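(* There exists an absolute constant $c$ with the following property. For every pair of positive integers $a$ and $b$, and every directed graph $G$ of directed treewidth at least $c\cdot a^6 \cdot b^8 \cdot \log^2(ab)$, there are directed graphs $G_1,G_2,\ldots,G_a$ such that: (1) each $G_i$ is a subgraph of $G$, (2) each vertex of $G$ belongs to at most four of the graphs $G_i$, and (3) each graph $G_i$ has directed treewidth at least $b$.
   Context: Directed treewidth is the standard notion of Johnson, Robertson, Seymour and Thomas.
   Formalization: For a=b=1 the factor log^2(ab) is read as 1 rather than 0, since with bound 0 a single vertex (directed treewidth 0) is a counterexample; log is base 2, and directed graphs are finite with natural numbers as vertices. *)

theory Defs
  imports Complex_Main
begin

text \<open>A finite directed graph on vertices of type nat: a pair (V, E) with E \<subseteq> V \<times> V.
  Any finite digraph is isomorphic to one of this form.\<close>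
type_synonym digraph = "nat set \<times> (nat \<times> nat) set"

definition verts :: "digraph \<Rightarrow> nat set" where "verts G = fst G"
definition arcs :: "digraph \<Rightarrow> (nat \<times> nat) set" where "arcs G = snd G"

definition wf_digraph :: "digraph \<Rightarrow> bool" where
  "wf_digraph G \<longleftrightarrow> finite (verts G) \<and> arcs G \<subseteq> verts G \<times> verts G"

definition subgraph :: "digraph \<Rightarrow> digraph \<Rightarrow> bool" where
  "subgraph H G \<longleftrightarrow> wf_digraph H \<and> verts H \<subseteq> verts G \<and> arcs H \<subseteq> arcs G"

text \<open>Arcs of G - Z.\<close>
definition arcs_minus :: "digraph \<Rightarrow> nat set \<Rightarrow> (nat \<times> nat) set" where
  "arcs_minus G Z = {(x, y). (x, y) \<in> arcs G \<and> x \<notin> Z \<and> y \<notin> Z}"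

text \<open>S \<subseteq> V(G) - Z is Z-normal: no directed walk in G - Z with first and last
  vertex in S uses a vertex of G - (Z \<union> S).\<close>
definition z_normal :: "digraph \<Rightarrow> nat set \<Rightarrow> nat set \<Rightarrow> bool" where
  "z_normal G Z S \<longleftrightarrow> S \<subseteq> verts G - Z \<and>
     \<not> (\<exists>u\<in>S. \<exists>v\<in>S. \<exists>w\<in>verts G - (Z \<union> S).
          (u, w) \<in> (arcs_minus G Z)\<^sup>* \<and> (w, v) \<in> (arcs_minus G Z)\<^sup>*)"

text \<open>An arborescence (out-tree) with node set T, arc set ER and root r0.\<close>
definition arborescence :: "nat set \<Rightarrow> (nat \<times> nat) set \<Rightarrow> nat \<Rightarrow> bool" where
  "arborescence T ER r0 \<longleftrightarrow> finite T \<and> r0 \<in> T \<and> ER \<subseteq> T \<times> T \<and>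
     (\<forall>s\<in>T. s = r0 \<longrightarrow> (\<forall>r. (r, s) \<notin> ER)) \<and>
     (\<forall>s\<in>T. s \<noteq> r0 \<longrightarrow> (\<exists>!r. (r, s) \<in> ER)) \<and>
     (\<forall>t\<in>T. (r0, t) \<in> ER\<^sup>*)"

text \<open>Arboreal decomposition (R, X, W) of G in the sense of Johnson, Robertson,
  Seymour and Thomas, of width at most w.\<close>
definition arboreal_decomposition ::
  "digraph \<Rightarrow> nat set \<Rightarrow> (nat \<times> nat) set \<Rightarrow> nat \<Rightarrow> (nat \<times> nat \<Rightarrow> nat set) \<Rightarrow> (nat \<Rightarrow> nat set) \<Rightarrow> bool"
  where
  "arboreal_decomposition G T ER r0 X W \<longleftrightarrow>
     arborescence T ER r0 \<and>
     (\<forall>t\<in>T. W t \<noteq> {}) \<and>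
     (\<Union>t\<in>T. W t) = verts G \<and>
     (\<forall>t\<in>T. \<forall>s\<in>T. t \<noteq> s \<longrightarrow> W t \<inter> W s = {}) \<and>
     (\<forall>e\<in>ER. X e \<subseteq> verts G) \<and>
     (\<forall>r s. (r, s) \<in> ER \<longrightarrow> z_normal G (X (r, s)) (\<Union>t\<in>{t\<in>T. (s, t) \<in> ER\<^sup>*}. W t))"

definition decomposition_width_le ::
  "nat set \<Rightarrow> (nat \<times> nat) set \<Rightarrow> (nat \<times> nat \<Rightarrow> nat set) \<Rightarrow> (nat \<Rightarrow> nat set) \<Rightarrow> nat \<Rightarrow> bool"
  where
  "decomposition_width_le T ER X W w \<longleftrightarrow>
     (\<forall>t\<in>T. card (W t \<union> (\<Union>e\<in>{e\<in>ER. fst e = t \<or> snd e = t}. X e)) \<le> w + 1)"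

text \<open>Directed treewidth: least width of an arboreal decomposition
  (by convention 0 for the graph with no vertices).\<close>
definition dtw :: "digraph \<Rightarrow> nat" where
  "dtw G = (if verts G = {} then 0 else
     (LEAST w. \<exists>T ER r0 X W. arboreal_decomposition G T ER r0 X W \<and>
                              decomposition_width_le T ER X W w))"

end

theory Submission
  imports Defs "HOL-Library.FuncSet"
begin

text \<open>
  Large directed treewidth yields a bramble of large order, a path through all its elements, and
  on that path many tokens between any two equally large sets of which Menger's theorem provides
  a linkage. Cut the path into \<open>7ab\<close> pieces \<open>P\<^sub>i\<close>, each with a set of incoming tokens followed
  by a set of outgoing ones, form \<open>a\<close> groups of \<open>7b\<close> pieces, and consider the linkages from the
  outgoing tokens of a piece to the incoming tokens of another piece of its group.

  If any two of these linkages have few intersecting pairs of paths, a counting argument selects one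
  path from each linkage so that the selected paths are disjoint. A group with its selected paths has
  directed treewidth at least \<open>b\<close>, since few vertices cannot separate most of its pieces from
  each other, and every vertex lies in at most two groups.

  Otherwise two linkages intersect densely. Close up each of them by a linkage going back, which
  permutes its paths, and cut both permutations into intervals. Some \<open>a\<close> disjoint pairs of intervals
  still intersect densely. Such a pair has directed treewidth at least \<open>b\<close>: advancing along
  one interval and returning along the other keeps it strongly connected. A vertex lies on at
  most one path of each of the four linkages involved.
\<close>

section \<open>Menger's theorem\<close>

text \<open>The parameters are found from the end backwards. A linkage has S paths. Two linkages
  with more than D * S intersecting pairs yield \<open>a\<close> good interval pairs, where D = 68 *
  a * 5 * (3 * b + 2): the factor \<open>a\<close> pays for the number of pairs, and 3 * b + 2
  bounds the steps of an interval that break when b vertices are deleted. With at most D * S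
  intersections for every two of the at most 49ab^2 linkages, counting finds disjoint
  representatives as soon as S \<ge> 4 * 49ab^2 * D, so S is of order a^2 b^3. All pieces together
  carry K = 7ab * 2S tokens, of order a^3 b^4. A separator between two token sets may have almost K
  vertices, so each of the two zones of a token must survive the deletion of that many, and the path
  has to be cut into 2K such zones. This takes a bramble of order 2K^2 and explains a^6 b^8.
  Incoming tokens precede outgoing ones because a path that arrives at a piece can only continue
  forwards. Both lower bounds on directed treewidth come from one descent in an arboreal
  decomposition, which gives the value b itself instead of a constant fraction of it.\<close>

definition restr :: "('a \<times> 'a) set \<Rightarrow> 'a set \<Rightarrow> ('a \<times> 'a) set" where
  "restr E Z = {(x, y). (x, y) \<in> E \<and> x \<notin> Z \<and> y \<notin> Z}"

definition is_path :: "('a \<times> 'a) set \<Rightarrow> 'a list \<Rightarrow> bool" where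
  "is_path E p \<longleftrightarrow> p \<noteq> [] \<and> distinct p \<and> successively (\<lambda>u v. (u, v) \<in> E) p"

text \<open>Indexing the paths by their first vertices makes following a linkage a function on
  vertices. Inner vertices of a path may lie in \<open>X\<close> or \<open>Y\<close>.\<close>

definition linkage :: "('a \<times> 'a) set \<Rightarrow> 'a set \<Rightarrow> 'a set \<Rightarrow> ('a \<Rightarrow> 'a list) \<Rightarrow> bool" where
  "linkage E X Y p \<longleftrightarrow>
     (\<forall>x\<in>X. is_path E (p x) \<and> hd (p x) = x \<and> last (p x) \<in> Y) \<and>
     (\<forall>x\<in>X. \<forall>y\<in>X. x \<noteq> y \<longrightarrow> set (p x) \<inter> set (p y) = {})"

text \<open>\<open>Z\<close> may use vertices of \<open>X\<close> and \<open>Y\<close>. A common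
  vertex of \<open>X\<close> and \<open>Y\<close> outside \<open>Z\<close> violates separation
  through the empty walk.\<close>

definition separates :: "('a \<times> 'a) set \<Rightarrow> 'a set \<Rightarrow> 'a set \<Rightarrow> 'a set \<Rightarrow> bool" where
  "separates E X Y Z \<longleftrightarrow> (\<forall>x\<in>X - Z. \<forall>y\<in>Y - Z. (x, y) \<notin> (restr E Z)\<^sup>*)"

lemma restr_mono: "E \<subseteq> F \<Longrightarrow> Z' \<subseteq> Z \<Longrightarrow> restr E Z \<subseteq> restr F Z'"
  by (auto simp: restr_def)

lemma restr_rtrancl_mono: "(x, y) \<in> (restr E Z)\<^sup>* \<Longrightarrow> E \<subseteq> F \<Longrightarrow> Z' \<subseteq> Z \<Longrightarrow> (x, y) \<in> (restr F Z')\<^sup>*"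
  using rtrancl_mono[OF restr_mono] by blast

lemma restr_rtrancl_notin: "(x, y) \<in> (restr E Z)\<^sup>* \<Longrightarrow> x \<notin> Z \<Longrightarrow> y \<notin> Z"
  by (induction rule: rtrancl_induct) (auto simp: restr_def)

lemma successively_reach:
  assumes "successively (\<lambda>u v. (u, v) \<in> E) (xs @ u # ys)" "set (u # ys) \<inter> Z = {}" "v \<in> set (u # ys)"
  shows "(u, v) \<in> (restr E Z)\<^sup>*"
  using assms
proof (induction ys arbitrary: xs u)
  case (Cons y ys)
  show ?case
  proof (cases "v = u")
    case False
    have "(y, v) \<in> (restr E Z)\<^sup>*"
      using Cons.IH[of "xs @ [u]" y] Cons.prems False by auto
    moreover have "(u, y) \<in> restr E Z"
      using Cons.prems by (auto simp: restr_def successively_append_iff)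
    ultimately show ?thesis by (rule converse_rtrancl_into_rtrancl[rotated])
  qed auto
qed auto

lemma is_path_appendD:
  assumes "is_path E (xs @ ys @ zs)" "ys \<noteq> []"
  shows "is_path E ys"
  using assms by (auto simp: is_path_def successively_append_iff)

lemma is_path_reach:
  assumes "is_path E (xs @ ys)" "u \<in> set xs" "v \<in> set ys" "set (xs @ ys) \<inter> Z = {}"
  shows "(u, v) \<in> (restr E Z)\<^sup>*"
proof -
  obtain a b where "xs = a @ u # b" using assms(2) by (meson split_list)
  then show ?thesis
    using successively_reach[of E a u "b @ ys" Z v] assms by (auto simp: is_path_def)
qed

lemma is_path_reach_last:
  assumes "is_path E p" "u \<in> set p" "set p \<inter> Z = {}"
  shows "(u, last p) \<in> (restr E Z)\<^sup>*"
proof -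
  obtain a b where p: "p = a @ u # b" using assms(2) by (meson split_list)
  then have l: "last p = last (u # b)" by simp
  show ?thesis
    unfolding l
  proof (rule successively_reach)
    show "successively (\<lambda>u v. (u, v) \<in> E) (a @ u # b)" using assms(1) p by (simp add: is_path_def)
    show "set (u # b) \<inter> Z = {}" using assms(3) p by auto
    show "last (u # b) \<in> set (u # b)" by (rule last_in_set) simp
  qed
qed

lemma is_path_hd_reach:
  assumes "is_path E p" "v \<in> set p" "set p \<inter> Z = {}"
  shows "(hd p, v) \<in> (restr E Z)\<^sup>*"
  using assms successively_reach[of E "[]" "hd p" "tl p" Z v] by (cases p) (auto simp: is_path_def)

lemma linkage_last_inj:
  assumes "linkage E X Y p"
  shows "inj_on (\<lambda>x. last (p x)) X"
proof (rule inj_onI, rule ccontr)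
  fix x y assume xy: "x \<in> X" "y \<in> X" "last (p x) = last (p y)" "x \<noteq> y"
  then have "last (p x) \<in> set (p x) \<inter> set (p y)"
    using assms by (metis Int_iff is_path_def last_in_set linkage_def)
  then show False using xy assms unfolding linkage_def by blast
qed

lemma linkage_last_bij:
  assumes "linkage E X Y p" "finite Y" "card X = card Y"
  shows "bij_betw (\<lambda>x. last (p x)) X Y"
proof -
  have "(\<lambda>x. last (p x)) ` X \<subseteq> Y" using assms(1) by (auto simp: linkage_def)
  then show ?thesis
    using linkage_last_inj[OF assms(1)] assms(2,3)
    by (metis bij_betw_def card_image card_subset_eq)
qed

text \<open>The two systems in the induction of Menger's theorem meet only in \<open>Z\<close>, since any other
  common vertex would yield an \<open>X\<close>-\<open>Y\<close> walk avoiding \<open>Z\<close>.\<close>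
lemma linkage_meet:
  assumes p: "linkage E A P p" and q: "linkage E Q Y q" and sep: "separates E X Y Z"
    and AX: "A \<subseteq> X"
    and finP: "finite P" and cA: "card A = card P"
    and ZP: "Z \<subseteq> P" and ZQ: "Z \<subseteq> Q"
    and aA: "a \<in> A" and bQ: "b \<in> Q" and v: "v \<in> set (p a)" "v \<in> set (q b)"
  shows "v \<in> Z \<and> v = last (p a) \<and> v = b"
proof -
  have bij: "bij_betw (\<lambda>x. last (p x)) A P" using linkage_last_bij[OF p finP cA] .
  \<comment> \<open>As \<open>card A = card P\<close>, every vertex of \<open>P\<close> is the end
    of some path, so by disjointness a path meets \<open>P\<close> only in its own end. Likewise
    every vertex of \<open>Q\<close> starts a path of the second system.\<close>
  have onlyP: "w = last (p a)" if w: "w \<in> set (p a)" "w \<in> P" for w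
  proof -
    obtain a' where a': "a' \<in> A" "w = last (p a')" using bij w(2) by (auto simp: bij_betw_def)
    have "p a' \<noteq> []" using p a'(1) by (simp add: linkage_def is_path_def)
    then have "w \<in> set (p a')" using a'(2) last_in_set by blast
    then have "set (p a) \<inter> set (p a') \<noteq> {}" using w(1) by blast
    then have "a = a'" using p aA a'(1) unfolding linkage_def by blast
    then show ?thesis using a'(2) by simp
  qed
  have onlyQ: "w = b" if w: "w \<in> set (q b)" "w \<in> Q" for w
  proof -
    have "w \<in> set (q w)" using q w(2) by (metis hd_in_set is_path_def linkage_def)
    then show ?thesis using w q bQ unfolding linkage_def by blast
  qed
  have "v \<in> Z"
  proof (rule ccontr)
    assume vZ: "v \<notin> Z"
    obtain l1 r1 where l1: "p a = l1 @ v # r1" using v(1) by (meson split_list)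
    obtain l2 r2 where l2: "q b = l2 @ v # r2" using v(2) by (meson split_list)
    have dp: "distinct (p a)" and sp: "is_path E (p a)" and dq: "distinct (q b)" and sq: "is_path E (q b)"
      using p q aA bQ by (auto simp: linkage_def is_path_def)
    have "last (p a) \<in> set (v # r1)" using l1 by (auto split: if_splits)
    then have l1Z: "set l1 \<inter> Z = {}" using onlyP ZP dp l1 by fastforce
    have "hd (q b) = b" using q bQ by (auto simp: linkage_def)
    then have "b \<in> set (l2 @ [v])" using l2 by (cases l2) auto
    then have r2Z: "set r2 \<inter> Z = {}" using onlyQ ZQ dq l2 by fastforce
    have "is_path E (l1 @ [v])" using sp l1 is_path_appendD[of E "[]" "l1 @ [v]" r1] by simp
    then have 1: "(hd (l1 @ [v]), v) \<in> (restr E Z)\<^sup>*"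
      using is_path_hd_reach[of E "l1 @ [v]" v Z] l1Z vZ by auto
    have "hd (l1 @ [v]) = a" using p aA l1 by (cases l1) (auto simp: linkage_def)
    moreover have "hd (l1 @ [v]) \<notin> Z" using l1Z vZ by (cases l1) auto
    moreover have "is_path E (v # r2)" using sq l2 is_path_appendD[of E l2 "v # r2" "[]"] by simp
    then have 2: "(v, last (v # r2)) \<in> (restr E Z)\<^sup>*"
      using is_path_reach_last[of E "v # r2" v Z] r2Z vZ by auto
    moreover have "last (v # r2) \<in> Y" using q bQ l2 by (auto simp: linkage_def split: if_splits)
    moreover have "last (v # r2) \<notin> Z" using restr_rtrancl_notin[OF 2 vZ] .
    ultimately show False
      using sep rtrancl_trans[OF 1 2] aA AX unfolding separates_def by blast
  qed
  then show ?thesis using onlyP[OF v(1)] onlyQ[OF v(2)] ZP ZQ by blast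
qed

text \<open>A walk from \<open>X\<close> that avoids \<open>W\<close> reaches neither
  \<open>x\<close> nor \<open>Z\<close>. So it never uses the new arc, it avoids \<open>Z\<close>,
  and it cannot end in \<open>Y\<close>.\<close>

lemma separates_before:
  assumes sep: "separates E X Y Z" and W: "separates E X (insert x Z) W"
  shows "separates (insert (x, y) E) X Y W"
  unfolding separates_def
proof (intro ballI notI)
  fix s t assume s: "s \<in> X - W" and t: "t \<in> Y - W" and st: "(s, t) \<in> (restr (insert (x, y) E) W)\<^sup>*"
  let ?P = "insert x Z"
  have no: "q \<notin> ?P" if "(s, q) \<in> (restr E W)\<^sup>*" for q
    using W s that restr_rtrancl_notin[OF that] unfolding separates_def by blast
  have "(s, t) \<in> (restr E (W \<union> Z))\<^sup>*"
    using st
  proof (induction rule: rtrancl_induct)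
    case (step u v)
    have u: "(s, u) \<in> (restr E W)\<^sup>*" using step.IH by (rule restr_rtrancl_mono) auto
    then have "u \<noteq> x" "u \<notin> Z" using no by auto
    then have uv: "(u, v) \<in> restr E W" using step.hyps by (auto simp: restr_def)
    then have "v \<notin> Z" using no u by (meson insertCI rtrancl.rtrancl_into_rtrancl)
    then have "(u, v) \<in> restr E (W \<union> Z)" using uv \<open>u \<notin> Z\<close> by (auto simp: restr_def)
    then show ?case using step.IH by (rule rtrancl_into_rtrancl[rotated])
  qed simp
  then have "(s, t) \<in> (restr E Z)\<^sup>*" by (rule restr_rtrancl_mono) auto
  moreover have "s \<notin> Z" using no[of s] by auto
  ultimately show False
    using sep s t restr_rtrancl_notin[of s t E Z] unfolding separates_def by blast
qed

lemma separates_endpoint: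
  assumes "separates E X Y Z" "z = x \<or> z = y"
  shows "separates (insert (x, y) E) X Y (insert z Z)"
proof -
  have "restr (insert (x, y) E) (insert z Z) \<subseteq> restr E Z" using assms(2) by (auto simp: restr_def)
  then show ?thesis using assms(1) rtrancl_mono unfolding separates_def by blast
qed

lemma restr_converse: "restr (E\<inverse>) Z = (restr E Z)\<inverse>"
  by (auto simp: restr_def)

lemma separates_converse: "separates (E\<inverse>) Y X Z \<longleftrightarrow> separates E X Y Z"
  unfolding separates_def restr_converse rtrancl_converse by blast

lemma separates_after:
  assumes "separates E X Y Z" and "separates E (insert y Z) Y W"
  shows "separates (insert (x, y) E) X Y W"
proof -
  have "separates (insert (y, x) (E\<inverse>)) Y X W"
    using separates_before[of "E\<inverse>" Y X Z y W x] assms by (simp add: separates_converse)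
  moreover have "insert (y, x) (E\<inverse>) = (insert (x, y) E)\<inverse>" by auto
  ultimately show ?thesis by (simp add: separates_converse)
qed

text \<open>Induction on the arcs. If the graph without (x, y) has a separator \<open>Z\<close> with
  fewer than k vertices, then adding x or y to \<open>Z\<close> gives sets of exactly k vertices
  that separate in the whole graph. The induction hypothesis links \<open>X\<close> to the first set
  and the second set to \<open>Y\<close>, and the two systems are glued along \<open>Z\<close> and
  (x, y).\<close>

theorem Menger:
  assumes "finite E" "finite X" "finite Y"
    and "\<And>Z. finite Z \<Longrightarrow> separates E X Y Z \<Longrightarrow> k \<le> card Z"
  shows "\<exists>A p. A \<subseteq> X \<and> card A = k \<and> linkage E A Y p"
  using assms
proof (induction E arbitrary: X Y rule: finite_induct)
  case empty
  have "separates {} X Y (X \<inter> Y)" by (auto simp: separates_def restr_def)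
  then have "k \<le> card (X \<inter> Y)" using empty by simp
  then obtain A where "A \<subseteq> X \<inter> Y" "card A = k" by (meson obtain_subset_with_card_n)
  moreover have "linkage {} A Y (\<lambda>x. [x])" using \<open>A \<subseteq> _\<close> by (auto simp: linkage_def is_path_def)
  ultimately show ?case by blast
next
  case (insert e E)
  obtain x y where e: "e = (x, y)" by (cases e)
  show ?case
  proof (cases "\<forall>Z. finite Z \<longrightarrow> separates E X Y Z \<longrightarrow> k \<le> card Z")
    case True
    then obtain A p where "A \<subseteq> X" "card A = k" "linkage E A Y p" using insert by metis
    moreover have "is_path (insert e E) q" if "is_path E q" for q
      using that unfolding is_path_def by (auto elim: successively_mono)
    ultimately show ?thesis unfolding linkage_def by blast
  next
    case False
    then obtain Z where Z: "finite Z" "separates E X Y Z" "card Z < k" by auto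
    let ?P = "insert x Z" and ?Q = "insert y Z"
    have "separates (insert e E) X Y ?P" "separates (insert e E) X Y ?Q"
      using separates_endpoint[OF Z(2), of x x y] separates_endpoint[OF Z(2), of y x y] e by auto
    then have "k \<le> card ?P" "k \<le> card ?Q" using insert.prems(3) Z(1) by auto
    then have cards: "card ?P = k" "card ?Q = k" "x \<notin> Z" "y \<notin> Z"
      using Z(1,3) by (auto simp: card_insert_if split: if_splits)
    have "\<And>W. finite W \<Longrightarrow> separates E X ?P W \<Longrightarrow> k \<le> card W"
      using separates_before[OF Z(2)] insert.prems(3) e by blast
    then obtain A p where A: "A \<subseteq> X" "card A = k" and p: "linkage E A ?P p"
      using insert.IH[of X ?P] insert.prems Z(1) by blast
    have "\<And>W. finite W \<Longrightarrow> separates E ?Q Y W \<Longrightarrow> k \<le> card W"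
      using separates_after[OF Z(2)] insert.prems(3) e by blast
    then obtain Q q where "Q \<subseteq> ?Q" "card Q = k" "linkage E Q Y q"
      using insert.IH[of ?Q Y] insert.prems Z(1) by blast
    then have q: "linkage E ?Q Y q" using cards Z(1) by (metis card_subset_eq finite_insert)
    note meet = linkage_meet[OF p q Z(2) A(1)]
    have mt: "v \<in> Z \<and> v = last (p a) \<and> v = b"
      if "a \<in> A" "b \<in> ?Q" "v \<in> set (p a)" "v \<in> set (q b)" for a b v
      using meet[of a b v] that Z(1) cards A(2) by auto
    \<comment> \<open>A path that ends in \<open>x\<close> crosses the arc to \<open>y\<close>. A
      path that ends in \<open>Z\<close> continues by the path starting there, whose first vertex is
      dropped because it is already present.\<close>
    define r where "r a = (if last (p a) = x then p a @ q y else p a @ tl (q (last (p a))))" for a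
    have succ: "successively (\<lambda>u v. (u, v) \<in> insert e E) s" if "is_path E s" for s
      using that unfolding is_path_def by (auto elim: successively_mono)
    have qs: "is_path E (q b)" "hd (q b) = b" "last (q b) \<in> Y" if "b \<in> ?Q" for b
      using q that by (auto simp: linkage_def)
    have ps: "is_path E (p a)" "hd (p a) = a" "last (p a) \<in> ?P" if "a \<in> A" for a
      using p that by (auto simp: linkage_def)
    have "is_path (insert e E) (r a) \<and> hd (r a) = a \<and> last (r a) \<in> Y" if a: "a \<in> A" for a
    proof (cases "last (p a) = x")
      case True
      have "set (p a) \<inter> set (q y) = {}" using mt[OF a, of y] cards by auto
      then show ?thesis
        using True ps[OF a] qs[of y] succ[of "p a"] succ[of "q y"] e
        by (auto simp: r_def is_path_def successively_append_iff)
    next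
      case False
      define b where "b = last (p a)"
      have b: "b \<in> Z" using False ps[OF a] by (auto simp: b_def)
      obtain q' where q': "q b = b # q'" using qs[of b] b by (cases "q b") (auto simp: is_path_def)
      have "set (p a) \<inter> set q' = {}"
        using mt[OF a, of b] q' b qs[of b] by (fastforce simp: is_path_def)
      moreover have "successively (\<lambda>u v. (u, v) \<in> insert e E) (b # q')" using succ qs[of b] b q' by auto
      ultimately show ?thesis
        using False ps[OF a] qs[of b] succ[of "p a"] q' b
        by (auto simp: r_def is_path_def successively_append_iff b_def[symmetric] successively_Cons last_append split: if_splits)
    qed
    moreover have "set (r a) \<inter> set (r a') = {}" if a: "a \<in> A" "a' \<in> A" "a \<noteq> a'" for a a'
    proof -
      define f where "f a = (if last (p a) = x then y else last (p a))" for a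
      have fQ: "f a \<in> ?Q" if "a \<in> A" for a using ps[OF that] by (auto simp: f_def)
      have inj: "last (p a) \<noteq> last (p a')" using linkage_last_inj[OF p] a by (auto simp: inj_on_def)
      have ff: "f a \<noteq> f a'" using inj ps[OF a(1)] ps[OF a(2)] cards by (auto simp: f_def)
      have sub: "set (r a) \<subseteq> set (p a) \<union> set (q (f a))" for a
      proof -
        have "set (tl l) \<subseteq> set l" for l :: "'a list" by (cases l) auto
        from this[of "q (last (p a))"] show ?thesis by (simp add: r_def f_def) blast
      qed
      have 1: "set (p a) \<inter> set (p a') = {}" using p a by (auto simp: linkage_def)
      have 2: "set (q (f a)) \<inter> set (q (f a')) = {}" using q fQ[OF a(1)] fQ[OF a(2)] ff
        unfolding linkage_def by blast
      have 3: "set (p a) \<inter> set (q (f a')) = {}" if a: "a \<in> A" "a' \<in> A" "f a \<noteq> f a'" for a a'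
      proof -
        have False if v: "v \<in> set (p a)" "v \<in> set (q (f a'))" for v
        proof -
          have m: "v \<in> Z" "last (p a) = v" "v = f a'" using mt[OF a(1) fQ[OF a(2)]] v by auto
          then have "f a = v" using cards unfolding f_def by auto
          then show False using a(3) m(3) by simp
        qed
        then show ?thesis by auto
      qed
      have 4: "set (p a') \<inter> set (q (f a)) = {}" using 3[OF a(2,1)] ff by simp
      have "set (r a) \<inter> set (r a') \<subseteq> (set (p a) \<union> set (q (f a))) \<inter> (set (p a') \<union> set (q (f a')))"
        by (rule Int_mono[OF sub sub])
      also have "\<dots> = {}"
        using 1 2 3[OF a(1,2) ff] 4 by (simp add: Int_Un_distrib Int_Un_distrib2 Int_commute)
      finally show ?thesis by simp
    qed
    ultimately have "linkage (insert e E) A Y r" unfolding linkage_def by simp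
    then show ?thesis using A by blast
  qed
qed

section \<open>A lower bound for directed treewidth\<close>

lemma arcs_minus_restr: "arcs_minus G Z = restr (arcs G) Z"
  by (simp add: arcs_minus_def restr_def)

lemma z_normal_closed:
  assumes "wf_digraph G" "z_normal G X S" "u \<in> S" "v \<in> S"
    and uw: "(u, w) \<in> (restr (arcs G) X)\<^sup>*" and "(w, v) \<in> (restr (arcs G) X)\<^sup>*"
  shows "w \<in> S"
proof (rule ccontr)
  assume "w \<notin> S"
  moreover have "w \<in> verts G - X"
  proof (cases "w = u")
    case False
    then have "w \<in> Range (restr (arcs G) X)"
      using uw by (auto elim: rtranclE)
    then show ?thesis using assms(1) by (auto simp: restr_def wf_digraph_def)
  qed (use assms in \<open>auto simp: z_normal_def\<close>)
  ultimately show False using assms unfolding z_normal_def arcs_minus_restr by blast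
qed

text \<open>Induction along the path from the root: a cycle through a node enters it by its only
  incoming arc, so it also passes through the parent. The root has no incoming arc at all.\<close>

lemma arborescence_acyclic:
  assumes "arborescence T ER r0" "t \<in> T"
  shows "(t, t) \<notin> ER\<^sup>+"
proof -
  have "(r0, t) \<in> ER\<^sup>*" using assms by (auto simp: arborescence_def)
  then show ?thesis
  proof (induction rule: rtrancl_induct)
    case base
    have "r0 \<in> T" using assms by (simp add: arborescence_def)
    then have "(r, r0) \<notin> ER" for r using assms by (auto simp: arborescence_def)
    then show ?case by (meson tranclE)
  next
    case (step u v)
    show ?case
    proof
      assume "(v, v) \<in> ER\<^sup>+"
      then obtain u' where u': "(v, u') \<in> ER\<^sup>*" "(u', v) \<in> ER" by (meson tranclD2)
      have "v \<in> T" "v \<noteq> r0" using step.hyps assms(1) by (auto simp: arborescence_def)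
      then have "u' = u" using u'(2) step.hyps assms(1) unfolding arborescence_def by blast
      then have "(u, u) \<in> ER\<^sup>+" using u' step.hyps by (meson rtrancl_into_trancl2)
      then show False using step.IH by simp
    qed
  qed
qed

text \<open>In a decomposition of small width, take a minimal subtree whose vertex set satisfies \<open>\<Phi>\<close>. With
  \<open>Y\<close> the bag of its root, the vertex \<open>v\<close> shows that a child satisfies \<open>\<Phi>\<close> as well.\<close>
lemma dtw_ge_descent:
  assumes wf: "wf_digraph G" and ne: "verts G \<noteq> {}" and root: "\<Phi> (verts G)"
    and step: "\<And>S X Y. z_normal G X S \<Longrightarrow> \<Phi> S \<Longrightarrow> X \<subseteq> Y \<Longrightarrow> Y \<subseteq> verts G \<Longrightarrow> card Y \<le> b \<Longrightarrow>
      \<exists>v\<in>S - Y. \<forall>S' X'. z_normal G X' S' \<longrightarrow> X' \<subseteq> Y \<longrightarrow> v \<in> S' \<longrightarrow> \<Phi> S'"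
  shows "b \<le> dtw G"
proof (rule ccontr)
  assume "\<not> b \<le> dtw G"
  have fin: "finite (verts G)" using wf by (simp add: wf_digraph_def)
  let ?P = "\<lambda>w. \<exists>T ER r0 X W. arboreal_decomposition G T ER r0 X W \<and> decomposition_width_le T ER X W w"
  \<comment> \<open>A single node with the bag \<open>verts G\<close> is a decomposition, so the
    \<open>LEAST\<close> in \<open>dtw\<close> is attained.\<close>
  have "?P (card (verts G))"
    by (rule exI[of _ "{0}"], rule exI[of _ "{}"], rule exI[of _ 0], rule exI[of _ "\<lambda>_. {}"],
        rule exI[of _ "\<lambda>_. verts G"])
      (use ne in \<open>auto simp: arboreal_decomposition_def arborescence_def decomposition_width_le_def\<close>)
  then have "?P (dtw G)" using ne unfolding dtw_def by (simp add: LeastI[of ?P])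
  then obtain T ER r0 X W where dec: "arboreal_decomposition G T ER r0 X W"
    and width: "decomposition_width_le T ER X W (dtw G)" by blast
  have arb: "arborescence T ER r0" using dec by (simp add: arboreal_decomposition_def)
  define D where "D t = {s \<in> T. (t, s) \<in> ER\<^sup>*}" for t
  define S where "S t = (\<Union>s\<in>D t. W s)" for t
  have finT: "finite T" using arb by (simp add: arborescence_def)
  have "D r0 = T" using arb by (auto simp: arborescence_def D_def)
  then have "S r0 = verts G" using dec by (simp add: S_def arboreal_decomposition_def)
  then have "r0 \<in> T \<and> \<Phi> (S r0)" using root arb by (simp add: arborescence_def)
  then obtain t where t: "t \<in> T" "\<Phi> (S t)"
    and min: "\<And>s. s \<in> T \<Longrightarrow> \<Phi> (S s) \<Longrightarrow> card (D t) \<le> card (D s)"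
    using ex_has_least_nat[of "\<lambda>t. t \<in> T \<and> \<Phi> (S t)" r0 "\<lambda>t. card (D t)"] by blast
  define Y where "Y = W t \<union> (\<Union>e\<in>{e\<in>ER. fst e = t \<or> snd e = t}. X e)"
  have "W t \<subseteq> verts G" using dec t(1) unfolding arboreal_decomposition_def by blast
  moreover have "\<forall>e\<in>ER. X e \<subseteq> verts G" using dec unfolding arboreal_decomposition_def by blast
  ultimately have YV: "Y \<subseteq> verts G" unfolding Y_def by blast
  \<comment> \<open>A width below \<open>b\<close> means that bags have at most \<open>b\<close>
    vertices.\<close>
  have cY: "card Y \<le> b"
    using width t(1) \<open>\<not> b \<le> dtw G\<close> unfolding decomposition_width_le_def Y_def by fastforce
  have norm: "z_normal G (X (r, s)) (S s)" if "(r, s) \<in> ER" for r s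
    using dec that unfolding arboreal_decomposition_def S_def D_def by blast
  \<comment> \<open>The root has no incoming arc to supply a label; since its subtree covers
    \<open>verts G\<close>, the empty set serves.\<close>
  have "\<exists>Xt. Xt \<subseteq> Y \<and> z_normal G Xt (S t)"
  proof (cases "t = r0")
    case True
    then have "z_normal G {} (S t)" using \<open>S r0 = verts G\<close> by (simp add: z_normal_def)
    then show ?thesis by blast
  next
    case False
    then obtain r where "(r, t) \<in> ER" using arb t(1) unfolding arborescence_def by blast
    then show ?thesis using norm by (intro exI[of _ "X (r, t)"]) (auto simp: Y_def)
  qed
  then obtain Xt where Xt: "Xt \<subseteq> Y" "z_normal G Xt (S t)" by blast
  obtain v where v: "v \<in> S t - Y"
    and next_set: "\<And>S' X'. z_normal G X' S' \<Longrightarrow> X' \<subseteq> Y \<Longrightarrow> v \<in> S' \<Longrightarrow> \<Phi> S'"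
    using step[OF Xt(2) t(2) Xt(1) YV cY] by blast
  then obtain s where s: "s \<in> D t" "v \<in> W s" by (auto simp: S_def)
  have "s \<noteq> t" using v s(2) by (auto simp: Y_def)
  then obtain c where c: "(t, c) \<in> ER" "(c, s) \<in> ER\<^sup>*" using s(1) unfolding D_def
    by (auto elim: converse_rtranclE)
  have cT: "c \<in> T" using c(1) arb by (auto simp: arborescence_def)
  have "v \<in> S c" using s c by (auto simp: S_def D_def)
  moreover have "X (t, c) \<subseteq> Y" using c(1) by (force simp: Y_def)
  ultimately have "\<Phi> (S c)" using next_set norm[OF c(1)] by blast
  then have "card (D t) \<le> card (D c)" using min cT by blast
  moreover have "D c \<subset> D t"
  proof -
    have "t \<notin> D c"
      using arborescence_acyclic[OF arb t(1)] rtrancl_into_trancl2[OF c(1), of t] by (auto simp: D_def)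
    moreover have "t \<in> D t" using t(1) by (simp add: D_def)
    moreover have "D c \<subseteq> D t"
      using c(1) unfolding D_def by (auto intro: converse_rtrancl_into_rtrancl)
    ultimately show ?thesis by blast
  qed
  moreover have "finite (D t)" using finT by (simp add: D_def)
  ultimately show False by (meson psubset_card_mono not_less)
qed

section \<open>An upper bound for directed treewidth\<close>

definition scc :: "digraph \<Rightarrow> nat set \<Rightarrow> nat \<Rightarrow> nat set" where
  "scc G Z u = {w \<in> verts G - Z. (u, w) \<in> (restr (arcs G) Z)\<^sup>* \<and> (w, u) \<in> (restr (arcs G) Z)\<^sup>*}"

lemma scc_refl: "u \<in> verts G - Z \<Longrightarrow> u \<in> scc G Z u"
  by (simp add: scc_def)

lemma scc_eq: "w \<in> scc G Z u \<Longrightarrow> scc G Z w = scc G Z u"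
  by (auto simp: scc_def intro: rtrancl_trans)

lemma scc_antimono: "Z \<subseteq> Z' \<Longrightarrow> scc G Z' u \<subseteq> scc G Z u"
  by (auto simp: scc_def intro: restr_rtrancl_mono)

text \<open>A walk in G - Z between two vertices of a strong component stays in that component.
  There, avoiding \<open>A \<inter> scc G Z u\<close> is the same as avoiding \<open>A\<close>, so
  the normality of \<open>S\<close> keeps the walk in \<open>S\<close>.\<close>

lemma z_normal_scc:
  assumes wf: "wf_digraph G" and norm: "z_normal G A S" and u: "u \<in> verts G - Z"
  shows "z_normal G (Z \<union> (A \<inter> scc G Z u)) (S \<inter> scc G Z u)"
proof -
  let ?K = "scc G Z u" and ?R = "restr (arcs G) (Z \<union> (A \<inter> scc G Z u))"
  have sub: "(p, q) \<in> (restr (arcs G) Z)\<^sup>*" if "(p, q) \<in> ?R\<^sup>*" for p q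
    using restr_rtrancl_mono[OF that] by blast
  have inK: "p \<in> ?K" if "x \<in> ?K" "y \<in> ?K" "(x, p) \<in> ?R\<^sup>*" "(p, y) \<in> ?R\<^sup>*" for x y p
  proof -
    have "(u, p) \<in> (restr (arcs G) Z)\<^sup>*" "(p, u) \<in> (restr (arcs G) Z)\<^sup>*"
      using that sub[of x p] sub[of p y] by (auto simp: scc_def intro: rtrancl_trans)
    \<comment> \<open>\<open>verts G\<close> is normal with respect to the empty set, so walks
      between vertices never leave the vertex set.\<close>
    moreover have "p \<in> verts G"
      using z_normal_closed[OF wf, of "{}" "verts G" x y p] that restr_rtrancl_mono[of _ _ _ _ "arcs G" "{}"]
      by (auto simp: z_normal_def scc_def)
    moreover have "p \<notin> Z" using restr_rtrancl_notin[OF sub[OF that(3)]] that(1) by (simp add: scc_def)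
    ultimately show ?thesis by (simp add: scc_def)
  qed
  have reach: "(p, q) \<in> (restr (arcs G) A)\<^sup>*"
    if xy: "x \<in> ?K" "y \<in> ?K" and xp: "(x, p) \<in> ?R\<^sup>*" and pq: "(p, q) \<in> ?R\<^sup>*" and qy: "(q, y) \<in> ?R\<^sup>*"
    for x y p q
    using pq qy
  proof (induction rule: rtrancl_induct)
    case (step s t)
    have sy: "(s, y) \<in> ?R\<^sup>*" using step by (meson converse_rtrancl_into_rtrancl)
    have xs: "(x, s) \<in> ?R\<^sup>*" using xp step by (meson rtrancl_trans)
    have xt: "(x, t) \<in> ?R\<^sup>*" using xs step by (meson rtrancl.rtrancl_into_rtrancl)
    have "s \<in> ?K" "t \<in> ?K" using inK[OF xy xs sy] inK[OF xy xt step.prems] by auto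
    then have "(s, t) \<in> restr (arcs G) A" using step.hyps by (auto simp: restr_def)
    then show ?case using step.IH[OF sy] by (meson rtrancl.rtrancl_into_rtrancl)
  qed simp
  have "w \<in> S \<inter> ?K"
    if xy: "x \<in> S \<inter> ?K" "y \<in> S \<inter> ?K" and xw: "(x, w) \<in> ?R\<^sup>*" and wy: "(w, y) \<in> ?R\<^sup>*" for x y w
  proof -
    have "(x, w) \<in> (restr (arcs G) A)\<^sup>*" using reach[of x y x w] xy xw wy by auto
    moreover have "(w, y) \<in> (restr (arcs G) A)\<^sup>*" using reach[of x y w y] xy xw wy by auto
    ultimately show ?thesis using z_normal_closed[OF wf norm] inK[of x y w] xy xw wy by auto
  qed
  moreover have "S \<inter> ?K \<subseteq> verts G - (Z \<union> (A \<inter> ?K))" using norm by (auto simp: z_normal_def scc_def)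
  ultimately show ?thesis unfolding z_normal_def arcs_minus_restr by blast
qed

definition bag where
  "bag ER X W A r t = W t \<union> (\<Union>e\<in>{e\<in>ER. fst e = t \<or> snd e = t}. X e) \<union> (if t = r then A else {})"

text \<open>Here \<open>A\<close> becomes the label of the arc that attaches the root to a larger tree. Every node
  belongs to its own \<open>W\<close>-set, which makes the node sets of disjoint parts disjoint.\<close>
definition partial_dec :: "digraph \<Rightarrow> nat \<Rightarrow> nat set \<Rightarrow> nat set \<Rightarrow> nat set \<Rightarrow> (nat \<times> nat) set \<Rightarrow> nat \<Rightarrow>
    (nat \<times> nat \<Rightarrow> nat set) \<Rightarrow> (nat \<Rightarrow> nat set) \<Rightarrow> bool" where
  "partial_dec G m A S T ER r X W \<longleftrightarrow>
     arborescence T ER r \<and> T \<subseteq> S \<and> (\<forall>t\<in>T. t \<in> W t) \<and> (\<Union>t\<in>T. W t) = S \<and>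
     (\<forall>t\<in>T. \<forall>s\<in>T. t \<noteq> s \<longrightarrow> W t \<inter> W s = {}) \<and> (\<forall>e\<in>ER. X e \<subseteq> verts G) \<and>
     (\<forall>a s. (a, s) \<in> ER \<longrightarrow> z_normal G (X (a, s)) (\<Union>t\<in>{t\<in>T. (s, t) \<in> ER\<^sup>*}. W t)) \<and>
     (\<forall>t\<in>T. card (bag ER X W A r t) \<le> m)"

text \<open>\<open>\<kappa>\<close> abstracts the strong components of G - Z. A new root
  \<open>v\<close> takes \<open>S \<inter> Z\<close>, and the tree of each component
  \<open>K\<close> hangs below it by an arc labelled \<open>Z \<union> (A \<inter> K)\<close>. A
  node is a vertex of its own component, so \<open>\<kappa> t\<close> tells which subtree contains
  the node \<open>t\<close>.\<close>

lemma partial_dec_join: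
  fixes \<kappa> :: "nat \<Rightarrow> nat set" and A S Z :: "nat set"
  defines "\<K> \<equiv> \<kappa> ` (S - Z)"
  assumes fin: "finite (verts G)" and SV: "S \<subseteq> verts G" and AV: "A \<subseteq> verts G" and ZV: "Z \<subseteq> verts G"
    and v: "v \<in> S \<inter> Z"
    and \<kappa>_refl: "\<And>u. u \<in> S - Z \<Longrightarrow> u \<in> \<kappa> u"
    and \<kappa>_eq: "\<And>u w. u \<in> S - Z \<Longrightarrow> w \<in> \<kappa> u \<Longrightarrow> \<kappa> w = \<kappa> u \<and> w \<notin> Z"
    and norm: "\<And>u. u \<in> S - Z \<Longrightarrow> z_normal G (Z \<union> (A \<inter> \<kappa> u)) (S \<inter> \<kappa> u)"
    and sub: "\<And>K. K \<in> \<K> \<Longrightarrow> partial_dec G m (Z \<union> (A \<inter> K)) (S \<inter> K) (fT K) (fE K) (fr K) (fX K) (fW K)"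
    and cZA: "card (Z \<union> A) \<le> m"
  shows "\<exists>T ER r X W. partial_dec G m A S T ER r X W"
proof -
  have arbK: "arborescence (fT K) (fE K) (fr K)" if "K \<in> \<K>" for K
    using sub[OF that] by (simp add: partial_dec_def)
  have frT: "fr K \<in> fT K" if "K \<in> \<K>" for K using arbK[OF that] by (simp add: arborescence_def)
  have fE_sub: "fE K \<subseteq> fT K \<times> fT K" if "K \<in> \<K>" for K using arbK[OF that] by (simp add: arborescence_def)
  have in_fT: "t \<in> S" "t \<in> K" "t \<notin> Z" "\<kappa> t = K" "t \<noteq> v" if K: "K \<in> \<K>" and t: "t \<in> fT K" for K t
  proof -
    have "t \<in> S \<inter> K" using sub[OF K] t unfolding partial_dec_def by blast
    then show *: "t \<in> S" "t \<in> K" by auto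
    obtain u where u: "u \<in> S - Z" "K = \<kappa> u" using K by (auto simp: \<K>_def)
    have "\<kappa> t = \<kappa> u \<and> t \<notin> Z" using \<kappa>_eq[OF u(1), of t] *(2) u(2) by blast
    then show "t \<notin> Z" "\<kappa> t = K" using u(2) by blast+
    from this(1) show "t \<noteq> v" using v by blast
  qed
  define T where "T = insert v (\<Union>K\<in>\<K>. fT K)"
  define ER where "ER = (\<lambda>K. (v, fr K)) ` \<K> \<union> (\<Union>K\<in>\<K>. fE K)"
  define W where "W t = (if t = v then S \<inter> Z else fW (\<kappa> t) t)" for t
  define X where "X e = (if fst e = v then Z \<union> (A \<inter> \<kappa> (snd e)) else fX (\<kappa> (fst e)) e)" for e
  have ER_cases: "(r = v \<and> (\<exists>K\<in>\<K>. s = fr K)) \<or> (\<exists>K\<in>\<K>. (r, s) \<in> fE K \<and> r \<in> fT K \<and> s \<in> fT K)"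
    if "(r, s) \<in> ER" for r s
    using that fE_sub unfolding ER_def by blast
  have ER_fT: "(t, s) \<in> ER \<longleftrightarrow> (t, s) \<in> fE K" if Kt: "K \<in> \<K>" "t \<in> fT K" for K t s
  proof
    assume "(t, s) \<in> ER"
    then obtain L where "L \<in> \<K>" "(t, s) \<in> fE L" "t \<in> fT L"
      using ER_cases[of t s] in_fT(5)[OF Kt] by blast
    then show "(t, s) \<in> fE K" using in_fT(4)[OF Kt] in_fT(4)[of L t] by simp
  qed (use Kt in \<open>auto simp: ER_def\<close>)
  have ER_v: "\<exists>K\<in>\<K>. s = fr K" if "(v, s) \<in> ER" for s
    using ER_cases[OF that] in_fT(5) by blast
  have v_no_in: "(r, v) \<notin> ER" for r
    using ER_cases[of r v] frT in_fT(5) by blast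
  have finK: "finite \<K>" using fin SV by (auto simp: \<K>_def intro: finite_subset)
  have sub_iff: "t \<in> T \<and> (s, t) \<in> ER\<^sup>* \<longleftrightarrow> t \<in> fT K \<and> (s, t) \<in> (fE K)\<^sup>*" if K: "K \<in> \<K>" "s \<in> fT K" for K s t
  proof
    assume "t \<in> T \<and> (s, t) \<in> ER\<^sup>*"
    then have "(s, t) \<in> ER\<^sup>*" by simp
    then show "t \<in> fT K \<and> (s, t) \<in> (fE K)\<^sup>*"
    proof (induction rule: rtrancl_induct)
      case (step a b)
      then have "(a, b) \<in> fE K" using ER_fT[OF K(1)] by blast
      then show ?case using step.IH fE_sub[OF K(1)] by (auto intro: rtrancl_into_rtrancl)
    qed (use K in auto)
  next
    have "fE K \<subseteq> ER" using K by (auto simp: ER_def)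
    moreover assume "t \<in> fT K \<and> (s, t) \<in> (fE K)\<^sup>*"
    ultimately show "t \<in> T \<and> (s, t) \<in> ER\<^sup>*" using K rtrancl_mono unfolding T_def by blast
  qed
  have W_fT: "W t = fW K t" if "K \<in> \<K>" "t \<in> fT K" for K t
    using in_fT[OF that] by (simp add: W_def)
  have subtree: "(\<Union>t\<in>{t\<in>T. (s, t) \<in> ER\<^sup>*}. W t) = (\<Union>t\<in>{t\<in>fT K. (s, t) \<in> (fE K)\<^sup>*}. fW K t)"
    if "K \<in> \<K>" "s \<in> fT K" for K s
    using sub_iff[OF that] W_fT[OF that(1)] by auto
  have WK: "fW K t \<subseteq> S \<inter> K" if "K \<in> \<K>" "t \<in> fT K" for K t
    using sub[OF that(1)] that(2) unfolding partial_dec_def by blast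
  have K_Z: "K \<inter> Z = {}" if K: "K \<in> \<K>" for K
  proof -
    obtain u where "u \<in> S - Z" "K = \<kappa> u" using K by (auto simp: \<K>_def)
    then show ?thesis using \<kappa>_eq by blast
  qed
  have K_disj: "K = L" if KL: "K \<in> \<K>" "L \<in> \<K>" "x \<in> K" "x \<in> L" for K L x
  proof -
    obtain u where u: "u \<in> S - Z" "K = \<kappa> u" using KL(1) unfolding \<K>_def by blast
    obtain w where w: "w \<in> S - Z" "L = \<kappa> w" using KL(2) unfolding \<K>_def by blast
    have "\<kappa> x = \<kappa> u" using \<kappa>_eq[OF u(1), of x] KL(3) u(2) by simp
    moreover have "\<kappa> x = \<kappa> w" using \<kappa>_eq[OF w(1), of x] KL(4) w(2) by simp
    ultimately show ?thesis using u(2) w(2) by simp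
  qed
  have XV: "\<forall>e\<in>ER. X e \<subseteq> verts G"
  proof
    fix e assume e: "e \<in> ER"
    show "X e \<subseteq> verts G"
    proof (cases "fst e = v")
      case False
      then obtain K where "K \<in> \<K>" "e \<in> fE K" "fst e \<in> fT K" using e ER_cases[of "fst e" "snd e"] by auto
      then show ?thesis using sub[of K] in_fT[of K "fst e"] False by (auto simp: partial_dec_def X_def)
    qed (use ZV AV in \<open>auto simp: X_def\<close>)
  qed
  have "arborescence T ER v"
    unfolding arborescence_def
  proof (intro conjI ballI impI allI)
    show "finite T" using finK arbK by (auto simp: T_def arborescence_def)
    show "v \<in> T" by (simp add: T_def)
    show "ER \<subseteq> T \<times> T" using frT fE_sub unfolding ER_def T_def by blast
  next
    fix s r assume "s = v"
    then show "(r, s) \<notin> ER" using v_no_in by simp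
  next
    fix s assume "s \<in> T" "s \<noteq> v"
    then obtain K where K: "K \<in> \<K>" "s \<in> fT K" by (auto simp: T_def)
    show "\<exists>!r. (r, s) \<in> ER"
    proof (cases "s = fr K")
      case True
      have no: "(r, s) \<notin> fE K" for r using arbK[OF K(1)] True K(2) unfolding arborescence_def by blast
      have "r = v" if "(r, s) \<in> ER" for r
        using ER_cases[OF that] no in_fT(4) K by blast
      moreover have "(v, s) \<in> ER" using K True by (auto simp: ER_def)
      ultimately show ?thesis by blast
    next
      case False
      then have ex1: "\<exists>!r. (r, s) \<in> fE K"
        using arbK[OF K(1)] K(2) unfolding arborescence_def by simp
      then obtain r where r: "(r, s) \<in> fE K" by blast
      have uniq: "r' = r" if "(r', s) \<in> fE K" for r' using ex1 r that by blast
      have "(r, s) \<in> ER" using r K by (auto simp: ER_def)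
      moreover have "r' = r" if "(r', s) \<in> ER" for r'
        using ER_cases[OF that] False K uniq in_fT(4) frT by metis
      ultimately show ?thesis by blast
    qed
  next
    fix t assume "t \<in> T"
    show "(v, t) \<in> ER\<^sup>*"
    proof (cases "t = v")
      case False
      then obtain K where K: "K \<in> \<K>" "t \<in> fT K" using \<open>t \<in> T\<close> by (auto simp: T_def)
      then have "(fr K, t) \<in> (fE K)\<^sup>*" using arbK by (simp add: arborescence_def)
      then have "(fr K, t) \<in> ER\<^sup>*" using sub_iff[OF K(1) frT[OF K(1)]] K(2) by blast
      moreover have "(v, fr K) \<in> ER" using K by (auto simp: ER_def)
      ultimately show ?thesis by (rule converse_rtrancl_into_rtrancl[rotated])
    qed simp
  qed
  moreover have "T \<subseteq> S" using in_fT v by (auto simp: T_def)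
  moreover have "\<forall>t\<in>T. t \<in> W t"
  proof
    fix t assume "t \<in> T"
    then consider "t = v" | K where "K \<in> \<K>" "t \<in> fT K" by (auto simp: T_def)
    then show "t \<in> W t"
    proof cases
      case (2 K)
      then show ?thesis using sub[of K] W_fT by (auto simp: partial_dec_def)
    qed (use v in \<open>auto simp: W_def\<close>)
  qed
  moreover have "(\<Union>t\<in>T. W t) = S"
  proof -
    have "(\<Union>t\<in>T. W t) = W v \<union> (\<Union>K\<in>\<K>. \<Union>t\<in>fT K. W t)" by (auto simp: T_def)
    also have "\<dots> = (S \<inter> Z) \<union> (\<Union>K\<in>\<K>. \<Union>t\<in>fT K. fW K t)" using W_fT by (simp add: W_def[of v])
    also have "\<dots> = (S \<inter> Z) \<union> (\<Union>K\<in>\<K>. S \<inter> K)" using sub by (simp add: partial_dec_def)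
    also have "\<dots> = S" using \<kappa>_refl by (auto simp: \<K>_def)
    finally show ?thesis .
  qed
  moreover have "\<forall>t\<in>T. \<forall>s\<in>T. t \<noteq> s \<longrightarrow> W t \<inter> W s = {}"
  proof -
    have vt: "W v \<inter> W t = {}" if "K \<in> \<K>" "t \<in> fT K" for K t
      using WK[OF that] K_Z[OF that(1)] W_fT[OF that] by (auto simp: W_def)
    have tt: "W t \<inter> W s = {}" if "K \<in> \<K>" "t \<in> fT K" "L \<in> \<K>" "s \<in> fT L" "t \<noteq> s" for K t L s
    proof (cases "K = L")
      case True
      then show ?thesis using sub[of K] that W_fT by (simp add: partial_dec_def)
    next
      case False
      then show ?thesis using K_disj WK[of K t] WK[of L s] W_fT that by blast
    qed
    show ?thesis using vt tt unfolding T_def by blast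
  qed
  moreover have "\<forall>a s. (a, s) \<in> ER \<longrightarrow> z_normal G (X (a, s)) (\<Union>t\<in>{t\<in>T. (s, t) \<in> ER\<^sup>*}. W t)"
  proof (intro allI impI)
    fix a s assume "(a, s) \<in> ER"
    then consider K where "a = v" "K \<in> \<K>" "s = fr K" | K where "K \<in> \<K>" "(a, s) \<in> fE K" "a \<in> fT K" "s \<in> fT K"
      using ER_cases by blast
    then show "z_normal G (X (a, s)) (\<Union>t\<in>{t\<in>T. (s, t) \<in> ER\<^sup>*}. W t)"
    proof cases
      case (1 K)
      have "(\<Union>t\<in>{t\<in>T. (s, t) \<in> ER\<^sup>*}. W t) = (\<Union>t\<in>fT K. fW K t)"
      proof -
        have "{t \<in> fT K. (fr K, t) \<in> (fE K)\<^sup>*} = fT K"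
          using arbK[OF 1(2)] by (auto simp: arborescence_def)
        then show ?thesis using subtree[OF 1(2) frT[OF 1(2)]] 1(3) by simp
      qed
      also have "\<dots> = S \<inter> K" using sub[OF 1(2)] by (simp add: partial_dec_def)
      finally show ?thesis using 1 norm in_fT(4)[OF 1(2) frT[OF 1(2)]] by (auto simp: X_def \<K>_def)
    next
      case (2 K)
      then show ?thesis using subtree[OF 2(1,4)] sub[OF 2(1)] in_fT[OF 2(1,3)]
        by (simp add: partial_dec_def X_def)
    qed
  qed
  moreover have "\<forall>t\<in>T. card (bag ER X W A v t) \<le> m"
  proof
    fix t assume "t \<in> T"
    then consider "t = v" | K where "K \<in> \<K>" "t \<in> fT K" by (auto simp: T_def)
    then show "card (bag ER X W A v t) \<le> m"
    proof cases
      case 1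
      have "X e \<subseteq> Z \<union> A" if "e \<in> ER" "fst e = v \<or> snd e = v" for e
      proof -
        have "fst e = v" using that v_no_in[of "fst e"] by (metis prod.collapse)
        then show ?thesis by (auto simp: X_def)
      qed
      then have "bag ER X W A v t \<subseteq> Z \<union> A" using 1 unfolding bag_def W_def by auto
      moreover have "finite (Z \<union> A)" using finite_subset[OF _ fin] ZV AV by simp
      ultimately have "card (bag ER X W A v t) \<le> card (Z \<union> A)" by (rule card_mono[rotated])
      then show ?thesis using cZA by (rule le_trans)
    next
      case (2 K)
      \<comment> \<open>The new arc from \<open>v\<close> to \<open>fr K\<close> adds its label to
        the bag of \<open>fr K\<close>. In the smaller tree this label is already counted, as the
        set attached to the root.\<close>
      let ?B = "bag (fE K) (fX K) (fW K) (Z \<union> (A \<inter> K)) (fr K) t"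
      have "X e \<subseteq> ?B" if e: "e \<in> ER" "fst e = t \<or> snd e = t" for e
      proof (cases "fst e = v")
        case True
        then have "snd e = t" using e(2) in_fT(5)[OF 2] by simp
        moreover obtain L where L: "L \<in> \<K>" "snd e = fr L"
          using ER_v[of "snd e"] e(1) True by (metis prod.collapse)
        ultimately have "L = K" using in_fT(4)[OF L(1) frT[OF L(1)]] in_fT(4)[OF 2] by simp
        then show ?thesis using True L in_fT(4)[OF L(1) frT[OF L(1)]] \<open>snd e = t\<close>
          by (auto simp: X_def bag_def)
      next
        case False
        then obtain L where L: "L \<in> \<K>" "e \<in> fE L" "fst e \<in> fT L" "snd e \<in> fT L"
          using e(1) ER_cases[of "fst e" "snd e"] by auto
        have "L = K" using e(2) in_fT(4)[OF 2] in_fT(4)[OF L(1,3)] in_fT(4)[OF L(1,4)] by auto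
        then show ?thesis using L e(2) in_fT[OF L(1,3)] False by (auto simp: X_def bag_def)
      qed
      moreover have "W t \<subseteq> ?B" using W_fT[OF 2] by (auto simp: bag_def)
      ultimately have "bag ER X W A v t \<subseteq> ?B" using in_fT(5)[OF 2] unfolding bag_def[of ER] by auto
      moreover have "?B \<subseteq> verts G"
      proof -
        have "\<forall>e\<in>fE K. fX K e \<subseteq> verts G" using sub[OF 2(1)] by (simp add: partial_dec_def)
        then show ?thesis using WK[OF 2] SV ZV AV unfolding bag_def by auto
      qed
      moreover have "card ?B \<le> m" using sub[OF 2(1)] 2(2) by (simp add: partial_dec_def)
      ultimately show ?thesis using fin by (meson card_mono finite_subset le_trans)
    qed
  qed
  ultimately show ?thesis using XV unfolding partial_dec_def by blast
qed

text \<open>The bound 2 * z + 2 on \<open>A\<close> reproduces itself: the separator has at most z +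
  1 vertices and a component holds at most half of \<open>A\<close>, so the next label has at most
  (z + 1) + (z + 1) vertices. The bag \<open>Z \<union> A\<close> has at most 3 * z + 3.\<close>

lemma partial_dec_exists:
  assumes wf: "wf_digraph G"
    and bal: "\<And>A. A \<subseteq> verts G \<Longrightarrow> \<exists>Z. Z \<subseteq> verts G \<and> card Z \<le> z \<and>
      (\<forall>u\<in>verts G - Z. 2 * card (A \<inter> scc G Z u) \<le> card A)"
    and "S \<noteq> {}" "z_normal G A S" "A \<subseteq> verts G" "card A \<le> 2 * z + 2"
  shows "\<exists>T ER r X W. partial_dec G (3 * z + 3) A S T ER r X W"
  using assms(3-)
proof (induction "card S" arbitrary: S A rule: less_induct)
  case less
  have fin: "finite (verts G)" using wf by (simp add: wf_digraph_def)
  have SV: "S \<subseteq> verts G" using less.prems(2) by (auto simp: z_normal_def)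
  obtain v where v: "v \<in> S" using less.prems(1) by blast
  obtain Z0 where Z0: "Z0 \<subseteq> verts G" "card Z0 \<le> z"
    and bal0: "\<And>u. u \<in> verts G - Z0 \<Longrightarrow> 2 * card (A \<inter> scc G Z0 u) \<le> card A"
    using bal[OF less.prems(3)] by blast
  \<comment> \<open>One vertex of \<open>S\<close> is added to the balanced separator so that
    \<open>S\<close> shrinks in every component and the induction proceeds.\<close>
  define Z where "Z = insert v Z0"
  have ZV: "Z \<subseteq> verts G" using Z0 v SV by (auto simp: Z_def)
  have finZ: "finite Z" using ZV fin by (rule finite_subset)
  have cZ: "card Z \<le> z + 1" using Z0 card_insert_le_m1[of "z + 1" Z0 v] by (auto simp: Z_def)
  have norm: "z_normal G (Z \<union> (A \<inter> scc G Z u)) (S \<inter> scc G Z u)" if "u \<in> S - Z" for u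
    using z_normal_scc[OF wf less.prems(2), of u Z] that SV by auto
  have child: "\<exists>T ER r X W. partial_dec G (3 * z + 3) (Z \<union> (A \<inter> scc G Z u)) (S \<inter> scc G Z u) T ER r X W"
    if u: "u \<in> S - Z" for u
  proof (rule less.hyps)
    have "v \<notin> scc G Z u" by (simp add: scc_def Z_def)
    then have "S \<inter> scc G Z u \<subset> S" using v by blast
    then show "card (S \<inter> scc G Z u) < card S" using fin SV by (meson finite_subset psubset_card_mono)
    show "S \<inter> scc G Z u \<noteq> {}" using scc_refl[of u G Z] u SV by blast
    show "z_normal G (Z \<union> (A \<inter> scc G Z u)) (S \<inter> scc G Z u)" using norm[OF u] .
    show "Z \<union> (A \<inter> scc G Z u) \<subseteq> verts G" using ZV less.prems(3) by auto
    have "2 * card (A \<inter> scc G Z0 u) \<le> card A" using bal0 u SV by (auto simp: Z_def)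
    moreover have "A \<inter> scc G Z u \<subseteq> A \<inter> scc G Z0 u" using scc_antimono[of Z0 Z G u] by (auto simp: Z_def)
    moreover have "finite (A \<inter> scc G Z0 u)" using fin less.prems(3) by (meson finite_Int finite_subset)
    ultimately have "2 * card (A \<inter> scc G Z u) \<le> card A" by (meson card_mono le_trans mult_le_mono2)
    then show "card (Z \<union> (A \<inter> scc G Z u)) \<le> 2 * z + 2"
      using cZ less.prems(4) card_Un_le[of Z "A \<inter> scc G Z u"] by linarith
  qed
  have ex: "\<forall>K\<in>(scc G Z) ` (S - Z). \<exists>q. case q of (T, ER, r, X, W) \<Rightarrow>
      partial_dec G (3 * z + 3) (Z \<union> (A \<inter> K)) (S \<inter> K) T ER r X W"
    using child by (simp add: split_paired_Ex)
  obtain f where f: "\<forall>K\<in>(scc G Z) ` (S - Z). case f K of (T, ER, r, X, W) \<Rightarrow>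
      partial_dec G (3 * z + 3) (Z \<union> (A \<inter> K)) (S \<inter> K) T ER r X W"
    using bchoice[OF ex] by blast
  show ?case
  proof (rule partial_dec_join[where \<kappa> = "scc G Z" and Z = Z and v = v and fT = "\<lambda>K. fst (f K)"
      and fE = "\<lambda>K. fst (snd (f K))" and fr = "\<lambda>K. fst (snd (snd (f K)))"
      and fX = "\<lambda>K. fst (snd (snd (snd (f K))))" and fW = "\<lambda>K. snd (snd (snd (snd (f K))))"])
    show "card (Z \<union> A) \<le> 3 * z + 3" using cZ less.prems(4) card_Un_le[of Z A] by linarith
    show "scc G Z w = scc G Z u \<and> w \<notin> Z" if "u \<in> S - Z" "w \<in> scc G Z u" for u w
      using scc_eq[OF that(2)] that(2) by (auto simp: scc_def)
    show "u \<in> scc G Z u" if "u \<in> S - Z" for u using scc_refl[of u G Z] that SV by blast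
    show "z_normal G (Z \<union> (A \<inter> scc G Z u)) (S \<inter> scc G Z u)" if "u \<in> S - Z" for u using norm[OF that] .
    show "partial_dec G (3 * z + 3) (Z \<union> (A \<inter> K)) (S \<inter> K) (fst (f K)) (fst (snd (f K)))
        (fst (snd (snd (f K)))) (fst (snd (snd (snd (f K))))) (snd (snd (snd (snd (f K)))))"
      if "K \<in> scc G Z ` (S - Z)" for K
      using bspec[OF f that] by (simp only: case_prod_unfold)
    show "v \<in> S \<inter> Z" using v by (simp add: Z_def)
  qed (use fin SV less.prems(3) ZV in simp_all)
qed

theorem dtw_upper_bound:
  assumes wf: "wf_digraph G"
    and bal: "\<And>A. A \<subseteq> verts G \<Longrightarrow> \<exists>Z. Z \<subseteq> verts G \<and> card Z \<le> z \<and>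
      (\<forall>u\<in>verts G - Z. 2 * card (A \<inter> scc G Z u) \<le> card A)"
  shows "dtw G \<le> 3 * z + 2"
proof (cases "verts G = {}")
  case False
  have "z_normal G {} (verts G)" by (auto simp: z_normal_def)
  then obtain T ER r X W where p: "partial_dec G (3 * z + 3) {} (verts G) T ER r X W"
    using partial_dec_exists[OF wf bal False, of "{}"] by auto
  have "arboreal_decomposition G T ER r X W"
    using p unfolding partial_dec_def arboreal_decomposition_def by auto
  moreover have "decomposition_width_le T ER X W (3 * z + 2)"
    using p by (auto simp: partial_dec_def decomposition_width_le_def bag_def)
  ultimately have "\<exists>T ER r0 X W. arboreal_decomposition G T ER r0 X W \<and>
      decomposition_width_le T ER X W (3 * z + 2)" by blast
  from Least_le[of "\<lambda>w. \<exists>T ER r0 X W. arboreal_decomposition G T ER r0 X W \<and>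
      decomposition_width_le T ER X W w", OF this]
  show ?thesis using False unfolding dtw_def by simp
qed (simp add: dtw_def)

section \<open>Brambles and path systems\<close>

text \<open>The strong form of a directed bramble, in which elements intersect instead of merely
  being joined by arcs in both directions. The last clause says that the order exceeds
  \<open>z\<close>.\<close>

definition bramble :: "('a \<times> 'a) set \<Rightarrow> 'a set \<Rightarrow> nat \<Rightarrow> 'a set set \<Rightarrow> bool" where
  "bramble E V z \<B> \<longleftrightarrow> \<B> \<subseteq> Pow V \<and>
     (\<forall>B\<in>\<B>. \<forall>u\<in>B. \<forall>v\<in>B. (u, v) \<in> (E \<inter> B \<times> B)\<^sup>*) \<and>
     (\<forall>B\<in>\<B>. \<forall>C\<in>\<B>. B \<inter> C \<noteq> {}) \<and>
     (\<forall>Z. finite Z \<longrightarrow> card Z \<le> z \<longrightarrow> (\<exists>B\<in>\<B>. B \<inter> Z = {}))"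

lemma bramble_subset:
  assumes "bramble E V z \<B>" "B \<in> \<B>"
  shows "B \<subseteq> V"
proof -
  have "\<B> \<subseteq> Pow V" using assms(1) by (simp add: bramble_def)
  then show ?thesis using assms(2) by auto
qed

lemma bramble_connected:
  "bramble E V z \<B> \<Longrightarrow> B \<in> \<B> \<Longrightarrow> u \<in> B \<Longrightarrow> v \<in> B \<Longrightarrow> (u, v) \<in> (E \<inter> B \<times> B)\<^sup>*"
  unfolding bramble_def by simp

lemma bramble_meet: "bramble E V z \<B> \<Longrightarrow> B \<in> \<B> \<Longrightarrow> C \<in> \<B> \<Longrightarrow> \<exists>w. w \<in> B \<and> w \<in> C"
  unfolding bramble_def by (simp add: disjoint_iff)

lemma bramble_avoid: "bramble E V z \<B> \<Longrightarrow> finite Z \<Longrightarrow> card Z \<le> z \<Longrightarrow> \<exists>B\<in>\<B>. B \<inter> Z = {}"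
  unfolding bramble_def by simp

lemma scc_strongly_connected:
  assumes wf: "wf_digraph G" and x: "x \<in> scc G Z u" and y: "y \<in> scc G Z u"
  shows "(x, y) \<in> (arcs G \<inter> scc G Z u \<times> scc G Z u)\<^sup>*"
proof -
  let ?R = "restr (arcs G) Z"
  have xu: "(x, u) \<in> ?R\<^sup>*" and uy: "(u, y) \<in> ?R\<^sup>*" and ux: "(u, x) \<in> ?R\<^sup>*" using x y by (auto simp: scc_def)
  from xu uy have "(x, y) \<in> ?R\<^sup>*" by (rule rtrancl_trans)
  then show ?thesis
    using y
  proof (induction rule: rtrancl_induct)
    case (step a b)
    have ua: "(u, a) \<in> ?R\<^sup>*" using ux step.hyps(1) by (rule rtrancl_trans)
    have au: "(a, u) \<in> ?R\<^sup>*"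
      using step.hyps(2) step.prems converse_rtrancl_into_rtrancl[of a b ?R u] by (simp add: scc_def)
    have "a \<in> scc G Z u"
      using ua au step.hyps(2) wf by (auto simp: scc_def restr_def wf_digraph_def)
    then show ?case
      using step.IH step.hyps(2) step.prems by (auto simp: restr_def intro: rtrancl_into_rtrancl)
  qed simp
qed

text \<open>By \<open>dtw_upper_bound\<close> some set \<open>A\<close> has no balanced separator
  with at most z vertices. The strong components that contain more than half of \<open>A\<close>
  form the bramble, since any two of them share a vertex of \<open>A\<close>.\<close>

lemma bramble_of_dtw:
  assumes wf: "wf_digraph G" and dtw: "3 * z + 3 \<le> dtw G"
  shows "\<exists>\<B>. bramble (arcs G) (verts G) z \<B>"
proof -
  have fin: "finite (verts G)" using wf by (simp add: wf_digraph_def)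
  have "\<not> (\<forall>A. A \<subseteq> verts G \<longrightarrow> (\<exists>Z. Z \<subseteq> verts G \<and> card Z \<le> z \<and>
      (\<forall>u\<in>verts G - Z. 2 * card (A \<inter> scc G Z u) \<le> card A)))"
  proof
    assume "\<forall>A. A \<subseteq> verts G \<longrightarrow> (\<exists>Z. Z \<subseteq> verts G \<and> card Z \<le> z \<and>
      (\<forall>u\<in>verts G - Z. 2 * card (A \<inter> scc G Z u) \<le> card A))"
    then have "dtw G \<le> 3 * z + 2" by (intro dtw_upper_bound[OF wf]) simp
    then show False using dtw by simp
  qed
  then obtain A where A: "A \<subseteq> verts G"
    and no: "\<not> (\<exists>Z. Z \<subseteq> verts G \<and> card Z \<le> z \<and>
      (\<forall>u\<in>verts G - Z. 2 * card (A \<inter> scc G Z u) \<le> card A))"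
    by blast
  have ex: "\<exists>u\<in>verts G - Z. card A < 2 * card (A \<inter> scc G Z u)"
    if "Z \<subseteq> verts G" "card Z \<le> z" for Z
  proof (rule ccontr)
    assume "\<not> ?thesis"
    then have "\<forall>u\<in>verts G - Z. 2 * card (A \<inter> scc G Z u) \<le> card A" by (simp add: not_less)
    then show False using no that by blast
  qed
  define \<B> where "\<B> = {scc G Z u |Z u. card A < 2 * card (A \<inter> scc G Z u)}"
  have "\<B> \<subseteq> Pow (verts G)" by (auto simp: \<B>_def scc_def)
  moreover have "\<forall>B\<in>\<B>. \<forall>u\<in>B. \<forall>v\<in>B. (u, v) \<in> (arcs G \<inter> B \<times> B)\<^sup>*"
    using scc_strongly_connected[OF wf] by (auto simp: \<B>_def)
  moreover have "B \<inter> C \<noteq> {}" if B: "B \<in> \<B>" and C: "C \<in> \<B>" for B C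
  proof
    assume BC: "B \<inter> C = {}"
    have finA: "finite A" using A fin by (rule finite_subset)
    have "card (A \<inter> B) + card (A \<inter> C) = card ((A \<inter> B) \<union> (A \<inter> C))"
      using finA BC by (subst card_Un_disjoint) auto
    also have "\<dots> \<le> card A" using finA by (intro card_mono) auto
    finally show False using B C by (auto simp: \<B>_def)
  qed
  moreover have "\<exists>B\<in>\<B>. B \<inter> Z = {}" if "finite Z" "card Z \<le> z" for Z
  proof -
    \<comment> \<open>The sets that fail to separate \<open>A\<close> are subsets of
      \<open>verts G\<close>, whereas a hitting set is arbitrary; its part inside the graph is what
      counts.\<close>
    have "card (Z \<inter> verts G) \<le> z" using that card_mono[of Z "Z \<inter> verts G"] by simp
    then obtain u where "card A < 2 * card (A \<inter> scc G (Z \<inter> verts G) u)" using ex[of "Z \<inter> verts G"] by auto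
    then have "scc G (Z \<inter> verts G) u \<in> \<B>" by (auto simp: \<B>_def)
    moreover have "scc G (Z \<inter> verts G) u \<inter> Z = {}" by (auto simp: scc_def)
    ultimately show ?thesis by blast
  qed
  ultimately have "bramble (arcs G) (verts G) z \<B>" unfolding bramble_def by simp
  then show ?thesis by blast
qed

lemma rtrancl_is_path:
  assumes "(u, v) \<in> R\<^sup>*"
  shows "\<exists>p. is_path R p \<and> hd p = u \<and> last p = v"
  using assms
proof (induction rule: rtrancl_induct)
  case base
  show ?case by (rule exI[of _ "[u]"]) (simp add: is_path_def)
next
  case (step v w)
  then obtain p where p: "is_path R p" "hd p = u" "last p = v" by blast
  show ?case
  proof (cases "w \<in> set p")
    case True
    then obtain xs ys where "p = xs @ w # ys" by (meson split_list)
    then show ?thesis using p is_path_appendD[of R "[]" "xs @ [w]" ys]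
      by (intro exI[of _ "xs @ [w]"]) (cases xs, auto)
  next
    case False
    then show ?thesis using p step.hyps(2)
      by (intro exI[of _ "p @ [w]"]) (auto simp: is_path_def successively_append_iff)
  qed
qed

lemma rtrancl_first_hit:
  assumes "(u, w) \<in> R\<^sup>*" "w \<in> C"
  shows "\<exists>w'\<in>C. (u, w') \<in> {(x, y) \<in> R. x \<notin> C}\<^sup>*"
  using assms
proof (induction rule: converse_rtrancl_induct)
  case (step y z)
  then show ?case by (cases "y \<in> C") (auto intro: converse_rtrancl_into_rtrancl)
qed auto

lemma successively_non_last:
  assumes "successively P xs" "x \<in> set xs" "x \<noteq> last xs"
  shows "\<exists>y. P x y"
  using assms by (induction xs) (auto simp: successively_Cons split: if_splits)

lemma successively_Range:
  assumes "successively (\<lambda>u v. (u, v) \<in> R) xs" "x \<in> set (tl xs)"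
  shows "x \<in> Range R"
proof -
  obtain y ys where xs: "xs = y # ys" "x \<in> set ys" using assms(2) by (cases xs) auto
  have "successively (\<lambda>u v. (u, v) \<in> R) (y # ys) \<Longrightarrow> x \<in> set ys \<Longrightarrow> x \<in> Range R" for y ys
    by (induction ys arbitrary: y) (auto simp: successively_Cons)
  then show ?thesis using xs assms(1) by blast
qed

lemma is_path_subset:
  assumes "is_path E p" "hd p \<in> V" "E \<subseteq> V \<times> V"
  shows "set p \<subseteq> V"
proof
  fix x assume "x \<in> set p"
  then have "x = hd p \<or> x \<in> set (tl p)" by (cases p) auto
  then show "x \<in> V" using assms successively_Range[of E p x] by (auto simp: is_path_def)
qed

text \<open>Take a longest path that some element \<open>B\<close> meets only in its last vertex. If
  it missed an element \<open>C\<close>, it could be prolonged inside \<open>B\<close> until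
  \<open>C\<close> is first reached: the new part avoids the old path, and the result meets
  \<open>C\<close> only in its last vertex.\<close>

lemma bramble_path:
  assumes finV: "finite V" and br: "bramble E V z \<B>" and ne: "\<B> \<noteq> {}"
  shows "\<exists>p. is_path E p \<and> set p \<subseteq> V \<and> (\<forall>B\<in>\<B>. B \<inter> set p \<noteq> {})"
proof -
  define good where "good p \<longleftrightarrow> is_path E p \<and> set p \<subseteq> V \<and> (\<exists>B\<in>\<B>. set p \<inter> B = {last p})" for p
  have extend: "\<exists>p'. good p' \<and> length p < length p'" if p: "good p" and C: "C \<in> \<B>" "C \<inter> set p = {}" for p C
  proof -
    obtain B where B: "B \<in> \<B>" "set p \<inter> B = {last p}" using p by (auto simp: good_def)
    let ?v = "last p"
    have pp: "p \<noteq> []" "is_path E p" "set p \<subseteq> V" using p by (auto simp: good_def is_path_def)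
    have v: "?v \<in> B" "?v \<notin> C" using B C pp by auto
    obtain w where "w \<in> B" "w \<in> C" using bramble_meet[OF br B(1) C(1)] by blast
    then have "(?v, w) \<in> (E \<inter> B \<times> B)\<^sup>*" using bramble_connected[OF br B(1)] v by blast
    define R where "R = {(x, y) \<in> E \<inter> B \<times> B. x \<notin> C}"
    obtain w' where w': "w' \<in> C" "(?v, w') \<in> R\<^sup>*"
      using rtrancl_first_hit[OF \<open>(?v, w) \<in> _\<close> \<open>w \<in> C\<close>] unfolding R_def by blast
    obtain q where q: "is_path R q" "hd q = ?v" "last q = w'" using rtrancl_is_path[OF w'(2)] by blast
    have sq: "successively (\<lambda>u v. (u, v) \<in> R) q" using q(1) by (simp add: is_path_def)
    obtain q' where q': "q = ?v # q'" using q by (cases q) (auto simp: is_path_def)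
    have q'ne: "q' \<noteq> []" using q q' w'(1) v(2) by auto
    have qB: "set q' \<subseteq> B" using successively_Range[OF sq] q' by (auto simp: R_def)
    have dq: "distinct q" using q(1) by (simp add: is_path_def)
    have "?v \<notin> set q'" using dq unfolding q' by simp
    moreover have "set p \<inter> set q' \<subseteq> {?v}" using Int_mono[OF subset_refl qB, of "set p"] B(2) by simp
    ultimately have disj: "set p \<inter> set q' = {}" by blast
    have "successively (\<lambda>u v. (u, v) \<in> E) q"
      using sq by (rule successively_mono) (auto simp: R_def)
    then have "is_path E (p @ q')"
      using pp(1,2) disj dq unfolding q' by (auto simp: is_path_def successively_append_iff successively_Cons)
    moreover have "set (p @ q') \<subseteq> V" using pp qB bramble_subset[OF br B(1)] by auto
    moreover have "set (p @ q') \<inter> C = {last (p @ q')}"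
    proof -
      have l: "last (p @ q') = w'" using q' q'ne q(3) by simp
      have "x = w'" if x: "x \<in> set q'" "x \<in> C" for x
      proof (rule ccontr)
        assume "x \<noteq> w'"
        then obtain y where "(x, y) \<in> R" using successively_non_last[OF sq, of x] x q' q(3) by auto
        then show False using x by (simp add: R_def)
      qed
      moreover have "w' \<in> set q'" using q(3) q' q'ne last_in_set[of q'] by simp
      ultimately have "set q' \<inter> C = {w'}" using w'(1) by blast
      then show ?thesis using C(2) l by auto
    qed
    ultimately have "good (p @ q')" using C(1) unfolding good_def by blast
    then show ?thesis using q'ne by (intro exI[of _ "p @ q'"]) auto
  qed
  obtain B where B: "B \<in> \<B>" using ne by blast
  then obtain v where v: "v \<in> B" using bramble_meet[OF br] by blast
  have "good [v]" using B v bramble_subset[OF br B] unfolding good_def is_path_def by auto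
  moreover have "length p < Suc (card V)" if "good p" for p
    using that card_mono[OF finV, of "set p"] distinct_card[of p] by (auto simp: good_def is_path_def)
  ultimately obtain p where p: "good p" "\<And>q. good q \<Longrightarrow> length q \<le> length p"
    using ex_has_greatest_nat[of good "[v]" length "Suc (card V)"] by blast
  then have "\<forall>B\<in>\<B>. B \<inter> set p \<noteq> {}" using extend by (meson not_less)
  then show ?thesis using p(1) unfolding good_def by blast
qed

section \<open>Rich zones and linked tokens on a path\<close>

definition rich :: "'a set set \<Rightarrow> nat \<Rightarrow> 'a set \<Rightarrow> bool" where
  "rich \<B> k S \<longleftrightarrow> (\<forall>Z. finite Z \<longrightarrow> card Z < k \<longrightarrow> (\<exists>B\<in>\<B>. B \<inter> S \<noteq> {} \<and> B \<inter> Z = {}))"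

lemma richD: "rich \<B> k S \<Longrightarrow> finite Z \<Longrightarrow> card Z < k \<Longrightarrow> \<exists>B\<in>\<B>. B \<inter> S \<noteq> {} \<and> B \<inter> Z = {}"
  by (simp only: rich_def)

text \<open>Cut off the shortest rich prefix. Without its last vertex it is not rich, so fewer than
  \<open>k\<close> vertices and this last vertex together hit every element that meets the prefix.
  Hence the rest of the path loses at most \<open>k\<close> in richness.\<close>

lemma rich_split:
  assumes "rich \<B> (m * k + 1) (set p)" "k \<ge> 1"
  shows "\<exists>ps rest. p = concat ps @ rest \<and> length ps = m \<and> (\<forall>q\<in>set ps. rich \<B> k (set q))"
  using assms(1)
proof (induction m arbitrary: p)
  case 0
  then show ?case by simp
next
  case (Suc m)
  have whole: "rich \<B> k (set p)" using Suc.prems by (auto simp: rich_def)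
  define n where "n = (LEAST n. rich \<B> k (set (take n p)))"
  have ex: "rich \<B> k (set (take (length p) p))" using whole by simp
  have rn: "rich \<B> k (set (take n p))" unfolding n_def by (rule LeastI[of "\<lambda>n. rich \<B> k (set (take n p))", OF ex])
  have "n \<le> length p" unfolding n_def by (rule Least_le[of "\<lambda>n. rich \<B> k (set (take n p))", OF ex])
  moreover have "\<not> rich \<B> k (set (take 0 p))" using assms(2) by (auto simp: rich_def)
  then have n0: "n \<noteq> 0" using rn by metis
  ultimately obtain l where l: "n = Suc l" "l < length p" by (cases n) auto
  have "l < n" using l(1) by simp
  then have "\<not> rich \<B> k (set (take l p))"
    unfolding n_def by (rule not_less_Least[of l "\<lambda>n. rich \<B> k (set (take n p))"])
  then obtain Z0 where Z0: "finite Z0" "card Z0 < k"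
    and no: "\<not> (\<exists>B\<in>\<B>. B \<inter> set (take l p) \<noteq> {} \<and> B \<inter> Z0 = {})"
    unfolding rich_def by (auto simp del: disjoint_iff)
  define Z1 where "Z1 = insert (p ! l) Z0"
  have Z1: "finite Z1" "card Z1 \<le> k" using Z0(1,2) by (auto simp: Z1_def card_insert_if)
  have hit: "B \<inter> Z1 \<noteq> {}" if "B \<in> \<B>" "B \<inter> set (take n p) \<noteq> {}" for B
  proof (cases "p ! l \<in> B")
    case False
    then have "B \<inter> set (take l p) \<noteq> {}" using that(2) l by (auto simp: take_Suc_conv_app_nth)
    then have "B \<inter> Z0 \<noteq> {}" using no that(1) by blast
    then show ?thesis by (auto simp: Z1_def)
  qed (auto simp: Z1_def)
  have "rich \<B> (m * k + 1) (set (drop n p))"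
    unfolding rich_def
  proof (intro allI impI)
    fix Z :: "'a set" assume Z: "finite Z" "card Z < m * k + 1"
    have "card (Z \<union> Z1) < Suc m * k + 1" using card_Un_le[of Z Z1] Z Z1 by simp
    then obtain B where B: "B \<in> \<B>" "B \<inter> set p \<noteq> {}" "B \<inter> (Z \<union> Z1) = {}"
      using richD[OF Suc.prems, of "Z \<union> Z1"] Z(1) Z1(1) by auto
    have "set p = set (take n p) \<union> set (drop n p)" by (metis append_take_drop_id set_append)
    then have "B \<inter> set (drop n p) \<noteq> {}" using B hit[of B] by blast
    then show "\<exists>B\<in>\<B>. B \<inter> set (drop n p) \<noteq> {} \<and> B \<inter> Z = {}" using B by blast
  qed
  then obtain ps rest where ps: "drop n p = concat ps @ rest" "length ps = m" "\<forall>q\<in>set ps. rich \<B> k (set q)"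
    using Suc.IH by blast
  have "p = concat (take n p # ps) @ rest"
    using append_take_drop_id[of n p] unfolding ps(1) by simp
  moreover have "length (take n p # ps) = Suc m" using ps(2) by simp
  ultimately show ?case using ps(3) rn by (metis set_ConsD)
qed

lemma disjoint_family_avoid:
  assumes "finite Z" "card Z < card I" "\<And>i j. i \<in> I \<Longrightarrow> j \<in> I \<Longrightarrow> i \<noteq> j \<Longrightarrow> f i \<inter> f j = {}"
  shows "\<exists>i\<in>I. f i \<inter> Z = {}"
proof (rule ccontr)
  assume "\<not> ?thesis"
  then have "\<forall>i\<in>I. \<exists>v. v \<in> f i \<inter> Z" by blast
  then obtain g where g: "\<forall>i\<in>I. g i \<in> f i \<inter> Z" by (meson bchoice)
  have "inj_on g I"
  proof (rule inj_onI, rule ccontr)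
    fix i j assume ij: "i \<in> I" "j \<in> I" "g i = g j" "i \<noteq> j"
    have "g i \<in> f i" "g j \<in> f j" using g ij(1,2) by auto
    then show False using assms(3)[OF ij(1,2,4)] ij(3) by auto
  qed
  moreover have "g ` I \<subseteq> Z" using g by auto
  ultimately have "card I \<le> card Z" using assms(1) by (rule card_inj_on_le)
  then show False using assms(2) by simp
qed

text \<open>Each token \<open>hd (\<zeta> (2 * b + 1))\<close> has a rich zone before it and a rich zone after it. So two
  tokens whose zones avoid \<open>Z\<close> are joined through two intersecting bramble elements avoiding \<open>Z\<close>.\<close>
lemma tokens_linked:
  fixes \<zeta> :: "nat \<Rightarrow> 'a list"
  defines "\<tau> \<equiv> \<lambda>b. hd (\<zeta> (2 * b + 1))"
  assumes br: "bramble E V z \<B>"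
    and path: "\<And>b. b < K \<Longrightarrow> is_path E (\<zeta> (2 * b) @ \<zeta> (2 * b + 1))"
    and ne: "\<And>b. b < K \<Longrightarrow> \<zeta> (2 * b + 1) \<noteq> []"
    and disj: "\<And>i j. i < 2 * K \<Longrightarrow> j < 2 * K \<Longrightarrow> i \<noteq> j \<Longrightarrow> set (\<zeta> i) \<inter> set (\<zeta> j) = {}"
    and rich: "\<And>i. i < 2 * K \<Longrightarrow> rich \<B> K (set (\<zeta> i))"
    and X: "X \<subseteq> \<tau> ` {..<K}" and Y: "Y \<subseteq> \<tau> ` {..<K}" and card: "card X = card Y"
    and Z: "finite Z" "separates E X Y Z"
  shows "card X \<le> card Z"
proof (rule ccontr)
  assume "\<not> ?thesis"
  then have less: "card Z < card X" by simp
  define Bl where "Bl b = set (\<zeta> (2 * b)) \<union> set (\<zeta> (2 * b + 1))" for b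
  have Bl_disj: "Bl b \<inter> Bl c = {}" if "b < K" "c < K" "b \<noteq> c" for b c
  proof -
    have "set (\<zeta> i) \<inter> set (\<zeta> j) = {}" if "i \<in> {2 * b, 2 * b + 1}" "j \<in> {2 * c, 2 * c + 1}" for i j
    proof (rule disj)
      show "i < 2 * K" "j < 2 * K" "i \<noteq> j" using that \<open>b < K\<close> \<open>c < K\<close> \<open>b \<noteq> c\<close> by (auto; presburger)+
    qed
    then show ?thesis unfolding Bl_def by blast
  qed
  \<comment> \<open>The blocks of different tokens are disjoint, so a set with more tokens than
    \<open>Z\<close> has vertices contains a token whose whole block avoids
    \<open>Z\<close>.\<close>
  have pick: "\<exists>b<K. \<tau> b \<in> S \<and> Bl b \<inter> Z = {}" if S: "S \<subseteq> \<tau> ` {..<K}" and c: "card Z < card S" for S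
  proof -
    define I where "I = {b. b < K \<and> \<tau> b \<in> S}"
    have "S = \<tau> ` I" using S by (auto simp: I_def)
    then have "card S \<le> card I" using card_image_le[of I \<tau>] by (simp add: I_def)
    then have "\<exists>b\<in>I. Bl b \<inter> Z = {}"
      using Bl_disj c by (intro disjoint_family_avoid[OF Z(1)]) (auto simp: I_def)
    then show ?thesis by (auto simp: I_def)
  qed
  obtain b where b: "b < K" "\<tau> b \<in> X" "Bl b \<inter> Z = {}" using pick[OF X less] by blast
  obtain c where c: "c < K" "\<tau> c \<in> Y" "Bl c \<inter> Z = {}" using pick[OF Y] less card by auto
  \<comment> \<open>This is why richness \<open>K\<close> suffices for the zones: the supposed
    separator has fewer than \<open>K\<close> vertices.\<close>
  have "card X \<le> K"
    using X card_mono[of "\<tau> ` {..<K}" X] card_image_le[of "{..<K}" \<tau>] by simp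
  then have ZK: "card Z < K" using less by simp
  have walk: "(u, v) \<in> (restr E Z)\<^sup>*" if "B \<in> \<B>" "B \<inter> Z = {}" "u \<in> B" "v \<in> B" for B u v
  proof -
    have "(u, v) \<in> (E \<inter> B \<times> B)\<^sup>*" using bramble_connected[OF br] that by blast
    moreover have "E \<inter> B \<times> B \<subseteq> restr E Z" using that(2) by (auto simp: restr_def)
    ultimately show ?thesis using rtrancl_mono by blast
  qed
  obtain B where B: "B \<in> \<B>" "B \<inter> set (\<zeta> (2 * b + 1)) \<noteq> {}" "B \<inter> Z = {}"
    using richD[OF rich[of "2 * b + 1"] Z(1) ZK] b(1) by auto
  obtain C where C: "C \<in> \<B>" "C \<inter> set (\<zeta> (2 * c)) \<noteq> {}" "C \<inter> Z = {}"
    using richD[OF rich[of "2 * c"] Z(1) ZK] c(1) by auto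
  obtain v where v: "v \<in> B" "v \<in> set (\<zeta> (2 * b + 1))" using B by blast
  obtain w where w: "w \<in> B" "w \<in> C" using bramble_meet[OF br B(1) C(1)] by blast
  obtain u where u: "u \<in> C" "u \<in> set (\<zeta> (2 * c))" using C by blast
  have "is_path E (\<zeta> (2 * b + 1))" using is_path_appendD[of E "\<zeta> (2 * b)" "\<zeta> (2 * b + 1)" "[]"] path[OF b(1)] ne[OF b(1)] by simp
  then have "(\<tau> b, v) \<in> (restr E Z)\<^sup>*" unfolding \<tau>_def
    using v b(3) by (intro is_path_hd_reach) (auto simp: Bl_def)
  also have "(v, w) \<in> (restr E Z)\<^sup>*" using walk[OF B(1,3)] v w by blast
  also have "(w, u) \<in> (restr E Z)\<^sup>*" using walk[OF C(1,3)] u w by blast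
  also have "(u, \<tau> c) \<in> (restr E Z)\<^sup>*"
    using is_path_reach[OF path[OF c(1)] u(2), of "\<tau> c" Z] ne[OF c(1)] c(3) by (auto simp: \<tau>_def Bl_def)
  finally have "(\<tau> b, \<tau> c) \<in> (restr E Z)\<^sup>*" .
  moreover have "\<tau> b \<in> Bl b" "\<tau> c \<in> Bl c" using ne b(1) c(1) by (auto simp: \<tau>_def Bl_def)
  then have "\<tau> b \<notin> Z" "\<tau> c \<notin> Z" using b(3) c(3) by auto
  ultimately show False using Z(2) b(2) c(2) unfolding separates_def by blast
qed

text \<open>There are \<open>K\<close> tokens with two zones each. Cutting a path into 2 * K zones
  of richness \<open>K\<close> takes total richness 2 * K * K + 1, which is the source of the
  quadratic loss. A piece owns 2 * S consecutive tokens, that is 4 * S zones; the first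
  \<open>S\<close> tokens become \<open>In\<close>, the last \<open>S\<close> become
  \<open>Out\<close>.\<close>

lemma path_system:
  assumes wf: "wf_digraph G" and NS: "N \<ge> 1" "S \<ge> 1"
    and K: "K = N * (2 * S)" and dtw: "3 * (2 * K * K) + 3 \<le> dtw G"
  shows "\<exists>p1 p2 In Out.
    (\<forall>i<N. is_path (arcs G) (p1 i @ p2 i) \<and> set (p1 i @ p2 i) \<subseteq> verts G \<and>
       In i \<subseteq> set (p1 i) \<and> Out i \<subseteq> set (p2 i) \<and> card (In i) = S \<and> card (Out i) = S) \<and>
    (\<forall>i<N. \<forall>j<N. i \<noteq> j \<longrightarrow> set (p1 i @ p2 i) \<inter> set (p1 j @ p2 j) = {}) \<and>
    (\<forall>X Y. X \<subseteq> (\<Union>i<N. In i \<union> Out i) \<longrightarrow> Y \<subseteq> (\<Union>i<N. In i \<union> Out i) \<longrightarrow> card X = card Y \<longrightarrow>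
       (\<exists>p. linkage (arcs G) X Y p))"
proof -
  have fin: "finite (verts G)" using wf by (simp add: wf_digraph_def)
  have K1: "K \<ge> 1" using NS K by simp
  obtain \<B> where br: "bramble (arcs G) (verts G) (2 * K * K) \<B>" using bramble_of_dtw[OF wf dtw] by blast
  have "\<B> \<noteq> {}" using bramble_avoid[OF br, of "{}"] by auto
  then obtain p where p: "is_path (arcs G) p" "set p \<subseteq> verts G" "\<And>B. B \<in> \<B> \<Longrightarrow> B \<inter> set p \<noteq> {}"
    using bramble_path[OF fin br] by blast
  have "rich \<B> (2 * K * K + 1) (set p)"
    unfolding rich_def
  proof (intro allI impI)
    fix Z :: "nat set" assume "finite Z" "card Z < 2 * K * K + 1"
    then obtain B where "B \<in> \<B>" "B \<inter> Z = {}" using bramble_avoid[OF br] by (metis Suc_eq_plus1 less_Suc_eq_le)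
    then show "\<exists>B\<in>\<B>. B \<inter> set p \<noteq> {} \<and> B \<inter> Z = {}" using p(3)[of B] by (intro bexI[of _ B]) auto
  qed
  then obtain ps rest where ps: "p = concat ps @ rest" "length ps = 2 * K" "\<forall>q\<in>set ps. rich \<B> K (set q)"
    using rich_split[of \<B> "2 * K" K p] K1 by auto
  have dp: "distinct (concat ps)" using p(1) ps(1) by (simp add: is_path_def)
  have rich: "rich \<B> K (set (ps ! j))" if "j < 2 * K" for j using ps that by auto
  have ne: "ps ! j \<noteq> []" if "j < 2 * K" for j
  proof -
    have "\<exists>B\<in>\<B>. B \<inter> set (ps ! j) \<noteq> {} \<and> B \<inter> {} = {}" using K1 by (intro richD[OF rich[OF that]]) auto
    then show ?thesis by auto
  qed
  have disj: "set (ps ! i) \<inter> set (ps ! j) = {}" if "i < 2 * K" "j < 2 * K" "i \<noteq> j" for i j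
  proof -
    have "removeAll [] ps = ps" using ne ps(2) by (metis in_set_conv_nth removeAll_id)
    then have "distinct ps" using dp by (simp add: distinct_concat_iff)
    then have "ps ! i \<noteq> ps ! j" using that ps(2) by (simp add: nth_eq_iff_index_eq)
    then show ?thesis using dp that ps(2) by (simp add: distinct_concat_iff)
  qed
  define seg where "seg a c = concat (map ((!) ps) [a..<c])" for a c
  have set_seg: "set (seg a c) = (\<Union>j\<in>{a..<c}. set (ps ! j))" for a c by (auto simp: seg_def)
  have seg_path: "is_path (arcs G) (seg a c)" if "a < c" "c \<le> 2 * K" for a c
  proof -
    have "[0..<2 * K] = [0..<a] @ [a..<c] @ [c..<2 * K]"
      using that by (metis le_add_diff_inverse less_imp_le upt_add_eq_append zero_le append.assoc le_trans)
    then have "concat ps = concat (map ((!) ps) [0..<a]) @ seg a c @ concat (map ((!) ps) [c..<2 * K])"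
      using map_nth[of ps] ps(2) unfolding seg_def by (metis concat_append map_append)
    moreover have "seg a c \<noteq> []" using ne[of a] that by (auto simp: seg_def upt_conv_Cons)
    ultimately show ?thesis
      using is_path_appendD[of "arcs G" "concat (map ((!) ps) [0..<a])" "seg a c"] p(1) ps(1) by simp
  qed
  have seg_append: "seg a c @ seg c d = seg a d" if "a \<le> c" "c \<le> d" for a c d
    using that unfolding seg_def by (metis concat_append le_add_diff_inverse map_append upt_add_eq_append)
  define \<tau> where "\<tau> b = hd (ps ! (2 * b + 1))" for b
  have \<tau>_in: "\<tau> b \<in> set (ps ! (2 * b + 1))" if "b < K" for b using ne[of "2 * b + 1"] that by (simp add: \<tau>_def)
  have \<tau>_inj: "inj_on \<tau> {..<K}"
  proof (rule inj_onI, rule ccontr)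
    fix b c assume "b \<in> {..<K}" "c \<in> {..<K}" "\<tau> b = \<tau> c" "b \<noteq> c"
    then show False using \<tau>_in[of b] \<tau>_in[of c] disj[of "2 * b + 1" "2 * c + 1"] by auto
  qed
  define In where "In i = \<tau> ` {2 * S * i..<2 * S * i + S}" for i
  define Out where "Out i = \<tau> ` {2 * S * i + S..<2 * S * i + 2 * S}" for i
  define p1 where "p1 i = seg (4 * S * i) (4 * S * i + 2 * S)" for i
  define p2 where "p2 i = seg (4 * S * i + 2 * S) (4 * S * i + 4 * S)" for i
  have bound: "2 * S * i + 2 * S \<le> K" if "i < N" for i
    using that mult_le_mono1[of "Suc i" N "2 * S"] K by (simp add: algebra_simps)
  have p12: "p1 i @ p2 i = seg (4 * S * i) (4 * S * i + 4 * S)" for i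
    unfolding p1_def p2_def by (rule seg_append) auto
  have F1: "is_path (arcs G) (p1 i @ p2 i) \<and> set (p1 i @ p2 i) \<subseteq> verts G \<and>
       In i \<subseteq> set (p1 i) \<and> Out i \<subseteq> set (p2 i) \<and> card (In i) = S \<and> card (Out i) = S" if i: "i < N" for i
  proof (intro conjI)
    show "is_path (arcs G) (p1 i @ p2 i)" unfolding p12 using bound[OF i] NS by (intro seg_path) auto
    show "set (p1 i @ p2 i) \<subseteq> verts G"
      unfolding p12 set_seg
    proof (rule UN_least)
      fix j assume "j \<in> {4 * S * i..<4 * S * i + 4 * S}"
      then have "j < 2 * K" using bound[OF i] by simp
      then have "ps ! j \<in> set ps" using ps(2) by simp
      then have "set (ps ! j) \<subseteq> set p" unfolding ps(1) by auto
      then show "set (ps ! j) \<subseteq> verts G" using p(2) by (rule subset_trans)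
    qed
    show "In i \<subseteq> set (p1 i)"
    proof
      fix x assume "x \<in> In i"
      then obtain b where b: "b \<in> {2 * S * i..<2 * S * i + S}" "x = \<tau> b" by (auto simp: In_def)
      then have "x \<in> set (ps ! (2 * b + 1))" using \<tau>_in[of b] bound[OF i] by auto
      moreover have "2 * b + 1 \<in> {4 * S * i..<4 * S * i + 2 * S}" using b by auto
      ultimately show "x \<in> set (p1 i)" unfolding p1_def set_seg by blast
    qed
    show "Out i \<subseteq> set (p2 i)"
    proof
      fix x assume "x \<in> Out i"
      then obtain b where b: "b \<in> {2 * S * i + S..<2 * S * i + 2 * S}" "x = \<tau> b" by (auto simp: Out_def)
      then have "x \<in> set (ps ! (2 * b + 1))" using \<tau>_in[of b] bound[OF i] by auto
      moreover have "2 * b + 1 \<in> {4 * S * i + 2 * S..<4 * S * i + 4 * S}" using b by auto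
      ultimately show "x \<in> set (p2 i)" unfolding p2_def set_seg by blast
    qed
    have "inj_on \<tau> {2 * S * i..<2 * S * i + S}" "inj_on \<tau> {2 * S * i + S..<2 * S * i + 2 * S}"
      using bound[OF i] by (auto intro!: inj_on_subset[OF \<tau>_inj])
    then show "card (In i) = S" "card (Out i) = S" by (simp_all add: In_def Out_def card_image)
  qed
  have F2: "set (p1 i @ p2 i) \<inter> set (p1 j @ p2 j) = {}" if ij: "i < N" "j < N" "i \<noteq> j" for i j
  proof -
    have *: "set (p1 i @ p2 i) \<inter> set (p1 j @ p2 j) = {}" if ij: "i < j" "j < N" for i j
    proof -
      have "4 * S * i + 4 * S \<le> 4 * S * j" using ij(1) mult_le_mono2[of "Suc i" j "4 * S"] by simp
      then have "set (ps ! a) \<inter> set (ps ! c) = {}"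
        if "a \<in> {4 * S * i..<4 * S * i + 4 * S}" "c \<in> {4 * S * j..<4 * S * j + 4 * S}" for a c
        using that bound[OF ij(2)] by (intro disj) auto
      then show ?thesis unfolding p12 set_seg by blast
    qed
    show ?thesis
    proof (cases "i < j")
      case True
      then show ?thesis using *[of i j] ij by simp
    next
      case False
      then show ?thesis using *[of j i] ij by (simp only: Int_commute)
    qed
  qed
  have F3: "\<exists>q. linkage (arcs G) X Y q"
    if X: "X \<subseteq> (\<Union>i<N. In i \<union> Out i)" and Y: "Y \<subseteq> (\<Union>i<N. In i \<union> Out i)" and c: "card X = card Y" for X Y
  proof -
    have IO: "In i \<union> Out i \<subseteq> \<tau> ` {..<K}" if "i < N" for i
      unfolding In_def Out_def image_Un[symmetric] using bound[OF that] by (intro image_mono) auto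
    then have "(\<Union>i<N. In i \<union> Out i) \<subseteq> \<tau> ` {..<K}" by (intro UN_least) simp
    then have XY: "X \<subseteq> \<tau> ` {..<K}" "Y \<subseteq> \<tau> ` {..<K}" using X Y by (simp_all only: subset_trans)
    then have finXY: "finite X" "finite Y" by (auto intro: finite_subset)
    have finE: "finite (arcs G)" using wf fin finite_subset[of "arcs G" "verts G \<times> verts G"] by (simp add: wf_digraph_def)
    have pair_path: "is_path (arcs G) (ps ! (2 * b) @ ps ! (2 * b + 1))" if "b < K" for b
      using seg_path[of "2 * b" "2 * b + 2"] that by (simp add: seg_def)
    have "card X \<le> card Z" if "finite Z" "separates (arcs G) X Y Z" for Z
      by (rule tokens_linked[OF br pair_path _ disj rich]) (use XY c that ne in \<open>auto simp: \<tau>_def\<close>)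
    then obtain A q where "A \<subseteq> X" "card A = card X" "linkage (arcs G) A Y q"
      using Menger[OF finE finXY, of "card X"] by blast
    then show ?thesis using card_subset_eq[OF finXY(1)] by auto
  qed
  show ?thesis
    by (rule exI[of _ p1], rule exI[of _ p2], rule exI[of _ In], rule exI[of _ Out], rule conjI,
        intro allI impI, erule F1, rule conjI, intro allI impI, rule F2, assumption+,
        intro allI impI, rule F3, assumption+)
qed

section \<open>Independent transversals\<close>

text \<open>Choices are extensional functions, so that those on a finite index set form a finite set
  and those on different index sets can be compared by \<open>restrict\<close> and update.\<close>

definition transversals where
  "transversals V conf T = {f \<in> PiE T V. \<forall>i\<in>T. \<forall>j\<in>T. i \<noteq> j \<longrightarrow> \<not> conf i (f i) j (f j)}"

lemma finite_transversals:
  assumes "finite T" "\<And>i. i \<in> T \<Longrightarrow> finite (V i)"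
  shows "finite (transversals V conf T)"
proof (rule finite_subset)
  show "transversals V conf T \<subseteq> PiE T V" by (auto simp: transversals_def)
  show "finite (PiE T V)" using assms by (rule finite_PiE)
qed

lemma transversals_restrict:
  assumes "f \<in> transversals V conf T" "U \<subseteq> T"
  shows "restrict f U \<in> transversals V conf U"
proof -
  have "f i \<in> V i" if "i \<in> U" for i using assms that by (auto simp: transversals_def)
  moreover have "\<not> conf i (f i) j (f j)" if "i \<in> U" "j \<in> U" "i \<noteq> j" for i j
  proof -
    have "i \<in> T" "j \<in> T" using that(1,2) assms(2) by auto
    then show ?thesis using assms(1) that(3) by (simp add: transversals_def)
  qed
  ultimately show ?thesis by (simp add: transversals_def)
qed

lemma transversals_extend:
  assumes f: "f \<in> transversals V conf U" and i: "i \<notin> U" and u: "u \<in> V i"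
    and sym: "\<And>i u j v. conf i u j v \<Longrightarrow> conf j v i u"
    and free: "\<And>j. j \<in> U \<Longrightarrow> \<not> conf i u j (f j)"
  shows "f(i := u) \<in> transversals V conf (insert i U)"
proof -
  have "f \<in> PiE U V" using f by (simp add: transversals_def)
  then have ext: "f(i := u) \<in> PiE (insert i U) V" using u by (auto simp: PiE_def extensional_def)
  have ok: "\<not> conf a ((f(i := u)) a) c ((f(i := u)) c)"
    if ac: "a \<in> insert i U" "c \<in> insert i U" "a \<noteq> c" for a c
  proof (cases "a = i \<or> c = i")
    case True
    then show ?thesis using free[of a] free[of c] sym[of a "f a" i u] ac by auto
  next
    case False
    then show ?thesis using f ac by (simp add: transversals_def)
  qed
  show ?thesis
    unfolding transversals_def
    by (intro CollectI conjI ballI impI) (rule ext, rule ok)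
qed

text \<open>Counting replaces the local lemma: the extensions to \<open>i\<close> spoilt by a conflict with \<open>j\<close> are
  determined by a conflicting pair and a conflict-free choice on \<open>T - {i, j}\<close>, and by induction
  there are few of the latter.\<close>
lemma transversals_step:
  fixes V :: "'i \<Rightarrow> 'a set"
  assumes fin: "finite T" "\<And>i. i \<in> T \<Longrightarrow> finite (V i)" and S: "\<And>i. i \<in> T \<Longrightarrow> card (V i) = S" "S \<ge> 1"
    and sym: "\<And>i u j v. conf i u j v \<Longrightarrow> conf j v i u"
    and e: "\<And>i j. i \<in> T \<Longrightarrow> j \<in> T \<Longrightarrow> i \<noteq> j \<Longrightarrow> card {(u, v) \<in> V i \<times> V j. conf i u j v} \<le> e"
    and r: "card T \<le> r" "4 * r * e \<le> S * S"
    and i: "i \<in> T"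
  shows "S * card (transversals V conf (T - {i})) \<le> 2 * card (transversals V conf T)"
  using fin S(1) e r(1) i
proof (induction "card T" arbitrary: T i rule: less_induct)
  case less
  define U where "U = T - {i}"
  let ?N = "\<lambda>T. card (transversals V conf T)"
  have finU: "finite U" "finite (transversals V conf U)"
    using less.prems(1,2) finite_transversals[of U V conf] by (auto simp: U_def)
  have cU: "card U < card T" "card U \<le> r"
    using less.prems(1,5,6) card_Diff1_less[of T i] by (auto simp: U_def)
  have IH: "S * ?N (U - {j}) \<le> 2 * ?N U" if "j \<in> U" for j
    by (rule less.hyps) (use cU finU less.prems that in \<open>auto simp: U_def\<close>)
  define bad where "bad j = {(f, u) \<in> transversals V conf U \<times> V i. conf i u j (f j)}" for j
  define good where "good = transversals V conf U \<times> V i - (\<Union>j\<in>U. bad j)"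
  have fin_bad: "finite (bad j)" for j
    using finU(2) less.prems(2,6) finite_subset[of "bad j" "transversals V conf U \<times> V i"]
    by (auto simp: bad_def)
  have card_bad: "card (bad j) \<le> ?N (U - {j}) * e" if j: "j \<in> U" for j
  proof -
    let ?C = "{(u, v) \<in> V i \<times> V j. conf i u j v}"
    let ?h = "\<lambda>(f, u). (restrict f (U - {j}), (u, f j))"
    have jT: "j \<in> T" "j \<noteq> i" using j by (auto simp: U_def)
    have "inj_on ?h (bad j)"
    proof (rule inj_onI)
      fix y y' assume yy: "y \<in> bad j" "y' \<in> bad j" "?h y = ?h y'"
      obtain f u g v where fuv: "y = (f, u)" "y' = (g, v)" by (cases y, cases y')
      have fg: "(f, u) \<in> bad j" "(g, v) \<in> bad j"
        and eq: "restrict f (U - {j}) = restrict g (U - {j})" "f j = g j" and uv: "u = v"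
        using yy fuv by simp_all
      have "f x = g x" for x
      proof (cases "x \<in> U - {j}")
        case True
        then show ?thesis using fun_cong[OF eq(1), of x] by simp
      next
        case False
        then show ?thesis using eq(2) fg by (cases "x = j") (auto simp: bad_def transversals_def PiE_def extensional_def)
      qed
      then have "f = g" by (rule ext)
      then show "y = y'" using fuv uv by simp
    qed
    moreover have "?h ` bad j \<subseteq> transversals V conf (U - {j}) \<times> ?C"
    proof (rule image_subsetI)
      fix y assume y: "y \<in> bad j"
      obtain f u where yfu: "y = (f, u)" by (cases y)
      have fu: "(f, u) \<in> bad j" using y yfu by simp
      then have f: "f \<in> transversals V conf U" by (simp add: bad_def)
      then have "f j \<in> V j" using j by (auto simp: transversals_def)
      then have "(u, f j) \<in> ?C" using fu by (simp add: bad_def)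
      moreover have "restrict f (U - {j}) \<in> transversals V conf (U - {j})"
        using f by (rule transversals_restrict) auto
      ultimately show "?h y \<in> transversals V conf (U - {j}) \<times> ?C"
        unfolding yfu by (simp only: mem_Sigma_iff prod.case)
    qed
    moreover have "finite (transversals V conf (U - {j}) \<times> ?C)"
    proof (rule finite_cartesian_product)
      show "finite (transversals V conf (U - {j}))"
        by (rule finite_transversals) (use finU less.prems(2) in \<open>auto simp: U_def\<close>)
      show "finite ?C" using less.prems(2)[OF jT(1)] less.prems(2)[OF less.prems(6)]
          finite_subset[of ?C "V i \<times> V j"] by auto
    qed
    ultimately have "card (bad j) \<le> card (transversals V conf (U - {j}) \<times> ?C)" by (rule card_inj_on_le)
    also have "\<dots> = ?N (U - {j}) * card ?C" by (rule card_cartesian_product)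
    also have "\<dots> \<le> ?N (U - {j}) * e" using less.prems(4)[OF less.prems(6) jT(1)] jT(2) by (intro mult_le_mono2) auto
    finally show ?thesis .
  qed
  have TU: "T = insert i U" "i \<notin> U" using less.prems(6) by (auto simp: U_def)
  have "card good \<le> ?N T"
  proof (rule card_inj_on_le)
    show "inj_on (\<lambda>(f, u). f(i := u)) good"
    proof (rule inj_onI)
      fix y y' assume yy: "y \<in> good" "y' \<in> good" "(\<lambda>(f, u). f(i := u)) y = (\<lambda>(f, u). f(i := u)) y'"
      obtain f u g v where fuv: "y = (f, u)" "y' = (g, v)" by (cases y, cases y')
      have fg: "(f, u) \<in> good" "(g, v) \<in> good" and eq: "f(i := u) = g(i := v)"
        using yy fuv by simp_all
      have "u = v" using fun_cong[OF eq, of i] by simp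
      moreover have "f x = g x" for x
      proof (cases "x = i")
        case True
        then show ?thesis using fg TU(2) by (auto simp: good_def transversals_def PiE_def extensional_def)
      next
        case False
        then show ?thesis using fun_cong[OF eq, of x] by simp
      qed
      then have "f = g" by (rule ext)
      ultimately show "y = y'" using fuv by simp
    qed
    show "(\<lambda>(f, u). f(i := u)) ` good \<subseteq> transversals V conf T"
    proof (rule image_subsetI)
      fix y assume y: "y \<in> good"
      obtain f u where yfu: "y = (f, u)" by (cases y)
      have fu: "(f, u) \<in> good" using y yfu by simp
      show "(\<lambda>(f, u). f(i := u)) y \<in> transversals V conf T"
        unfolding yfu prod.case TU(1) by (rule transversals_extend) (use fu TU(2) sym in \<open>auto simp: good_def bad_def\<close>)
    qed
    show "finite (transversals V conf T)" by (rule finite_transversals[OF less.prems(1,2)])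
  qed
  moreover have "?N U * S = card (transversals V conf U \<times> V i)"
    using less.prems(3,6) by (simp add: card_cartesian_product)
  moreover have "card (transversals V conf U \<times> V i) \<le> card good + (\<Sum>j\<in>U. card (bad j))"
  proof -
    have fb: "finite (\<Union>j\<in>U. bad j)" using finU(1) fin_bad by simp
    have "finite good" using finU(2) less.prems(2,6) by (simp add: good_def)
    moreover have "transversals V conf U \<times> V i \<subseteq> good \<union> (\<Union>j\<in>U. bad j)" by (auto simp: good_def)
    ultimately have "card (transversals V conf U \<times> V i) \<le> card (good \<union> (\<Union>j\<in>U. bad j))"
      using fb by (intro card_mono) auto
    also have "\<dots> \<le> card good + card (\<Union>j\<in>U. bad j)" by (rule card_Un_le)
    also have "card (\<Union>j\<in>U. bad j) \<le> (\<Sum>j\<in>U. card (bad j))" using finU(1) by (rule card_UN_le)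
    finally show ?thesis by simp
  qed
  moreover have "(\<Sum>j\<in>U. card (bad j)) \<le> (\<Sum>j\<in>U. ?N (U - {j}) * e)" using card_bad by (rule sum_mono)
  ultimately have main: "?N U * S \<le> ?N T + (\<Sum>j\<in>U. ?N (U - {j}) * e)" by linarith
  \<comment> \<open>By induction S * N(U - {j}) \<le> 2 * N(U), and 4 * r * e \<le> S * S then
    bounds the spoilt extensions by half of S * N(U). The factor 2 * S clears the
    denominators.\<close>
  have "2 * S * (\<Sum>j\<in>U. ?N (U - {j}) * e) = (\<Sum>j\<in>U. (S * ?N (U - {j})) * (2 * e))"
    by (simp add: sum_distrib_left algebra_simps)
  also have "\<dots> \<le> (\<Sum>j\<in>U. (2 * ?N U) * (2 * e))" using IH by (intro sum_mono mult_le_mono1) auto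
  also have "\<dots> = card U * (4 * e * ?N U)" by simp
  also have "\<dots> \<le> r * (4 * e * ?N U)" using cU(2) by (rule mult_le_mono1)
  also have "\<dots> = (4 * r * e) * ?N U" by simp
  also have "\<dots> \<le> S * S * ?N U" using r(2) by (rule mult_le_mono1)
  finally have "2 * S * (\<Sum>j\<in>U. ?N (U - {j}) * e) \<le> S * (S * ?N U)" by simp
  moreover have "2 * (S * (S * ?N U)) \<le> S * (2 * ?N T) + 2 * S * (\<Sum>j\<in>U. ?N (U - {j}) * e)"
    using mult_le_mono2[OF main, of "2 * S"] by (simp only: distrib_left mult.assoc mult.commute mult.left_commute)
  ultimately have "S * (S * ?N U) \<le> S * (2 * ?N T)" by linarith
  then show ?case using S(2) by (simp add: U_def)
qed

lemma independent_transversal: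
  fixes V :: "'i \<Rightarrow> 'a set"
  assumes fin: "finite T" "\<And>i. i \<in> T \<Longrightarrow> finite (V i)" and S: "\<And>i. i \<in> T \<Longrightarrow> card (V i) = S" "S \<ge> 1"
    and sym: "\<And>i u j v. conf i u j v \<Longrightarrow> conf j v i u"
    and e: "\<And>i j. i \<in> T \<Longrightarrow> j \<in> T \<Longrightarrow> i \<noteq> j \<Longrightarrow> card {(u, v) \<in> V i \<times> V j. conf i u j v} \<le> e"
    and r: "card T \<le> r" "4 * r * e \<le> S * S"
  shows "\<exists>f. (\<forall>i\<in>T. f i \<in> V i) \<and> (\<forall>i\<in>T. \<forall>j\<in>T. i \<noteq> j \<longrightarrow> \<not> conf i (f i) j (f j))"
proof -
  have "0 < card (transversals V conf U)" if "U \<subseteq> T" for U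
    using finite_subset[OF that fin(1)] that
  proof (induction U rule: finite_induct)
    case empty
    show ?case by (simp add: transversals_def)
  next
    case (insert i U)
    have "S * card (transversals V conf (insert i U - {i})) \<le> 2 * card (transversals V conf (insert i U))"
    proof (rule transversals_step[where r = r and e = e, OF _ _ _ S(2) sym])
      show "card (insert i U) \<le> r" using insert.prems r(1) card_mono[OF fin(1)] le_trans by blast
      show "card {(u, v) \<in> V a \<times> V c. conf a u c v} \<le> e"
        if "a \<in> insert i U" "c \<in> insert i U" "a \<noteq> c" for a c
        using that insert.prems by (intro e) auto
      show "finite (V a)" "card (V a) = S" if "a \<in> insert i U" for a
        using that insert.prems fin(2)[of a] S(1)[of a] by auto
    qed (use insert.hyps r(2) in auto)
    then show ?case using insert S(2) by (cases "card (transversals V conf (insert i U))") auto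
  qed
  then have "transversals V conf T \<noteq> {}" using card_gt_0_iff by blast
  then obtain f where "f \<in> transversals V conf T" by blast
  then show ?thesis by (intro exI[of _ f]) (auto simp: transversals_def)
qed

section \<open>Sparsely intersecting linkages\<close>

definition path_arcs :: "'a list \<Rightarrow> ('a \<times> 'a) set" where
  "path_arcs p = {(u, v). \<exists>xs ys. p = xs @ u # v # ys}"

lemma successively_path_arcs: "successively (\<lambda>u v. (u, v) \<in> path_arcs p) p"
proof -
  have "successively (\<lambda>u v. (u, v) \<in> path_arcs p) q" if "p = xs @ q" for xs q
    using that
  proof (induction q arbitrary: xs)
    case (Cons x q)
    show ?case
    proof (cases q)
      case (Cons y ys)
      then have "(x, y) \<in> path_arcs p" using Cons.prems unfolding path_arcs_def by auto
      moreover have "successively (\<lambda>u v. (u, v) \<in> path_arcs p) q"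
        using Cons.IH[of "xs @ [x]"] Cons.prems by simp
      ultimately show ?thesis using Cons by (simp add: successively_Cons)
    qed simp
  qed simp
  then show ?thesis by (metis append_Nil)
qed

lemma path_arcs_subset_set: "path_arcs p \<subseteq> set p \<times> set p"
  by (auto simp: path_arcs_def)

lemma path_arcs_subset: "is_path E p \<Longrightarrow> path_arcs p \<subseteq> E"
  by (auto simp: path_arcs_def is_path_def successively_append_iff)

definition union_graph :: "nat list set \<Rightarrow> digraph" where
  "union_graph Ps = (\<Union>p\<in>Ps. set p, \<Union>p\<in>Ps. path_arcs p)"

lemma verts_union_graph: "verts (union_graph Ps) = (\<Union>p\<in>Ps. set p)"
  by (simp add: union_graph_def verts_def)

lemma is_path_union_graph:
  assumes "is_path E p" "p \<in> Ps"
  shows "is_path (arcs (union_graph Ps)) p"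
proof -
  have "successively (\<lambda>u v. (u, v) \<in> arcs (union_graph Ps)) p"
    using successively_path_arcs by (rule successively_mono) (use assms(2) in \<open>auto simp: union_graph_def arcs_def\<close>)
  then show ?thesis using assms(1) by (simp add: is_path_def)
qed

lemma subgraph_union_graph:
  assumes "finite Ps" "\<And>p. p \<in> Ps \<Longrightarrow> is_path (arcs G) p \<and> set p \<subseteq> verts G"
  shows "subgraph (union_graph Ps) G"
proof -
  have "arcs (union_graph Ps) \<subseteq> verts (union_graph Ps) \<times> verts (union_graph Ps)"
    using path_arcs_subset_set by (fastforce simp: union_graph_def verts_def arcs_def)
  moreover have "finite (verts (union_graph Ps))" using assms(1) by (simp add: verts_union_graph)
  moreover have "verts (union_graph Ps) \<subseteq> verts G"
    unfolding verts_union_graph using assms(2) by (intro UN_least) simp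
  moreover have "arcs (union_graph Ps) \<subseteq> arcs G"
    unfolding union_graph_def arcs_def[of "(_, _)"] snd_conv
    by (intro UN_least path_arcs_subset) (use assms(2) in simp)
  ultimately show ?thesis by (simp add: subgraph_def wf_digraph_def)
qed

definition packing :: "digraph \<Rightarrow> nat \<Rightarrow> nat \<Rightarrow> bool" where
  "packing G a b \<longleftrightarrow> (\<exists>Gs. (\<forall>g<a. subgraph (Gs g) G \<and> b \<le> dtw (Gs g)) \<and>
     (\<forall>v. card {g. g < a \<and> v \<in> verts (Gs g)} \<le> 4))"

lemma card_le_one_disjoint:
  assumes "\<And>g h. g < a \<Longrightarrow> h < a \<Longrightarrow> g \<noteq> h \<Longrightarrow> A g \<inter> A h = {}"
  shows "card {g. g < (a::nat) \<and> v \<in> A g} \<le> 1"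
proof -
  have "g = h" if "g \<in> {g. g < a \<and> v \<in> A g}" "h \<in> {g. g < a \<and> v \<in> A g}" for g h
    using assms[of g h] that by auto
  then show ?thesis by (simp add: card_le_Suc0_iff_eq)
qed

lemma card_hit_disjoint:
  assumes "finite Y" "\<And>i j. i \<in> I \<Longrightarrow> j \<in> I \<Longrightarrow> i \<noteq> j \<Longrightarrow> f i \<inter> f j = {}"
  shows "card {i\<in>I. f i \<inter> Y \<noteq> {}} \<le> card Y"
proof (rule ccontr)
  let ?J = "{i\<in>I. f i \<inter> Y \<noteq> {}}"
  assume "\<not> ?thesis"
  then have "\<exists>i\<in>?J. f i \<inter> Y = {}" by (intro disjoint_family_avoid) (use assms in auto)
  then show False by simp
qed

text \<open>At most \<open>b\<close> deleted vertices hit at most \<open>b\<close> pieces and at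
  most \<open>b\<close> connecting paths. A hit path discards both of its indices, so all but 3 * b
  indices stay clean, and the cores of clean indices reach each other. A set that contains all but 3
  * b cores contains a clean one, because \<open>card I\<close> exceeds 6 * b.\<close>

lemma clique_dtw:
  fixes G :: digraph and I :: "'i set"
  assumes wf: "wf_digraph G" and I: "finite I" "6 * b + 1 \<le> card I"
    and P: "\<And>i. i \<in> I \<Longrightarrow> is_path (arcs G) (p1 i @ p2 i) \<and> set (p1 i @ p2 i) \<subseteq> verts G \<and> p2 i \<noteq> []"
    and P_disj: "\<And>i j. i \<in> I \<Longrightarrow> j \<in> I \<Longrightarrow> i \<noteq> j \<Longrightarrow> set (p1 i @ p2 i) \<inter> set (p1 j @ p2 j) = {}"
    and Q: "\<And>i j. i \<in> I \<Longrightarrow> j \<in> I \<Longrightarrow> i \<noteq> j \<Longrightarrow> is_path (arcs G) (q i j) \<and> hd (q i j) \<in> set (p2 i) \<and>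
      last (q i j) \<in> set (p1 j)"
    and Q_disj: "\<And>i j i' j'. i \<in> I \<Longrightarrow> j \<in> I \<Longrightarrow> i' \<in> I \<Longrightarrow> j' \<in> I \<Longrightarrow> i \<noteq> j \<Longrightarrow> i' \<noteq> j' \<Longrightarrow>
      (i, j) \<noteq> (i', j') \<Longrightarrow> set (q i j) \<inter> set (q i' j') = {}"
  shows "b \<le> dtw G"
proof -
  have finV: "finite (verts G)" using wf by (simp add: wf_digraph_def)
  \<comment> \<open>The first vertex of \<open>p2 i\<close> is reached from all of
    \<open>p1 i\<close>, where paths arrive, and it reaches all of \<open>p2 i\<close>, where paths
    depart.\<close>
  define core where "core i = hd (p2 i)" for i
  have core_in: "core i \<in> set (p2 i)" "core i \<in> verts G" if "i \<in> I" for i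
  proof -
    show *: "core i \<in> set (p2 i)" using P[OF that] by (simp add: core_def)
    show "core i \<in> verts G" using * P[OF that] by auto
  qed
  have reach: "(core i, core j) \<in> (restr (arcs G) Z)\<^sup>*"
    if ij: "i \<in> I" "j \<in> I" "i \<noteq> j"
      and Z: "set (p1 i @ p2 i) \<inter> Z = {}" "set (p1 j @ p2 j) \<inter> Z = {}" "set (q i j) \<inter> Z = {}" for i j Z
  proof -
    have "is_path (arcs G) (p2 i)" using is_path_appendD[of "arcs G" "p1 i" "p2 i" "[]"] P[OF ij(1)] by simp
    then have 1: "(core i, hd (q i j)) \<in> (restr (arcs G) Z)\<^sup>*"
      unfolding core_def by (rule is_path_hd_reach) (use Q[OF ij] Z(1) in auto)
    have q: "is_path (arcs G) (q i j)" "q i j \<noteq> []" using Q[OF ij] by (auto simp: is_path_def)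
    have 2: "(hd (q i j), last (q i j)) \<in> (restr (arcs G) Z)\<^sup>*"
      by (rule is_path_hd_reach[OF q(1) last_in_set[OF q(2)] Z(3)])
    have 3: "(last (q i j), core j) \<in> (restr (arcs G) Z)\<^sup>*"
      by (rule is_path_reach[of "arcs G" "p1 j" "p2 j"]) (use P[OF ij(2)] Q[OF ij] core_in(1)[OF ij(2)] Z(2) in auto)
    show ?thesis using rtrancl_trans[OF rtrancl_trans[OF 1 2] 3] .
  qed
  define \<Phi> where "\<Phi> S \<longleftrightarrow> card I \<le> card {i\<in>I. core i \<in> S} + 3 * b" for S
  show ?thesis
  proof (rule dtw_ge_descent[OF wf, of \<Phi>])
    obtain i where "i \<in> I" using I(2) by fastforce
    then show "verts G \<noteq> {}" using core_in(2) by auto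
    have "{i\<in>I. core i \<in> verts G} = I" using core_in(2) by auto
    then show "\<Phi> (verts G)" by (simp add: \<Phi>_def)
  next
    fix S X Y
    assume S: "z_normal G X S" "\<Phi> S" and XY: "X \<subseteq> Y" "Y \<subseteq> verts G" "card Y \<le> b"
    have finY: "finite Y" using XY(2) finV by (rule finite_subset)
    define B1 where "B1 = {i\<in>I. set (p1 i @ p2 i) \<inter> Y \<noteq> {}}"
    define B2 where "B2 = {t\<in>{(i, j). i \<in> I \<and> j \<in> I \<and> i \<noteq> j}. set (q (fst t) (snd t)) \<inter> Y \<noteq> {}}"
    define I0 where "I0 = I - (B1 \<union> fst ` B2 \<union> snd ` B2)"
    have "finite {(i, j). i \<in> I \<and> j \<in> I \<and> i \<noteq> j}" by (rule finite_subset[of _ "I \<times> I"]) (use I(1) in auto)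
    then have finB: "finite B1" "finite B2" using I(1) by (simp_all add: B1_def B2_def)
    have "card B1 \<le> card Y" unfolding B1_def by (rule card_hit_disjoint[OF finY P_disj])
    moreover have "card B2 \<le> card Y" unfolding B2_def
    proof (rule card_hit_disjoint[OF finY])
      fix s t assume st: "s \<in> {(i, j). i \<in> I \<and> j \<in> I \<and> i \<noteq> j}" "t \<in> {(i, j). i \<in> I \<and> j \<in> I \<and> i \<noteq> j}" "s \<noteq> t"
      obtain i j i' j' where eq: "s = (i, j)" "t = (i', j')" by (cases s, cases t)
      show "set (q (fst s) (snd s)) \<inter> set (q (fst t) (snd t)) = {}"
        using st Q_disj[of i j i' j'] unfolding eq by simp
    qed
    moreover have "card (fst ` B2) \<le> card B2" "card (snd ` B2) \<le> card B2" using finB(2) by (auto intro: card_image_le)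
    moreover have "card (B1 \<union> fst ` B2 \<union> snd ` B2) \<le> card B1 + card (fst ` B2) + card (snd ` B2)"
      using card_Un_le[of "B1 \<union> fst ` B2" "snd ` B2"] card_Un_le[of B1 "fst ` B2"] by linarith
    ultimately have "card (B1 \<union> fst ` B2 \<union> snd ` B2) \<le> 3 * b" using XY(3) by linarith
    moreover have "card I \<le> card I0 + card (B1 \<union> fst ` B2 \<union> snd ` B2)"
    proof -
      have "I \<subseteq> I0 \<union> (B1 \<union> fst ` B2 \<union> snd ` B2)" by (auto simp: I0_def)
      then have "card I \<le> card (I0 \<union> (B1 \<union> fst ` B2 \<union> snd ` B2))"
        using finB I(1) by (intro card_mono) (auto simp: I0_def)
      also have "\<dots> \<le> card I0 + card (B1 \<union> fst ` B2 \<union> snd ` B2)" by (rule card_Un_le)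
      finally show ?thesis .
    qed
    ultimately have cI0: "card I \<le> card I0 + 3 * b" by linarith
    have I0I: "I0 \<subseteq> I" by (auto simp: I0_def)
    have "I0 \<inter> {i\<in>I. core i \<in> S} \<noteq> {}"
    proof
      assume e: "I0 \<inter> {i\<in>I. core i \<in> S} = {}"
      have "card I0 + card {i\<in>I. core i \<in> S} = card (I0 \<union> {i\<in>I. core i \<in> S})"
        using e I(1) I0I by (subst card_Un_disjoint) (auto intro: finite_subset)
      also have "\<dots> \<le> card I" using I(1) I0I by (intro card_mono) auto
      finally show False using cI0 S(2) I(2) unfolding \<Phi>_def by linarith
    qed
    then obtain i where i: "i \<in> I0" "core i \<in> S" by blast
    have clean: "set (p1 j @ p2 j) \<inter> Y = {}" if "j \<in> I0" for j using that by (auto simp: I0_def B1_def)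
    have cleanQ: "set (q j k) \<inter> Y = {}" if jk: "j \<in> I0" "k \<in> I0" "j \<noteq> k" for j k
    proof (rule ccontr)
      assume "set (q j k) \<inter> Y \<noteq> {}"
      then have "(j, k) \<in> B2" using jk I0I by (auto simp: B2_def)
      then have "j \<in> fst ` B2" by force
      then show False using jk(1) by (simp add: I0_def)
    qed
    have conn: "(core j, core k) \<in> (restr (arcs G) Y)\<^sup>*" if "j \<in> I0" "k \<in> I0" for j k
    proof (cases "j = k")
      case False
      show ?thesis
        by (rule reach) (use that I0I False clean[OF that(1)] clean[OF that(2)] cleanQ[OF that False] in auto)
    qed simp
    have "core i \<notin> Y" using clean[OF i(1)] core_in(1)[of i] i(1) I0I by auto
    moreover have "\<Phi> S'" if S': "z_normal G X' S'" "X' \<subseteq> Y" "core i \<in> S'" for S' X'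
    proof -
      have "core j \<in> S'" if j: "j \<in> I0" for j
      proof (rule z_normal_closed[OF wf S'(1,3,3)])
        show "(core i, core j) \<in> (restr (arcs G) X')\<^sup>*" using restr_rtrancl_mono[OF conn[OF i(1) j] subset_refl S'(2)] .
        show "(core j, core i) \<in> (restr (arcs G) X')\<^sup>*" using restr_rtrancl_mono[OF conn[OF j i(1)] subset_refl S'(2)] .
      qed
      then have "I0 \<subseteq> {i\<in>I. core i \<in> S'}" using I0I by auto
      then have "card I0 \<le> card {i\<in>I. core i \<in> S'}" using I(1) by (intro card_mono) auto
      then show ?thesis using cI0 unfolding \<Phi>_def by linarith
    qed
    ultimately show "\<exists>v\<in>S - Y. \<forall>S' X'. z_normal G X' S' \<longrightarrow> X' \<subseteq> Y \<longrightarrow> v \<in> S' \<longrightarrow> \<Phi> S'"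
      using i(2) by (intro bexI[of _ "core i"]) auto
  qed
qed

lemma packing_of_transversal:
  fixes G :: digraph
  assumes wf: "wf_digraph G" and M: "6 * b + 1 \<le> M"
    and P: "\<And>i. i < a * M \<Longrightarrow> is_path (arcs G) (p1 i @ p2 i) \<and> set (p1 i @ p2 i) \<subseteq> verts G \<and> p2 i \<noteq> []"
    and P_disj: "\<And>i j. i < a * M \<Longrightarrow> j < a * M \<Longrightarrow> i \<noteq> j \<Longrightarrow> set (p1 i @ p2 i) \<inter> set (p1 j @ p2 j) = {}"
    and T: "T = {(i, j). i < a * M \<and> j < a * M \<and> i \<noteq> j \<and> i div M = j div M}"
    and Q: "\<And>i j. (i, j) \<in> T \<Longrightarrow> is_path (arcs G) (q (i, j)) \<and> hd (q (i, j)) \<in> set (p2 i) \<and>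
      last (q (i, j)) \<in> set (p1 j)"
    and Q_disj: "\<And>s t. s \<in> T \<Longrightarrow> t \<in> T \<Longrightarrow> s \<noteq> t \<Longrightarrow> set (q s) \<inter> set (q t) = {}"
  shows "packing G a b"
proof -
  have M0: "M > 0" using M by simp
  define I where "I g = {i. i < a * M \<and> i div M = g}" for g
  define TT where "TT g = {(i, j). i \<in> I g \<and> j \<in> I g \<and> i \<noteq> j}" for g
  define Ps where "Ps g = (\<lambda>i. p1 i @ p2 i) ` I g \<union> q ` TT g" for g
  have TT: "TT g \<subseteq> T" for g by (auto simp: TT_def I_def T)
  have finI: "finite (I g)" for g by (simp add: I_def)
  have "TT g \<subseteq> I g \<times> I g" for g by (auto simp: TT_def)
  then have finPs: "finite (Ps g)" for g
    using finI finite_subset[of "TT g" "I g \<times> I g"] by (simp add: Ps_def)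
  have cI: "card (I g) = M" if "g < a" for g
  proof -
    have "Suc g * M \<le> a * M" using that by (intro mult_le_mono1) simp
    moreover have "i div M = g \<longleftrightarrow> g * M \<le> i \<and> i < Suc g * M" for i
    proof -
      have "i div M = g \<longleftrightarrow> g \<le> i div M \<and> i div M < Suc g" by linarith
      then show ?thesis by (simp only: less_eq_div_iff_mult_less_eq[OF M0] div_less_iff_less_mult[OF M0])
    qed
    ultimately have "i \<in> I g \<longleftrightarrow> i \<in> {g * M..<Suc g * M}" for i
      unfolding I_def by (simp only: mem_Collect_eq atLeastLessThan_iff) linarith
    then have "I g = {g * M..<Suc g * M}" by (rule set_eqI)
    then show ?thesis by simp
  qed
  have arcsV: "arcs G \<subseteq> verts G \<times> verts G" using wf by (simp add: wf_digraph_def)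
  have Qs: "is_path (arcs G) (q t) \<and> set (q t) \<subseteq> verts G" if t: "t \<in> T" for t
  proof -
    obtain i j where ij: "t = (i, j)" by (cases t)
    have "i < a * M" using t ij by (simp add: T)
    then have "hd (q t) \<in> verts G" using Q[of i j] t ij P[of i] by auto
    then show ?thesis using Q[of i j] t ij is_path_subset[OF _ _ arcsV] by auto
  qed
  have Ps_path: "is_path (arcs G) p \<and> set p \<subseteq> verts G" if p: "p \<in> Ps g" for p g
  proof -
    consider i where "i \<in> I g" "p = p1 i @ p2 i" | t where "t \<in> TT g" "p = q t"
      using p by (auto simp: Ps_def)
    then show ?thesis
    proof cases
      case (1 i)
      then show ?thesis using P[of i] by (simp add: I_def)
    next
      case (2 t)
      then show ?thesis using Qs[of t] TT by auto
    qed
  qed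
  let ?G = "\<lambda>g. union_graph (Ps g)"
  have sub: "subgraph (?G g) G" for g
    by (rule subgraph_union_graph[OF finPs]) (rule Ps_path)
  have "b \<le> dtw (?G g)" if g: "g < a" for g
  proof (rule clique_dtw[where I = "I g" and ?p1.0 = p1 and ?p2.0 = p2 and q = "\<lambda>i j. q (i, j)"])
    show "wf_digraph (?G g)" using sub by (simp add: subgraph_def)
    show "finite (I g)" by (rule finI)
    show "6 * b + 1 \<le> card (I g)" using cI[OF g] M by simp
  next
    fix i assume i: "i \<in> I g"
    then have *: "p1 i @ p2 i \<in> Ps g" by (simp add: Ps_def)
    have iN: "i < a * M" using i by (simp add: I_def)
    show "is_path (arcs (?G g)) (p1 i @ p2 i) \<and> set (p1 i @ p2 i) \<subseteq> verts (?G g) \<and> p2 i \<noteq> []"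
    proof (intro conjI)
      show "is_path (arcs (?G g)) (p1 i @ p2 i)" by (rule is_path_union_graph[OF _ *]) (use P[OF iN] in blast)
      show "set (p1 i @ p2 i) \<subseteq> verts (?G g)" unfolding verts_union_graph using * by (rule UN_upper)
      show "p2 i \<noteq> []" using P[OF iN] by blast
    qed
  next
    fix i j assume "i \<in> I g" "j \<in> I g" "i \<noteq> j"
    then show "set (p1 i @ p2 i) \<inter> set (p1 j @ p2 j) = {}" by (intro P_disj) (auto simp: I_def)
  next
    fix i j assume "i \<in> I g" "j \<in> I g" "i \<noteq> j"
    then have t: "(i, j) \<in> TT g" by (simp add: TT_def)
    then have *: "q (i, j) \<in> Ps g" by (simp add: Ps_def)
    have tT: "(i, j) \<in> T" using t TT by blast
    show "is_path (arcs (?G g)) (q (i, j)) \<and> hd (q (i, j)) \<in> set (p2 i) \<and> last (q (i, j)) \<in> set (p1 j)"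
      using is_path_union_graph[OF _ *] Q[OF tT] by blast
  next
    fix i j i' j' assume "i \<in> I g" "j \<in> I g" "i' \<in> I g" "j' \<in> I g" "i \<noteq> j" "i' \<noteq> j'" "(i, j) \<noteq> (i', j')"
    then show "set (q (i, j)) \<inter> set (q (i', j')) = {}"
      by (intro Q_disj) (auto simp: T I_def)
  qed
  moreover have "card {g. g < a \<and> v \<in> verts (?G g)} \<le> 4" for v
  proof -
    let ?A = "\<lambda>g. \<Union>i\<in>I g. set (p1 i @ p2 i)" and ?B = "\<lambda>g. \<Union>t\<in>TT g. set (q t)"
    have "?A g \<inter> ?A h = {}" if gh: "g \<noteq> h" for g h
    proof -
      have "set (p1 i @ p2 i) \<inter> set (p1 j @ p2 j) = {}" if "i \<in> I g" "j \<in> I h" for i j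
        using that gh by (intro P_disj) (auto simp: I_def)
      then show ?thesis by blast
    qed
    then have 1: "card {g. g < a \<and> v \<in> ?A g} \<le> 1" by (intro card_le_one_disjoint) simp
    have "?B g \<inter> ?B h = {}" if gh: "g \<noteq> h" for g h
    proof -
      have "set (q s) \<inter> set (q t) = {}" if "s \<in> TT g" "t \<in> TT h" for s t
      proof (rule Q_disj)
        show "s \<in> T" "t \<in> T" using that TT by auto
        show "s \<noteq> t" using that gh by (auto simp: TT_def I_def)
      qed
      then show ?thesis by blast
    qed
    then have 2: "card {g. g < a \<and> v \<in> ?B g} \<le> 1" by (intro card_le_one_disjoint) simp
    have "{g. g < a \<and> v \<in> verts (?G g)} = {g. g < a \<and> v \<in> ?A g} \<union> {g. g < a \<and> v \<in> ?B g}"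
      unfolding verts_union_graph Ps_def by auto
    then show ?thesis using 1 2 card_Un_le[of "{g. g < a \<and> v \<in> ?A g}" "{g. g < a \<and> v \<in> ?B g}"] by simp
  qed
  ultimately show ?thesis using sub unfolding packing_def by (intro exI[of _ ?G]) simp
qed

lemma packing_sparse:
  fixes G :: digraph
  assumes wf: "wf_digraph G" and M: "6 * b + 1 \<le> M" and S: "S \<ge> 1"
    and P: "\<And>i. i < a * M \<Longrightarrow> is_path (arcs G) (p1 i @ p2 i) \<and> set (p1 i @ p2 i) \<subseteq> verts G \<and>
       In i \<subseteq> set (p1 i) \<and> Out i \<subseteq> set (p2 i) \<and> card (Out i) = S"
    and P_disj: "\<And>i j. i < a * M \<Longrightarrow> j < a * M \<Longrightarrow> i \<noteq> j \<Longrightarrow> set (p1 i @ p2 i) \<inter> set (p1 j @ p2 j) = {}"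
    and T: "T = {(i, j). i < a * M \<and> j < a * M \<and> i \<noteq> j \<and> i div M = j div M}"
    and L: "\<And>i j. (i, j) \<in> T \<Longrightarrow> linkage (arcs G) (Out i) (In j) (L (i, j))"
    and sparse: "\<And>s t. s \<in> T \<Longrightarrow> t \<in> T \<Longrightarrow> s \<noteq> t \<Longrightarrow>
      card {(u, v) \<in> Out (fst s) \<times> Out (fst t). set (L s u) \<inter> set (L t v) \<noteq> {}} \<le> e"
    and e: "4 * (a * M * M) * e \<le> S * S"
  shows "packing G a b"
proof -
  have M0: "M > 0" using M by simp
  \<comment> \<open>Within a group \<open>j mod M\<close> determines \<open>j\<close>, so there are
    at most \<open>a * M * M\<close> ordered pairs instead of (a * M)^2.\<close>
  have inj: "inj_on (\<lambda>(i, j). (i, j mod M)) T"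
  proof (rule inj_onI)
    fix s t assume st: "s \<in> T" "t \<in> T" "(\<lambda>(i, j). (i, j mod M)) s = (\<lambda>(i, j). (i, j mod M)) t"
    obtain i j i' j' where "s = (i, j)" "t = (i', j')" by (cases s, cases t)
    then show "s = t" using st by (auto simp: T) (metis div_mult_mod_eq)
  qed
  have img: "(\<lambda>(i, j). (i, j mod M)) ` T \<subseteq> {..<a * M} \<times> {..<M}" using M0 by (auto simp: T)
  have finT: "finite T" using inj img by (meson finite_SigmaI finite_imageD finite_lessThan finite_subset)
  have cT: "card T \<le> a * M * M" using card_inj_on_le[OF inj img] by simp
  have fstT: "fst t < a * M" if "t \<in> T" for t using that by (auto simp: T)
  have "\<exists>f. (\<forall>t\<in>T. f t \<in> Out (fst t)) \<and>
      (\<forall>s\<in>T. \<forall>t\<in>T. s \<noteq> t \<longrightarrow> \<not> set (L s (f s)) \<inter> set (L t (f t)) \<noteq> {})"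
  proof (rule independent_transversal[OF finT _ _ S _ _ cT e, where V = "\<lambda>t. Out (fst t)"
      and conf = "\<lambda>s u t v. set (L s u) \<inter> set (L t v) \<noteq> {}"])
    show "finite (Out (fst t))" "card (Out (fst t)) = S" if "t \<in> T" for t
      using P[OF fstT[OF that]] S by (auto intro: card_ge_0_finite)
    show "set (L t v) \<inter> set (L s u) \<noteq> {}" if "set (L s u) \<inter> set (L t v) \<noteq> {}" for s u t v
      using that by (simp only: Int_commute not_False_eq_True)
    show "card {(u, v) \<in> Out (fst s) \<times> Out (fst t). set (L s u) \<inter> set (L t v) \<noteq> {}} \<le> e"
      if "s \<in> T" "t \<in> T" "s \<noteq> t" for s t using sparse[OF that] .
  qed
  then obtain f where f: "\<And>t. t \<in> T \<Longrightarrow> f t \<in> Out (fst t)"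
    "\<And>s t. s \<in> T \<Longrightarrow> t \<in> T \<Longrightarrow> s \<noteq> t \<Longrightarrow> set (L s (f s)) \<inter> set (L t (f t)) = {}" by blast
  show ?thesis
  proof (rule packing_of_transversal[OF wf M _ P_disj T, where q = "\<lambda>t. L t (f t)"])
    fix i assume i: "i < a * M"
    have "Out i \<noteq> {}" using P[OF i] S by auto
    then show "is_path (arcs G) (p1 i @ p2 i) \<and> set (p1 i @ p2 i) \<subseteq> verts G \<and> p2 i \<noteq> []" using P[OF i] by auto
  next
    fix i j assume ij: "(i, j) \<in> T"
    then have i: "i < a * M" "j < a * M" by (auto simp: T)
    have u: "f (i, j) \<in> Out i" using f(1)[OF ij] by simp
    have "is_path (arcs G) (L (i, j) (f (i, j))) \<and> hd (L (i, j) (f (i, j))) = f (i, j) \<and> last (L (i, j) (f (i, j))) \<in> In j"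
      using L[OF ij] u unfolding linkage_def by simp
    then show "is_path (arcs G) (L (i, j) (f (i, j))) \<and> hd (L (i, j) (f (i, j))) \<in> set (p2 i) \<and>
        last (L (i, j) (f (i, j))) \<in> set (p1 j)"
      using u P[OF i(1)] P[OF i(2)] by auto
  qed (use f(2) in auto)
qed

section \<open>Chained families of paths\<close>

text \<open>Think of the sets \<open>P i\<close> as consecutive segments of a few long walks: deleting \<open>b\<close> vertices
  breaks boundedly many steps, and \<open>f\<close> advances to the next segment with index in \<open>N\<close>.\<close>
definition chained :: "digraph \<Rightarrow> ('i \<Rightarrow> nat set) \<Rightarrow> 'i set \<Rightarrow> nat \<Rightarrow> nat \<Rightarrow> bool" where
  "chained G P I b B \<longleftrightarrow> (\<forall>N Z. N \<subseteq> I \<longrightarrow> finite Z \<longrightarrow> card Z \<le> b \<longrightarrow>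
     (\<exists>F f. F \<subseteq> N \<and> inj_on f F \<and> f ` F \<subseteq> N \<and> card N \<le> card F + B \<and>
       (\<forall>i\<in>F. P i \<inter> Z = {} \<and> P (f i) \<inter> Z = {} \<and>
         (\<forall>u\<in>P i. \<forall>v\<in>P (f i). (u, v) \<in> (restr (arcs G) Z)\<^sup>*))))"

lemma chainedD:
  assumes "chained G P I b B" "N \<subseteq> I" "finite Z" "card Z \<le> b"
  obtains F f where "F \<subseteq> N" "inj_on f F" "f ` F \<subseteq> N" "card N \<le> card F + B"
    "\<And>i. i \<in> F \<Longrightarrow> P i \<inter> Z = {}" "\<And>i. i \<in> F \<Longrightarrow> P (f i) \<inter> Z = {}"
    "\<And>i u v. i \<in> F \<Longrightarrow> u \<in> P i \<Longrightarrow> v \<in> P (f i) \<Longrightarrow> (u, v) \<in> (restr (arcs G) Z)\<^sup>*"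
proof -
  have "\<exists>F f. F \<subseteq> N \<and> inj_on f F \<and> f ` F \<subseteq> N \<and> card N \<le> card F + B \<and>
       (\<forall>i\<in>F. P i \<inter> Z = {} \<and> P (f i) \<inter> Z = {} \<and>
         (\<forall>u\<in>P i. \<forall>v\<in>P (f i). (u, v) \<in> (restr (arcs G) Z)\<^sup>*))"
    using assms unfolding chained_def by simp
  then obtain F f where "F \<subseteq> N \<and> inj_on f F \<and> f ` F \<subseteq> N \<and> card N \<le> card F + B \<and>
       (\<forall>i\<in>F. P i \<inter> Z = {} \<and> P (f i) \<inter> Z = {} \<and>
         (\<forall>u\<in>P i. \<forall>v\<in>P (f i). (u, v) \<in> (restr (arcs G) Z)\<^sup>*))" by blast
  then show thesis by (intro that[of F f]) simp_all
qed

lemma chained_subset: "chained G P I b B \<Longrightarrow> U \<subseteq> I \<Longrightarrow> chained G P U b B"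
  unfolding chained_def using subset_trans[of _ U I] by simp

text \<open>If \<open>y\<close> lies both in \<open>F\<close> and in its image under
  \<open>f\<close>, then \<open>Q y\<close> is passed by a walk between two members of the family
  that meet \<open>A\<close>, so normality puts all of \<open>Q y\<close> into \<open>S\<close>. The
  set \<open>F\<close> and its image each miss at most \<open>B\<close> of the members that meet
  \<open>A\<close>, hence their intersection misses at most 2 * B.\<close>

lemma inner_degree:
  assumes wf: "wf_digraph G" and norm: "z_normal G X S" and X: "finite X" "card X \<le> b"
    and ch: "chained G Q U b B" and fin: "finite U" and A: "A \<subseteq> S"
    and QV: "\<And>y. y \<in> U \<Longrightarrow> Q y \<subseteq> verts G"
  shows "card {y\<in>U. A \<inter> Q y \<noteq> {}} \<le> card {y\<in>{y\<in>U. Q y \<subseteq> S}. A \<inter> Q y \<noteq> {}} + 2 * B"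
proof -
  let ?N = "{y\<in>U. A \<inter> Q y \<noteq> {}}"
  obtain F f where F: "F \<subseteq> ?N" "inj_on f F" "f ` F \<subseteq> ?N" "card ?N \<le> card F + B"
    and reach: "\<And>i u v. i \<in> F \<Longrightarrow> u \<in> Q i \<Longrightarrow> v \<in> Q (f i) \<Longrightarrow> (u, v) \<in> (restr (arcs G) X)\<^sup>*"
    by (rule chainedD[OF ch _ X, of ?N]) auto
  have fins: "finite ?N" "finite F" using fin F(1) finite_subset[of F ?N] by auto
  have "Q y \<subseteq> S" if y: "y \<in> F" "y \<in> f ` F" for y
  proof
    fix v assume v: "v \<in> Q y"
    obtain x where x: "x \<in> F" "y = f x" using y(2) by blast
    obtain p where p: "p \<in> A" "p \<in> Q x" using F(1) x(1) by blast
    obtain p' where p': "p' \<in> A" "p' \<in> Q (f y)" using F(3) y(1) by blast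
    have "(p, v) \<in> (restr (arcs G) X)\<^sup>*" using reach[OF x(1) p(2)] v x(2) by simp
    moreover have "(v, p') \<in> (restr (arcs G) X)\<^sup>*" using reach[OF y(1) v p'(2)] .
    ultimately show "v \<in> S" using z_normal_closed[OF wf norm, of p p' v] p(1) p'(1) A by auto
  qed
  then have "F \<inter> f ` F \<subseteq> {y\<in>{y\<in>U. Q y \<subseteq> S}. A \<inter> Q y \<noteq> {}}" using F(1) by auto
  then have "card (F \<inter> f ` F) \<le> card {y\<in>{y\<in>U. Q y \<subseteq> S}. A \<inter> Q y \<noteq> {}}" using fin by (intro card_mono) auto
  moreover have "card F + card (f ` F) = card (F \<union> f ` F) + card (F \<inter> f ` F)"
    using fins by (intro card_Un_Int) auto
  moreover have "card (F \<union> f ` F) \<le> card ?N" using fins(1) F(1,3) by (intro card_mono) auto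
  moreover have "card (f ` F) = card F" using F(2) by (rule card_image)
  ultimately show ?thesis using F(4) by linarith
qed

lemma sum_card_swap:
  assumes "finite A" "finite B"
  shows "(\<Sum>y\<in>B. card {x\<in>A. R x y}) = (\<Sum>x\<in>A. card {y\<in>B. R x y})"
  using sum.swap_restrict[OF assms(2,1), of "\<lambda>_ _. 1::nat" "\<lambda>y x. R x y"] by simp

text \<open>Most intersecting pairs \<open>P x\<close>, \<open>Q y\<close> admit a closed walk: from \<open>P x\<close> advance along the first
  family into \<open>Q y\<close>, then along the second family into the predecessor of \<open>P x\<close> with respect to
  \<open>Q y\<close>, and from there to \<open>P x\<close>.\<close>
lemma exists_strong_member:
  assumes chP: "chained G P U b B" and chQ: "chained G Q U' b B" and fin: "finite U" "finite U'"
    and Y: "finite Y" "card Y \<le> b" and sub: "T \<subseteq> U" "T' \<subseteq> U'" and ne: "T \<noteq> {}"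
    and deg: "\<And>x. x \<in> T \<Longrightarrow> 3 * B < card {y\<in>T'. P x \<inter> Q y \<noteq> {}}"
    and deg': "\<And>y. y \<in> T' \<Longrightarrow> 3 * B < card {x\<in>T. P x \<inter> Q y \<noteq> {}}"
  shows "\<exists>x\<in>T. P x \<inter> Y = {} \<and> (\<forall>u\<in>P x. \<forall>v\<in>P x. (u, v) \<in> (restr (arcs G) Y)\<^sup>*)"
proof -
  have finT: "finite T" "finite T'" using sub fin by (auto intro: finite_subset)
  define N where "N y = {x\<in>T. P x \<inter> Q y \<noteq> {}}" for y
  define N' where "N' x = {y\<in>T'. P x \<inter> Q y \<noteq> {}}" for x
  let ?good = "\<lambda>(P::_ \<Rightarrow> nat set) M F f. F \<subseteq> M \<and> inj_on f F \<and> f ` F \<subseteq> M \<and> card M \<le> card F + B \<and>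
       (\<forall>i\<in>F. P i \<inter> Y = {} \<and> P (f i) \<inter> Y = {} \<and> (\<forall>u\<in>P i. \<forall>v\<in>P (f i). (u, v) \<in> (restr (arcs G) Y)\<^sup>*))"
  have "\<exists>F f. ?good P (N y) F f" for y
  proof -
    have "N y \<subseteq> U" using sub(1) by (auto simp: N_def)
    then show ?thesis using chP Y unfolding chained_def by simp
  qed
  then have "\<exists>Fs fs. \<forall>y. ?good P (N y) (Fs y) (fs y)" by metis
  then obtain F f where F: "\<And>y. ?good P (N y) (F y) (f y)" by blast
  have "\<exists>F f. ?good Q (N' x) F f" for x
  proof -
    have "N' x \<subseteq> U'" using sub(2) by (auto simp: N'_def)
    then show ?thesis using chQ Y unfolding chained_def by simp
  qed
  then have "\<exists>Fs fs. \<forall>x. ?good Q (N' x) (Fs x) (fs x)" by metis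
  then obtain F' f' where F': "\<And>x. ?good Q (N' x) (F' x) (f' x)" by blast
  \<comment> \<open>For \<open>x\<close> in \<open>Gd y\<close> both moves are possible:
    \<open>x\<close> advances among the neighbours of \<open>y\<close>, and \<open>y\<close>
    advances among the neighbours of \<open>x\<close>.\<close>
  define Gd where "Gd y = {x\<in>F y. y \<in> F' x}" for y
  define bad where "bad y = {x\<in>T. P x \<inter> Q y \<noteq> {} \<and> y \<notin> F' x}" for y
  have finN: "finite (N y)" "finite (F y)" "finite (Gd y)" "finite (bad y)" for y
    using finT(1) F[of y] finite_subset[of "F y" "N y"] by (auto simp: N_def Gd_def bad_def)
  \<comment> \<open>For such a \<open>y\<close> the image of \<open>Gd y\<close> under
    \<open>f y\<close> and the set \<open>F y\<close> overlap inside \<open>N y\<close>. If no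
    \<open>y\<close> qualified, the number e of intersecting pairs would satisfy e \<le> B * |T| + 2
    * B * |T'|. Minimum degree 3 * B + 1 on both sides gives (3 * B + 1) * |T| \<le> e and the same
    for \<open>T'\<close>, hence (3 * B + 1) * e \<le> 3 * B * e and e = 0.\<close>
  have "\<exists>y\<in>T'. card (N y) < card (Gd y) + card (F y)"
  proof (rule ccontr)
    assume "\<not> ?thesis"
    then have le: "card (Gd y) + card (F y) \<le> card (N y)" if "y \<in> T'" for y using that by (auto simp: not_less)
    have "card (N y) \<le> card (bad y) + 2 * B" if y: "y \<in> T'" for y
    proof -
      have "F y \<subseteq> Gd y \<union> bad y" using F[of y] by (auto simp: Gd_def bad_def N_def)
      then have "card (F y) \<le> card (Gd y \<union> bad y)" using finN by (intro card_mono) auto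
      also have "\<dots> \<le> card (Gd y) + card (bad y)" by (rule card_Un_le)
      finally have "card (F y) \<le> card (Gd y) + card (bad y)" .
      moreover have "card (N y) \<le> card (F y) + B" using F[of y] by simp
      ultimately show ?thesis using le[OF y] by linarith
    qed
    then have "(\<Sum>y\<in>T'. card (N y)) \<le> (\<Sum>y\<in>T'. card (bad y) + 2 * B)" by (rule sum_mono)
    also have "\<dots> = (\<Sum>y\<in>T'. card (bad y)) + card T' * (2 * B)" by (simp add: sum.distrib)
    also have "(\<Sum>y\<in>T'. card (bad y)) = (\<Sum>x\<in>T. card {y\<in>T'. P x \<inter> Q y \<noteq> {} \<and> y \<notin> F' x})"
      unfolding bad_def by (rule sum_card_swap[OF finT])
    also have "\<dots> \<le> (\<Sum>x\<in>T. B)"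
    proof (rule sum_mono)
      fix x assume "x \<in> T"
      have "{y\<in>T'. P x \<inter> Q y \<noteq> {} \<and> y \<notin> F' x} = N' x - F' x" by (auto simp: N'_def)
      moreover have "finite (F' x)" using F'[of x] finT(2) finite_subset[of "F' x" "N' x"] by (auto simp: N'_def)
      moreover have "F' x \<subseteq> N' x" using F'[of x] by simp
      ultimately have "card {y\<in>T'. P x \<inter> Q y \<noteq> {} \<and> y \<notin> F' x} = card (N' x) - card (F' x)"
        by (simp add: card_Diff_subset)
      moreover have "card (N' x) \<le> card (F' x) + B" using F'[of x] by simp
      ultimately show "card {y\<in>T'. P x \<inter> Q y \<noteq> {} \<and> y \<notin> F' x} \<le> B" by linarith
    qed
    finally have up: "(\<Sum>y\<in>T'. card (N y)) \<le> card T * B + card T' * (2 * B)" by simp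
    define e where "e = (\<Sum>y\<in>T'. card (N y))"
    have e2: "e = (\<Sum>x\<in>T. card (N' x))" unfolding e_def N_def N'_def by (rule sum_card_swap[OF finT])
    have "(\<Sum>y\<in>T'. 3 * B + 1) \<le> e" unfolding e_def using deg' by (intro sum_mono) (simp add: N_def Suc_le_eq)
    then have 1: "card T' * (3 * B + 1) \<le> e" by simp
    have "(\<Sum>x\<in>T. 3 * B + 1) \<le> e" unfolding e2 using deg by (intro sum_mono) (simp add: N'_def Suc_le_eq)
    then have 2: "card T * (3 * B + 1) \<le> e" by simp
    have "(3 * B + 1) * e \<le> (3 * B + 1) * (card T * B + card T' * (2 * B))"
      using up unfolding e_def by (rule mult_le_mono2)
    also have "\<dots> = card T * (3 * B + 1) * B + card T' * (3 * B + 1) * (2 * B)" by (simp add: algebra_simps)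
    also have "\<dots> \<le> e * B + e * (2 * B)" using 1 2 by (intro add_le_mono mult_le_mono1)
    finally have "e = 0" by (simp add: algebra_simps)
    moreover have "card T > 0" using ne finT(1) by (simp add: card_gt_0_iff)
    ultimately show False using 2 by simp
  qed
  then obtain y where y: "y \<in> T'" "card (N y) < card (Gd y) + card (F y)" by blast
  have Gd_sub: "Gd y \<subseteq> F y" by (auto simp: Gd_def)
  have Fy: "F y \<subseteq> N y" "inj_on (f y) (F y)" "f y ` F y \<subseteq> N y" using F[of y] by simp_all
  have "f y ` Gd y \<inter> F y \<noteq> {}"
  proof
    assume e: "f y ` Gd y \<inter> F y = {}"
    have "card (f y ` Gd y) = card (Gd y)" using inj_on_subset[OF Fy(2) Gd_sub] by (rule card_image)
    then have "card (Gd y) + card (F y) = card (f y ` Gd y \<union> F y)"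
      using card_Un_disjoint[OF _ finN(2) e] finN(3) by simp
    also have "\<dots> \<le> card (N y)" using finN(1) Fy Gd_sub by (intro card_mono) blast+
    finally show False using y(2) by simp
  qed
  then obtain x0 where x0: "x0 \<in> Gd y" "f y x0 \<in> F y" by blast
  define x where "x = f y x0"
  have xF: "x \<in> F y" using x0 by (simp add: x_def)
  have x0F: "x0 \<in> F y" and yF': "y \<in> F' x0" using x0 by (auto simp: Gd_def)
  have "(u, v) \<in> (restr (arcs G) Y)\<^sup>*" if uv: "u \<in> P x" "v \<in> P x" for u v
  proof -
    have "f y x \<in> N y" using Fy(3) xF by blast
    then obtain r where r: "r \<in> P (f y x)" "r \<in> Q y" by (auto simp: N_def)
    have "f' x0 y \<in> N' x0" using F'[of x0] yF' by auto
    then obtain s where s: "s \<in> P x0" "s \<in> Q (f' x0 y)" by (auto simp: N'_def)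
    have "(u, r) \<in> (restr (arcs G) Y)\<^sup>*" using F[of y] xF uv(1) r(1) by simp
    moreover have "(r, s) \<in> (restr (arcs G) Y)\<^sup>*" using F'[of x0] yF' r(2) s(2) by simp
    moreover have "(s, v) \<in> (restr (arcs G) Y)\<^sup>*" using F[of y] x0F s(1) uv(2) by (simp add: x_def)
    ultimately show ?thesis by (meson rtrancl_trans)
  qed
  moreover have "x \<in> T" using Fy(1) xF by (auto simp: N_def)
  moreover have "P x \<inter> Y = {}" using F[of y] xF by simp
  ultimately show ?thesis by blast
qed

text \<open>The descent keeps a whole member \<open>P x\<close> inside \<open>S\<close>. Discarding
  the members that are not contained in \<open>S\<close> costs 2 * B in each degree by
  \<open>inner_degree\<close>, and \<open>exists_strong_member\<close> needs more than 3 * B;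
  together this gives 5 * B.\<close>

lemma chained_dtw:
  assumes wf: "wf_digraph G" and chP: "chained G P U b B" and chQ: "chained G Q U' b B"
    and fin: "finite U" "finite U'" and ne: "U \<noteq> {}"
    and PV: "\<And>x. x \<in> U \<Longrightarrow> P x \<noteq> {} \<and> P x \<subseteq> verts G" and QV: "\<And>y. y \<in> U' \<Longrightarrow> Q y \<subseteq> verts G"
    and deg: "\<And>x. x \<in> U \<Longrightarrow> 5 * B < card {y\<in>U'. P x \<inter> Q y \<noteq> {}}"
    and deg': "\<And>y. y \<in> U' \<Longrightarrow> 5 * B < card {x\<in>U. P x \<inter> Q y \<noteq> {}}"
  shows "b \<le> dtw G"
proof (rule dtw_ge_descent[OF wf, of "\<lambda>S. \<exists>x\<in>U. P x \<subseteq> S"])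
  show "verts G \<noteq> {}" using ne PV by blast
  show "\<exists>x\<in>U. P x \<subseteq> verts G" using ne PV by blast
next
  fix S X Y
  assume S: "z_normal G X S" "\<exists>x\<in>U. P x \<subseteq> S" and XY: "X \<subseteq> Y" "Y \<subseteq> verts G" "card Y \<le> b"
  have finY: "finite Y" using XY(2) wf by (auto simp: wf_digraph_def intro: finite_subset)
  have finX: "finite X" using XY(1) finY by (rule finite_subset)
  have cX: "card X \<le> b" using card_mono[OF finY XY(1)] XY(3) by simp
  define T where "T = {x\<in>U. P x \<subseteq> S}"
  define T' where "T' = {y\<in>U'. Q y \<subseteq> S}"
  have "\<exists>x\<in>T. P x \<inter> Y = {} \<and> (\<forall>u\<in>P x. \<forall>v\<in>P x. (u, v) \<in> (restr (arcs G) Y)\<^sup>*)"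
  proof (rule exists_strong_member[OF chP chQ fin finY XY(3)])
    show "T \<subseteq> U" "T' \<subseteq> U'" by (auto simp: T_def T'_def)
    show "T \<noteq> {}" using S(2) by (auto simp: T_def)
    show "3 * B < card {y\<in>T'. P x \<inter> Q y \<noteq> {}}" if "x \<in> T" for x
      using inner_degree[OF wf S(1) finX cX chQ fin(2), of "P x"] deg[of x] that QV unfolding T_def T'_def by simp
    show "3 * B < card {x\<in>T. P x \<inter> Q y \<noteq> {}}" if "y \<in> T'" for y
      using inner_degree[OF wf S(1) finX cX chP fin(1), of "Q y"] deg'[of y] that PV
      unfolding T_def T'_def by (simp add: Int_commute)
  qed
  then obtain x where x: "x \<in> T" "P x \<inter> Y = {}"
    and conn: "\<And>u v. u \<in> P x \<Longrightarrow> v \<in> P x \<Longrightarrow> (u, v) \<in> (restr (arcs G) Y)\<^sup>*" by blast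
  have xU: "x \<in> U" "P x \<subseteq> S" using x(1) by (auto simp: T_def)
  obtain v where v: "v \<in> P x" using PV[OF xU(1)] by blast
  have "\<exists>x\<in>U. P x \<subseteq> S'" if S': "z_normal G X' S'" "X' \<subseteq> Y" "v \<in> S'" for S' X'
  proof -
    have "w \<in> S'" if w: "w \<in> P x" for w
      using z_normal_closed[OF wf S'(1,3,3)] restr_rtrancl_mono[OF conn[OF v w] subset_refl S'(2)]
        restr_rtrancl_mono[OF conn[OF w v] subset_refl S'(2)] by blast
    then show ?thesis using xU(1) by blast
  qed
  moreover have "v \<in> S - Y" using v x(2) xU(2) by blast
  ultimately show "\<exists>v\<in>S - Y. \<forall>S' X'. z_normal G X' S' \<longrightarrow> X' \<subseteq> Y \<longrightarrow> v \<in> S' \<longrightarrow> (\<exists>x\<in>U. P x \<subseteq> S')"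
    by (intro bexI[of _ v]) auto
qed

section \<open>First returns of a permutation\<close>

lemma funpow_return:
  assumes "finite J" "bij_betw \<pi> J J" "x \<in> J"
  shows "\<exists>k\<ge>1. (\<pi> ^^ k) x = x"
proof -
  have inJ: "(\<pi> ^^ n) x \<in> J" for n
    using bij_betw_funpow[OF assms(2), of n] assms(3) by (auto simp: bij_betw_def)
  have "\<not> inj (\<lambda>n. (\<pi> ^^ n) x)"
  proof
    assume inj: "inj (\<lambda>n. (\<pi> ^^ n) x)"
    have "range (\<lambda>n. (\<pi> ^^ n) x) \<subseteq> J" using inJ by auto
    then have "finite (range (\<lambda>n. (\<pi> ^^ n) x))" using assms(1) by (rule finite_subset)
    from finite_imageD[OF this inj] show False by simp
  qed
  then obtain m n where mn: "(\<pi> ^^ m) x = (\<pi> ^^ n) x" "m < n"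
    unfolding inj_def by (metis linorder_neqE_nat)
  have "(\<pi> ^^ m) x = (\<pi> ^^ m) ((\<pi> ^^ (n - m)) x)"
    using mn by (metis add_diff_inverse_nat comp_apply funpow_add less_imp_not_less)
  moreover have "inj_on (\<pi> ^^ m) J" using bij_betw_funpow[OF assms(2)] by (auto simp: bij_betw_def)
  ultimately have "x = (\<pi> ^^ (n - m)) x" using inJ assms(3) by (auto simp: inj_on_def)
  then show ?thesis using mn(2) by (intro exI[of _ "n - m"]) auto
qed

text \<open>Follow the permutation from each member of \<open>N\<close> to the next member of \<open>N\<close>; the walks are
  disjoint, so every broken step spoils at most one of them.\<close>
lemma successor_along_permutation:
  assumes fin: "finite J" and bij: "bij_betw \<pi> J J" and sub: "N \<subseteq> I" "I \<subseteq> J" "Br \<subseteq> I"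
    and step: "\<And>x. x \<in> I - Br \<Longrightarrow> \<pi> x \<in> I"
  shows "\<exists>F f. F \<subseteq> N \<and> inj_on f F \<and> f ` F \<subseteq> N \<and> card N \<le> card F + card Br \<and>
    (\<forall>x\<in>F. (x, f x) \<in> {(x, \<pi> x) |x. x \<in> I - Br}\<^sup>+)"
proof -
  have NJ: "x \<in> J" if "x \<in> N" for x using that sub by blast
  have inJ: "(\<pi> ^^ n) x \<in> J" if "x \<in> N" for n x
    using bij_betw_funpow[OF bij, of n] NJ[OF that] by (auto simp: bij_betw_def)
  define j where "j x = (LEAST j. 1 \<le> j \<and> (\<pi> ^^ j) x \<in> N)" for x
  have j: "1 \<le> j x" "(\<pi> ^^ j x) x \<in> N" if x: "x \<in> N" for x
  proof -
    obtain k where "1 \<le> k" "(\<pi> ^^ k) x = x" using funpow_return[OF fin bij NJ[OF x]] by blast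
    then have "1 \<le> k \<and> (\<pi> ^^ k) x \<in> N" using x by simp
    then have "1 \<le> j x \<and> (\<pi> ^^ j x) x \<in> N" unfolding j_def
      by (rule LeastI[of "\<lambda>j. 1 \<le> j \<and> (\<pi> ^^ j) x \<in> N"])
    then show "1 \<le> j x" "(\<pi> ^^ j x) x \<in> N" by auto
  qed
  have j_min: "j x \<le> k" if "1 \<le> k" "(\<pi> ^^ k) x \<in> N" for x k
    unfolding j_def using that by (intro Least_le) simp
  \<comment> \<open>Two walks up to their first returns cannot meet: cancelling the common power of
    \<open>\<pi>\<close> would bring one of them back to \<open>N\<close> before its first
    return.\<close>
  have one_sided: "x = x'" if x: "x \<in> N" "x' \<in> N" "l \<le> l'" "l' - l < j x'" "(\<pi> ^^ l) x = (\<pi> ^^ l') x'" for x x' l l'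
  proof -
    have "(\<pi> ^^ l) x = (\<pi> ^^ l) ((\<pi> ^^ (l' - l)) x')"
      using x(3,5) by (metis comp_apply funpow_add le_add_diff_inverse)
    moreover have "inj_on (\<pi> ^^ l) J" using bij_betw_funpow[OF bij] by (auto simp: bij_betw_def)
    ultimately have eq: "x = (\<pi> ^^ (l' - l)) x'" using inJ[OF x(2)] NJ[OF x(1)] by (simp add: inj_on_def)
    have "\<not> 1 \<le> l' - l" using j_min[of "l' - l" x'] eq x(1,4) by auto
    then show ?thesis using eq by auto
  qed
  have two_sided: "x = x'"
    if "x \<in> N" "x' \<in> N" "l' - l < j x'" "l - l' < j x" "(\<pi> ^^ l) x = (\<pi> ^^ l') x'" for x x' l l'
  proof (cases "l \<le> l'")
    case True
    then show ?thesis using one_sided[of x x' l l'] that by simp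
  next
    case False
    then show ?thesis using one_sided[of x' x l' l] that by simp
  qed
  define F where "F = {x\<in>N. \<forall>l<j x. (\<pi> ^^ l) x \<in> I - Br}"
  define f where "f x = (\<pi> ^^ j x) x" for x
  have "inj_on f F"
  proof (rule inj_onI)
    fix x x' assume x: "x \<in> F" "x' \<in> F" "f x = f x'"
    then have N: "x \<in> N" "x' \<in> N" by (auto simp: F_def)
    show "x = x'" using two_sided[OF N, of "j x'" "j x"] x(3) j(1)[OF N(1)] j(1)[OF N(2)] by (simp add: f_def)
  qed
  moreover have "f ` F \<subseteq> N" using j by (auto simp: f_def F_def)
  moreover have "card N \<le> card F + card Br"
  proof -
    have finN: "finite N" using fin sub by (meson finite_subset)
    have finBr: "finite Br" using fin sub by (meson finite_subset)
    \<comment> \<open>Until its first broken step the walk stays in \<open>I\<close>, so this step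
      starts at an element of \<open>Br\<close>.\<close>
    have ex: "\<exists>l<j x. (\<pi> ^^ l) x \<in> Br" if x: "x \<in> N - F" for x
    proof -
      have "\<exists>l. l < j x \<and> (\<pi> ^^ l) x \<notin> I - Br" using x unfolding F_def by blast
      then obtain l where l: "l < j x" "(\<pi> ^^ l) x \<notin> I - Br"
        and l_min: "\<And>i. i < l \<Longrightarrow> \<not> (i < j x \<and> (\<pi> ^^ i) x \<notin> I - Br)"
        using exists_least_iff[of "\<lambda>l. l < j x \<and> (\<pi> ^^ l) x \<notin> I - Br"] by blast
      have "(\<pi> ^^ l) x \<in> I"
      proof (cases l)
        case 0
        then show ?thesis using x sub(1) by auto
      next
        case (Suc i)
        then show ?thesis using l_min[of i] l(1) step[of "(\<pi> ^^ i) x"] by auto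
      qed
      then show ?thesis using l by blast
    qed
    then obtain l where l: "\<And>x. x \<in> N - F \<Longrightarrow> l x < j x \<and> (\<pi> ^^ l x) x \<in> Br" by metis
    have "card (N - F) \<le> card Br"
    proof (rule card_inj_on_le)
      show "inj_on (\<lambda>x. (\<pi> ^^ l x) x) (N - F)"
      proof (rule inj_onI)
        fix x x' assume x: "x \<in> N - F" "x' \<in> N - F" "(\<pi> ^^ l x) x = (\<pi> ^^ l x') x'"
        show "x = x'" by (rule two_sided[of x x' "l x'" "l x"]) (use x l[OF x(1)] l[OF x(2)] in auto)
      qed
      show "(\<lambda>x. (\<pi> ^^ l x) x) ` (N - F) \<subseteq> Br" using l by blast
    qed (rule finBr)
    moreover have "F \<subseteq> N" by (auto simp: F_def)
    then have "card N = card F + card (N - F)" using finN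
      by (metis card_Un_disjoint Diff_disjoint Diff_partition finite_Diff finite_subset)
    ultimately show ?thesis by simp
  qed
  moreover have "(x, f x) \<in> {(x, \<pi> x) |x. x \<in> I - Br}\<^sup>+" if x: "x \<in> F" for x
  proof -
    have "(x, (\<pi> ^^ Suc l) x) \<in> {(x, \<pi> x) |x. x \<in> I - Br}\<^sup>+" if "l < j x" for l
      using that
    proof (induction l)
      case 0
      have "(\<pi> ^^ 0) x \<in> I - Br" using x 0 unfolding F_def by blast
      then show ?case by (intro r_into_trancl) auto
    next
      case (Suc l)
      have "(\<pi> ^^ Suc l) x \<in> I - Br" using x Suc.prems unfolding F_def by blast
      then have "((\<pi> ^^ Suc l) x, (\<pi> ^^ Suc (Suc l)) x) \<in> {(x, \<pi> x) |x. x \<in> I - Br}" by auto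
      with Suc show ?case by (meson Suc_lessD trancl_into_trancl)
    qed
    from this[of "j x - 1"] show ?thesis using j(1)[of x] x by (auto simp: F_def f_def)
  qed
  moreover have "F \<subseteq> N" by (auto simp: F_def)
  ultimately show ?thesis by (intro exI[of _ F] exI[of _ f]) simp
qed

text \<open>A step from \<open>x\<close> to \<open>\<pi> x\<close> follows \<open>p x\<close>,
  \<open>q x\<close> and \<open>p (\<pi> x)\<close>. It breaks if \<open>\<pi> x\<close> lies
  outside \<open>I\<close>, at most twice, or if one of these three paths meets \<open>Z\<close>, at
  most \<open>b\<close> times for each: 3 * b + 2 in total.\<close>

lemma chained_of_permutation:
  assumes fin: "finite J" and bij: "bij_betw \<pi> J J" and IJ: "I \<subseteq> J"
    and p: "\<And>x. x \<in> I \<Longrightarrow> is_path (arcs G) (p x)"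
    and p_disj: "\<And>x y. x \<in> I \<Longrightarrow> y \<in> I \<Longrightarrow> x \<noteq> y \<Longrightarrow> set (p x) \<inter> set (p y) = {}"
    and q: "\<And>x. x \<in> I \<Longrightarrow> is_path (arcs G) (q x) \<and> hd (q x) = last (p x) \<and> last (q x) = hd (p (\<pi> x))"
    and q_disj: "\<And>x y. x \<in> I \<Longrightarrow> y \<in> I \<Longrightarrow> x \<noteq> y \<Longrightarrow> set (q x) \<inter> set (q y) = {}"
    and exits: "card {x\<in>I. \<pi> x \<notin> I} \<le> 2"
  shows "chained G (\<lambda>x. set (p x)) I b (3 * b + 2)"
  unfolding chained_def
proof (intro allI impI)
  fix N and Z :: "nat set"
  assume N: "N \<subseteq> I" and Z: "finite Z" "card Z \<le> b"
  have finI: "finite I" using IJ fin by (rule finite_subset)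
  define Hp where "Hp = {x\<in>I. set (p x) \<inter> Z \<noteq> {}}"
  define Hq where "Hq = {x\<in>I. set (q x) \<inter> Z \<noteq> {}}"
  define Hn where "Hn = {x\<in>I. \<pi> x \<in> Hp}"
  define Br where "Br = {x\<in>I. \<pi> x \<notin> I} \<union> Hp \<union> Hq \<union> Hn"
  have cHp: "card Hp \<le> card Z" unfolding Hp_def by (rule card_hit_disjoint[OF Z(1) p_disj])
  moreover have "card Hq \<le> card Z" unfolding Hq_def by (rule card_hit_disjoint[OF Z(1) q_disj])
  moreover have "card Hn \<le> card Hp"
  proof (rule card_inj_on_le)
    show "inj_on \<pi> Hn" using bij IJ by (auto simp: bij_betw_def Hn_def intro: inj_on_subset)
    show "finite Hp" using finI by (simp add: Hp_def)
  qed (auto simp: Hn_def)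
  moreover have "card Br \<le> card {x\<in>I. \<pi> x \<notin> I} + card Hp + card Hq + card Hn"
    unfolding Br_def
    using card_Un_le[of "{x\<in>I. \<pi> x \<notin> I} \<union> Hp \<union> Hq" Hn] card_Un_le[of "{x\<in>I. \<pi> x \<notin> I} \<union> Hp" Hq]
      card_Un_le[of "{x\<in>I. \<pi> x \<notin> I}" Hp] by linarith
  ultimately have cBr: "card Br \<le> 3 * b + 2" using exits Z(2) by linarith
  have BrI: "Br \<subseteq> I" by (auto simp: Br_def Hp_def Hq_def Hn_def)
  have step: "\<pi> x \<in> I" if "x \<in> I - Br" for x using that by (auto simp: Br_def)
  obtain F f where F: "F \<subseteq> N" "inj_on f F" "f ` F \<subseteq> N" "card N \<le> card F + card Br"
    and walk: "\<And>x. x \<in> F \<Longrightarrow> (x, f x) \<in> {(x, \<pi> x) |x. x \<in> I - Br}\<^sup>+"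
    using successor_along_permutation[OF fin bij N IJ BrI step] by blast
  define ok where "ok x y \<longleftrightarrow> set (p x) \<inter> Z = {} \<and> set (p y) \<inter> Z = {} \<and>
      (\<forall>u\<in>set (p x). \<forall>v\<in>set (p y). (u, v) \<in> (restr (arcs G) Z)\<^sup>*)" for x y
  have one: "ok x (\<pi> x)" if x: "x \<in> I - Br" for x
    unfolding ok_def
  proof (intro conjI ballI)
    have I: "x \<in> I" "\<pi> x \<in> I" using x step by auto
    show cx: "set (p x) \<inter> Z = {}" using x by (auto simp: Br_def Hp_def)
    have "\<pi> x \<notin> Hp" using x by (auto simp: Br_def Hn_def)
    then show cy: "set (p (\<pi> x)) \<inter> Z = {}" using I(2) by (auto simp: Hp_def)
    have cq: "set (q x) \<inter> Z = {}" using x by (auto simp: Br_def Hq_def)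
    fix u v assume u: "u \<in> set (p x)" and v: "v \<in> set (p (\<pi> x))"
    have 1: "(u, last (p x)) \<in> (restr (arcs G) Z)\<^sup>*" by (rule is_path_reach_last[OF p[OF I(1)] u cx])
    have qp: "is_path (arcs G) (q x)" "q x \<noteq> []" using q[OF I(1)] by (auto simp: is_path_def)
    have "(hd (q x), last (q x)) \<in> (restr (arcs G) Z)\<^sup>*"
      by (rule is_path_hd_reach[OF qp(1) last_in_set[OF qp(2)] cq])
    then have 2: "(last (p x), hd (p (\<pi> x))) \<in> (restr (arcs G) Z)\<^sup>*" using q[OF I(1)] by simp
    have 3: "(hd (p (\<pi> x)), v) \<in> (restr (arcs G) Z)\<^sup>*" by (rule is_path_hd_reach[OF p[OF I(2)] v cy])
    show "(u, v) \<in> (restr (arcs G) Z)\<^sup>*" using rtrancl_trans[OF rtrancl_trans[OF 1 2] 3] .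
  qed
  have ok_walk: "ok x y \<and> y \<in> I" if "(x, y) \<in> {(x, \<pi> x) |x. x \<in> I - Br}\<^sup>+" for x y
    using that
  proof (induction rule: trancl_induct)
    case (base y)
    then show ?case using one step by auto
  next
    case (step y z)
    have y: "y \<in> I - Br" "z = \<pi> y" using step.hyps(2) by auto
    have yz: "ok y z" using one[OF y(1)] y(2) by simp
    have "p y \<noteq> []" using p[of y] y(1) by (auto simp: is_path_def)
    then obtain w where w: "w \<in> set (p y)" by (meson hd_in_set)
    have "(u, v) \<in> (restr (arcs G) Z)\<^sup>*" if "u \<in> set (p x)" "v \<in> set (p z)" for u v
    proof -
      have "(u, w) \<in> (restr (arcs G) Z)\<^sup>*" using step.IH that w unfolding ok_def by simp
      moreover have "(w, v) \<in> (restr (arcs G) Z)\<^sup>*" using yz that w unfolding ok_def by simp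
      ultimately show ?thesis by (rule rtrancl_trans)
    qed
    then have "ok x z" using step.IH yz unfolding ok_def by simp
    moreover have "z \<in> I" using y \<open>\<And>x. x \<in> I - Br \<Longrightarrow> \<pi> x \<in> I\<close> by simp
    ultimately show ?case by simp
  qed
  show "\<exists>F f. F \<subseteq> N \<and> inj_on f F \<and> f ` F \<subseteq> N \<and> card N \<le> card F + (3 * b + 2) \<and>
       (\<forall>i\<in>F. set (p i) \<inter> Z = {} \<and> set (p (f i)) \<inter> Z = {} \<and>
         (\<forall>u\<in>set (p i). \<forall>v\<in>set (p (f i)). (u, v) \<in> (restr (arcs G) Z)\<^sup>*))"
  proof (intro exI[of _ F] exI[of _ f] conjI)
    show "card N \<le> card F + (3 * b + 2)" using F(4) cBr by linarith
    show "\<forall>i\<in>F. set (p i) \<inter> Z = {} \<and> set (p (f i)) \<inter> Z = {} \<and>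
         (\<forall>u\<in>set (p i). \<forall>v\<in>set (p (f i)). (u, v) \<in> (restr (arcs G) Z)\<^sup>*)"
    proof
      fix i assume i: "i \<in> F"
      have "ok i (f i)" using ok_walk[OF walk[OF i]] by (rule conjunct1)
      then show "set (p i) \<inter> Z = {} \<and> set (p (f i)) \<inter> Z = {} \<and>
          (\<forall>u\<in>set (p i). \<forall>v\<in>set (p (f i)). (u, v) \<in> (restr (arcs G) Z)\<^sup>*)"
        unfolding ok_def .
    qed
  qed (use F in auto)
qed

section \<open>Dense pairs of intervals\<close>

text \<open>Enumerating cycle by cycle, every initial segment is left by at most one step of the
  permutation.\<close>
lemma permutation_order:
  assumes fin: "finite J" and bij: "bij_betw \<pi> J J"
  shows "\<exists>pos. bij_betw pos J {..<card J} \<and>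
    (\<forall>m. card {x\<in>J. pos x < m \<and> \<not> pos (\<pi> x) < (m::nat)} \<le> 1)"
proof -
  have \<pi>J: "\<pi> x \<in> J" if "x \<in> J" for x using bij that by (auto simp: bij_betw_def)
  define leave where "leave A pos m = {x\<in>A. pos x < m \<and> \<not> (\<pi> x \<in> A \<and> pos (\<pi> x) < m)}"
    for A and pos :: "'a \<Rightarrow> nat" and m
  have ex: "\<exists>A pos. A \<subseteq> J \<and> card A = n \<and> bij_betw pos A {..<n} \<and> (\<forall>m. card (leave A pos m) \<le> 1)"
    if "n \<le> card J" for n
    using that
  proof (induction n)
    case 0
    show ?case by (intro exI[of _ "{}"] exI[of _ "\<lambda>_. 0"]) (simp add: leave_def bij_betw_def)
  next
    case (Suc n)
    then obtain A pos where A: "A \<subseteq> J" "card A = n" "bij_betw pos A {..<n}"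
      and le1: "\<And>m. card (leave A pos m) \<le> 1" by auto
    have finA: "finite A" using A(1) fin by (rule finite_subset)
    have "A \<noteq> J" using A(2) Suc.prems by auto
    then obtain z0 where z0: "z0 \<in> J - A" using A(1) by blast
    have pos_lt: "pos x < n" if "x \<in> A" for x using A(3) that by (auto simp: bij_betw_def)
    define E where "E = {x\<in>A. \<pi> x \<notin> A}"
    have "leave A pos n = E" using pos_lt by (auto simp: leave_def E_def)
    then have E1: "card E \<le> 1" using le1[of n] by simp
    \<comment> \<open>The next element is the image of the unique element whose image lies outside
      \<open>A\<close>. If there is none, \<open>A\<close> is a union of cycles and any element may
      start a new one.\<close>
    define z where "z = (if E = {} then z0 else \<pi> (SOME x. x \<in> E))"
    have z: "z \<in> J - A"
    proof (cases "E = {}")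
      case False
      then have "(SOME x. x \<in> E) \<in> E" by (simp add: some_in_eq)
      then show ?thesis using False A(1) \<pi>J by (auto simp: z_def E_def)
    qed (use z0 in \<open>simp add: z_def\<close>)
    have to_z: "\<pi> x = z" if x: "x \<in> E" for x
    proof -
      have "E \<noteq> {}" using x by auto
      then have s: "(SOME x. x \<in> E) \<in> E" by (simp add: some_in_eq)
      have "finite E" using finA by (simp add: E_def)
      then have "x = (SOME x. x \<in> E)" using E1 x s by (simp add: card_le_Suc0_iff_eq)
      then show ?thesis using \<open>E \<noteq> {}\<close> by (simp add: z_def)
    qed
    define A' where "A' = insert z A"
    define pos' where "pos' = pos(z := n)"
    have pos'A: "pos' x = pos x" if "x \<in> A" for x using that z by (auto simp: pos'_def)
    have pos'z: "pos' z = n" by (simp add: pos'_def)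
    have "card A' = Suc n" using z finA A(2) by (simp add: A'_def)
    moreover have "A' \<subseteq> J" using z A(1) by (auto simp: A'_def)
    moreover have "bij_betw pos' A' {..<Suc n}"
    proof -
      have "bij_betw pos' A {..<n}" using A(3) pos'A by (simp add: bij_betw_cong[of A pos' pos])
      then have "bij_betw pos' (A \<union> {z}) ({..<n} \<union> {n})"
        by (rule bij_betw_combine) (auto simp: bij_betw_def pos'z)
      moreover have "A \<union> {z} = A'" "{..<n} \<union> {n} = {..<Suc n}" by (auto simp: A'_def)
      ultimately show ?thesis by simp
    qed
    moreover have "card (leave A' pos' m) \<le> 1" for m
    proof (cases "m \<le> n")
      case True
      have "leave A' pos' m = leave A pos m"
      proof (rule set_eqI)
        fix x
        show "x \<in> leave A' pos' m \<longleftrightarrow> x \<in> leave A pos m"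
        proof (cases "x \<in> A")
          case xA: True
          have "(\<pi> x \<in> A' \<and> pos' (\<pi> x) < m) \<longleftrightarrow> (\<pi> x \<in> A \<and> pos (\<pi> x) < m)"
            using True pos'z pos'A[of "\<pi> x"] by (cases "\<pi> x \<in> A") (auto simp: A'_def)
          then show ?thesis using xA pos'A[OF xA] by (auto simp: leave_def A'_def)
        next
          case False
          then show ?thesis using True pos'z by (auto simp: leave_def A'_def)
        qed
      qed
      then show ?thesis using le1 by simp
    next
      case False
      have "leave A' pos' m \<subseteq> {z}"
      proof
        fix x assume x: "x \<in> leave A' pos' m"
        have lt: "pos' y < m" if "y \<in> A'" for y
          using that False pos_lt[of y] pos'A[of y] pos'z by (auto simp: A'_def)
        have "\<pi> x \<notin> A'" "x \<in> A'" using x lt[of "\<pi> x"] by (auto simp: leave_def)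
        then show "x \<in> {z}" using to_z[of x] by (auto simp: A'_def E_def)
      qed
      then have "card (leave A' pos' m) \<le> card {z}" by (intro card_mono) auto
      then show ?thesis by simp
    qed
    ultimately show ?case by (intro exI[of _ A'] exI[of _ pos']) simp
  qed
  obtain A pos where A: "A \<subseteq> J" "card A = card J" "bij_betw pos A {..<card J}"
    and le1: "\<And>m. card (leave A pos m) \<le> 1" using ex[OF order_refl] by auto
  have "A = J" by (rule card_subset_eq[OF fin A(1,2)])
  moreover have "{x\<in>J. pos x < m \<and> \<not> pos (\<pi> x) < m} = leave J pos m" for m
    using \<pi>J by (auto simp: leave_def)
  ultimately show ?thesis using A(3) le1 by (intro exI[of _ pos]) simp
qed

text \<open>\<open>A\<close> and its preimage have equally many elements; removing those that belong
  to both leaves the two sets compared.\<close>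

lemma card_enter_eq_card_leave:
  assumes fin: "finite J" and bij: "bij_betw \<pi> J J" and A: "A \<subseteq> J"
  shows "card {x\<in>J. x \<notin> A \<and> \<pi> x \<in> A} = card {x\<in>A. \<pi> x \<notin> A}"
proof -
  have finA: "finite A" using A fin by (rule finite_subset)
  have "bij_betw \<pi> {x\<in>J. \<pi> x \<in> A} A"
  proof (rule bij_betw_imageI)
    show "inj_on \<pi> {x\<in>J. \<pi> x \<in> A}" using bij by (auto simp: bij_betw_def intro: inj_on_subset)
    have "\<pi> ` J = J" using bij by (simp add: bij_betw_def)
    then have "A \<subseteq> \<pi> ` J" using A by simp
    then show "\<pi> ` {x\<in>J. \<pi> x \<in> A} = A" by auto
  qed
  then have "card {x\<in>J. \<pi> x \<in> A} = card A" by (rule bij_betw_same_card)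
  moreover have "card {x\<in>J. \<pi> x \<in> A} = card {x\<in>A. \<pi> x \<in> A} + card {x\<in>J. x \<notin> A \<and> \<pi> x \<in> A}"
  proof -
    have "{x\<in>J. \<pi> x \<in> A} = {x\<in>A. \<pi> x \<in> A} \<union> {x\<in>J. x \<notin> A \<and> \<pi> x \<in> A}" using A by auto
    then show ?thesis using fin finA by (simp only:) (rule card_Un_disjoint; auto)
  qed
  moreover have "card A = card {x\<in>A. \<pi> x \<in> A} + card {x\<in>A. \<pi> x \<notin> A}"
  proof -
    have "card ({x\<in>A. \<pi> x \<in> A} \<union> {x\<in>A. \<pi> x \<notin> A}) = card {x\<in>A. \<pi> x \<in> A} + card {x\<in>A. \<pi> x \<notin> A}"
      using finA by (intro card_Un_disjoint) auto
    moreover have "{x\<in>A. \<pi> x \<in> A} \<union> {x\<in>A. \<pi> x \<notin> A} = A" by auto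
    ultimately show ?thesis by simp
  qed
  ultimately show ?thesis by linarith
qed

text \<open>The colour classes are intervals in the order of \<open>permutation_order\<close>.\<close>
lemma interval_colouring:
  fixes w :: "'a \<Rightarrow> nat"
  assumes fin: "finite J" and bij: "bij_betw \<pi> J J" and u: "u > 0" and w: "\<And>x. x \<in> J \<Longrightarrow> w x \<le> u"
  shows "\<exists>c. (\<forall>x\<in>J. c x \<le> sum w J div u) \<and> (\<forall>k. sum w {x\<in>J. c x = k} \<le> 2 * u) \<and>
    (\<forall>k. card {x\<in>J. c x = k \<and> c (\<pi> x) \<noteq> k} \<le> 2)"
proof -
  obtain pos where pos: "bij_betw pos J {..<card J}"
    and leave: "\<And>m. card {x\<in>J. pos x < m \<and> \<not> pos (\<pi> x) < (m::nat)} \<le> 1"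
    using permutation_order[OF fin bij] by blast
  have inj: "inj_on pos J" using pos by (simp add: bij_betw_def)
  have \<pi>J: "\<pi> x \<in> J" if "x \<in> J" for x using bij that by (auto simp: bij_betw_def)
  define s where "s x = sum w {y\<in>J. pos y < pos x}" for x
  \<comment> \<open>Colours measure the weight of all earlier elements in units of \<open>u\<close>.
    A class has weight less than \<open>u\<close> before its last element, whose own weight is at
    most \<open>u\<close>; hence 2 * u.\<close>
  define c where "c x = s x div u" for x
  have s_mono: "s x \<le> s y" if "pos x \<le> pos y" for x y
    unfolding s_def using fin that by (intro sum_mono2) auto
  have "c x \<le> sum w J div u" for x
    unfolding c_def s_def using fin by (intro div_le_mono sum_mono2) auto
  moreover have "sum w {x\<in>J. c x = k} \<le> 2 * u" for k
  proof (cases "{x\<in>J. c x = k} = {}")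
    case False
    let ?K = "{x\<in>J. c x = k}"
    have finK: "finite ?K" using fin by simp
    obtain x where x: "x \<in> ?K" "\<And>y. y \<in> ?K \<Longrightarrow> pos x \<le> pos y"
      using ex_has_least_nat[of "\<lambda>x. x \<in> ?K" _ pos] False by auto
    obtain z where z: "z \<in> ?K" "\<And>y. y \<in> ?K \<Longrightarrow> pos y \<le> pos z"
    proof -
      have "Max (pos ` ?K) \<in> pos ` ?K" using finK False by (intro Max_in) auto
      then obtain z where z: "Max (pos ` ?K) = pos z" "z \<in> ?K" by (rule imageE)
      show thesis
      proof (rule that[OF z(2)])
        fix y assume "y \<in> ?K"
        then have "pos y \<in> pos ` ?K" by (rule imageI)
        then show "pos y \<le> pos z" unfolding z(1)[symmetric] using finK by (intro Max_ge) auto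
      qed
    qed
    have "sum w ?K \<le> sum w (insert z {y\<in>?K. pos y < pos z})"
    proof (rule sum_mono2)
      show "?K \<subseteq> insert z {y\<in>?K. pos y < pos z}"
      proof
        fix y assume y: "y \<in> ?K"
        then have "pos y = pos z \<Longrightarrow> y = z" using inj z(1) by (auto simp: inj_on_def)
        then show "y \<in> insert z {y\<in>?K. pos y < pos z}" using y z(2)[OF y] by force
      qed
    qed (use fin in auto)
    also have "\<dots> = w z + sum w {y\<in>?K. pos y < pos z}" using fin by (subst sum.insert) auto
    finally have 1: "sum w ?K \<le> w z + sum w {y\<in>?K. pos y < pos z}" .
    have "s x + sum w {y\<in>?K. pos y < pos z} = sum w ({y\<in>J. pos y < pos x} \<union> {y\<in>?K. pos y < pos z})"
      unfolding s_def using fin x(2) by (intro sum.union_disjoint[symmetric]) force+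
    also have "\<dots> \<le> s z" unfolding s_def using fin x(2)[OF z(1)] by (intro sum_mono2) auto
    finally have 2: "s x + sum w {y\<in>?K. pos y < pos z} \<le> s z" .
    have "s x div u = k" "s z div u = k" using x(1) z(1) by (auto simp: c_def)
    then have "k * u \<le> s x" "s z < k * u + u" using u dividend_less_div_times[of u "s z"] by (auto simp: mult.commute)
    then have "sum w {y\<in>?K. pos y < pos z} \<le> u" using 2 by linarith
    moreover have "w z \<le> u" using z(1) w by blast
    ultimately show ?thesis using 1 by linarith
  next
    case True
    then show ?thesis by (simp only: sum.empty)
  qed
  moreover have "card {x\<in>J. c x = k \<and> c (\<pi> x) \<noteq> k} \<le> 2" for k
  proof -
    have down: "\<exists>m. \<forall>x\<in>J. c x < k \<longleftrightarrow> pos x < m" for k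
    proof (cases "\<exists>x. x \<in> J \<and> \<not> c x < k")
      case True
      then obtain x where x: "x \<in> J" "\<not> c x < k" "\<And>y. y \<in> J \<and> \<not> c y < k \<Longrightarrow> pos x \<le> pos y"
        using ex_has_least_nat[of "\<lambda>x. x \<in> J \<and> \<not> c x < k" _ pos] by blast
      have "c y < k \<longleftrightarrow> pos y < pos x" if y: "y \<in> J" for y
      proof
        assume "c y < k"
        show "pos y < pos x"
        proof (rule ccontr)
          assume "\<not> pos y < pos x"
          then have "c x \<le> c y" unfolding c_def using s_mono[of x y] by (intro div_le_mono) simp
          then show False using \<open>c y < k\<close> x(2) by simp
        qed
      next
        assume "pos y < pos x"
        then show "c y < k" using x(3)[of y] y by auto
      qed
      then show ?thesis by blast
    next
      case False
      have "pos x < card J" if "x \<in> J" for x using pos that by (auto simp: bij_betw_def)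
      then show ?thesis using False by blast
    qed
    have leave_c: "card {x\<in>J. c x < k \<and> \<not> c (\<pi> x) < k} \<le> 1" for k
    proof -
      obtain m where m: "\<forall>x\<in>J. c x < k \<longleftrightarrow> pos x < m" using down by blast
      then have "{x\<in>J. c x < k \<and> \<not> c (\<pi> x) < k} = {x\<in>J. pos x < m \<and> \<not> pos (\<pi> x) < m}" using \<pi>J by blast
      then show ?thesis using leave[of m] by simp
    qed
    \<comment> \<open>A step out of class \<open>k\<close> goes up, leaving an initial segment, or
      down, entering one. A permutation enters a set as often as it leaves it, so each kind occurs
      at most once.\<close>
    let ?L = "{x\<in>J. c x < Suc k \<and> \<not> c (\<pi> x) < Suc k}" and ?E = "{x\<in>J. \<not> c x < k \<and> c (\<pi> x) < k}"
    have "?E = {x\<in>J. x \<notin> {x\<in>J. c x < k} \<and> \<pi> x \<in> {x\<in>J. c x < k}}" using \<pi>J by blast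
    then have "card ?E = card {x\<in>{x\<in>J. c x < k}. \<pi> x \<notin> {x\<in>J. c x < k}}"
      using card_enter_eq_card_leave[OF fin bij, of "{x\<in>J. c x < k}"] by auto
    also have "{x\<in>{x\<in>J. c x < k}. \<pi> x \<notin> {x\<in>J. c x < k}} = {x\<in>J. c x < k \<and> \<not> c (\<pi> x) < k}" using \<pi>J by blast
    finally have "card ?E \<le> 1" using leave_c[of k] by simp
    moreover have "card ?L \<le> 1" by (rule leave_c)
    moreover have "card {x\<in>J. c x = k \<and> c (\<pi> x) \<noteq> k} \<le> card (?L \<union> ?E)"
      using fin by (intro card_mono) auto
    ultimately show ?thesis using card_Un_le[of ?L ?E] by linarith
  qed
  ultimately show ?thesis by (intro exI[of _ c]) simp
qed

section \<open>Dense subgraphs and dense pairs of colour classes\<close>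

lemma min_degree_subgraph:
  fixes R :: "'a \<Rightarrow> 'b \<Rightarrow> bool"
  assumes "finite I" "finite I'" "d * (card I + card I') < card {(x, y) \<in> I \<times> I'. R x y}"
  shows "\<exists>U U'. U \<subseteq> I \<and> U' \<subseteq> I' \<and> U \<noteq> {} \<and> (\<forall>x\<in>U. d < card {y\<in>U'. R x y}) \<and>
    (\<forall>y\<in>U'. d < card {x\<in>U. R x y})"
  using assms
proof (induction "card I + card I'" arbitrary: I I' rule: less_induct)
  case less
  let ?e = "\<lambda>I I'. {(x, y) \<in> I \<times> I'. R x y}"
  have fin_e: "finite (?e A A')" if "A \<subseteq> I" "A' \<subseteq> I'" for A A'
    by (rule finite_subset[of _ "I \<times> I'"]) (use that less.prems(1,2) in auto)
  consider x where "x \<in> I" "card {y\<in>I'. R x y} \<le> d" | y where "y \<in> I'" "card {x\<in>I. R x y} \<le> d"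
    | "\<forall>x\<in>I. d < card {y\<in>I'. R x y}" "\<forall>y\<in>I'. d < card {x\<in>I. R x y}"
    by (meson not_less)
  then show ?case
  proof cases
    case (1 x)
    have c: "card I = Suc (card (I - {x}))" using 1 less.prems(1) by (metis card_Suc_Diff1)
    have "?e I I' \<subseteq> ?e (I - {x}) I' \<union> Pair x ` {y\<in>I'. R x y}" by auto
    then have "card (?e I I') \<le> card (?e (I - {x}) I' \<union> Pair x ` {y\<in>I'. R x y})"
      using fin_e[of "I - {x}" I'] less.prems(2) by (intro card_mono) auto
    also have "\<dots> \<le> card (?e (I - {x}) I') + card (Pair x ` {y\<in>I'. R x y})" by (rule card_Un_le)
    also have "card (Pair x ` {y\<in>I'. R x y}) \<le> d" using 1(2) by (simp add: card_image inj_on_def)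
    \<comment> \<open>A vertex of degree at most \<open>d\<close> takes at most \<open>d\<close>
      edges with it, so the surplus of edges over \<open>d\<close> times the number of vertices
      persists.\<close>
    finally have "d * (card (I - {x}) + card I') < card (?e (I - {x}) I')"
      using less.prems(3) c by (simp add: algebra_simps)
    then have "\<exists>U U'. U \<subseteq> I - {x} \<and> U' \<subseteq> I' \<and> U \<noteq> {} \<and> (\<forall>x\<in>U. d < card {y\<in>U'. R x y}) \<and>
        (\<forall>y\<in>U'. d < card {x\<in>U. R x y})"
      using less.prems(1,2) c by (intro less.hyps) auto
    then show ?thesis by (meson Diff_subset subset_trans)
  next
    case (2 y)
    have c: "card I' = Suc (card (I' - {y}))" using 2 less.prems(2) by (metis card_Suc_Diff1)
    have "?e I I' \<subseteq> ?e I (I' - {y}) \<union> (\<lambda>x. (x, y)) ` {x\<in>I. R x y}" by auto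
    then have "card (?e I I') \<le> card (?e I (I' - {y}) \<union> (\<lambda>x. (x, y)) ` {x\<in>I. R x y})"
      using fin_e[of I "I' - {y}"] less.prems(1) by (intro card_mono) auto
    also have "\<dots> \<le> card (?e I (I' - {y})) + card ((\<lambda>x. (x, y)) ` {x\<in>I. R x y})" by (rule card_Un_le)
    also have "card ((\<lambda>x. (x, y)) ` {x\<in>I. R x y}) \<le> d" using 2(2) by (simp add: card_image inj_on_def)
    finally have "d * (card I + card (I' - {y})) < card (?e I (I' - {y}))"
      using less.prems(3) c by (simp add: algebra_simps)
    then have "\<exists>U U'. U \<subseteq> I \<and> U' \<subseteq> I' - {y} \<and> U \<noteq> {} \<and> (\<forall>x\<in>U. d < card {y\<in>U'. R x y}) \<and>
        (\<forall>y\<in>U'. d < card {x\<in>U. R x y})"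
      using less.prems(1,2) c by (intro less.hyps) auto
    then show ?thesis by (meson Diff_subset subset_trans)
  next
    case 3
    have "?e I I' \<noteq> {}" using less.prems(3) by (metis card.empty not_less0)
    then have "I \<noteq> {}" by auto
    then show ?thesis using 3 by (intro exI[of _ I] exI[of _ I']) simp
  qed
qed

text \<open>A maximal matching of dense colour pairs covers few edges, and the pairs that are not
  dense contain few edges.\<close>
lemma dense_matching:
  fixes R :: "'a \<Rightarrow> 'b \<Rightarrow> bool" and c :: "'a \<Rightarrow> nat" and c' :: "'b \<Rightarrow> nat"
  defines "E \<equiv> \<lambda>A A'. {(x, y) \<in> A \<times> A'. R x y}"
  assumes fin: "finite J" "finite J'" and n: "card J = n" "card J' = n"
    and c: "\<And>x. x \<in> J \<Longrightarrow> c x \<le> K" and c': "\<And>y. y \<in> J' \<Longrightarrow> c' y \<le> K"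
    and w: "\<And>k. card (E {x\<in>J. c x = k} J') \<le> 2 * u" and w': "\<And>k. card (E J {y\<in>J'. c' y = k}) \<le> 2 * u"
    and big: "4 * a * u + 2 * d * n * (K + 1) < card (E J J')"
  shows "\<exists>\<kappa> \<kappa>'. inj_on \<kappa> {..<a} \<and> inj_on \<kappa>' {..<a} \<and>
    (\<forall>g<a. d * (card {x\<in>J. c x = \<kappa> g} + card {y\<in>J'. c' y = \<kappa>' g}) <
       card (E {x\<in>J. c x = \<kappa> g} {y\<in>J'. c' y = \<kappa>' g}))"
proof -
  let ?I = "\<lambda>k. {x\<in>J. c x = k}" and ?I' = "\<lambda>l. {y\<in>J'. c' y = l}"
  define good where "good k l \<longleftrightarrow> d * (card (?I k) + card (?I' l)) < card (E (?I k) (?I' l))" for k l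
  define matching where "matching M \<longleftrightarrow> M \<subseteq> {..K} \<times> {..K} \<and> (\<forall>(k, l)\<in>M. good k l) \<and> inj_on fst M \<and> inj_on snd M" for M
  have fin_sub: "finite (E A A')" if "A \<subseteq> J" "A' \<subseteq> J'" for A A'
    unfolding E_def by (rule finite_subset[of _ "J \<times> J'"]) (use that fin in auto)
  have "matching {}" by (simp add: matching_def)
  moreover have "card M < Suc (card ({..K} \<times> {..K}))" if "matching M" for M
    using that card_mono[of "{..K} \<times> {..K}" M] by (auto simp: matching_def)
  ultimately obtain M where M: "matching M" and max: "\<And>M'. matching M' \<Longrightarrow> card M' \<le> card M"
    using ex_has_greatest_nat[of matching "{}" card "Suc (card ({..K} \<times> {..K}))"] by blast
  have finM: "finite M" using M finite_subset[of M "{..K} \<times> {..K}"] by (simp add: matching_def)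
  have "a \<le> card M"
  proof (rule ccontr)
    assume "\<not> a \<le> card M"
    then have small: "card M \<le> a" by simp
    have bad: "\<not> good k l" if kl: "k \<le> K" "l \<le> K" "k \<notin> fst ` M" "l \<notin> snd ` M" for k l
    proof
      assume "good k l"
      have "inj_on fst (insert (k, l) M)" "inj_on snd (insert (k, l) M)"
        using M kl(3,4) by (auto simp: matching_def inj_on_insert image_iff)
      then have "matching (insert (k, l) M)" using M \<open>good k l\<close> kl(1,2) by (auto simp: matching_def)
      from max[OF this] have "(k, l) \<in> M" using finM by (metis card_insert_disjoint not_less_eq_eq order_refl)
      then show False using kl(3) by force
    qed
    let ?EA = "\<Union>k\<in>fst ` M. E (?I k) J'" and ?EB = "\<Union>l\<in>snd ` M. E J (?I' l)"
    let ?rest = "({..K} - fst ` M) \<times> ({..K} - snd ` M)"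
    let ?EC = "\<Union>t\<in>?rest. E (?I (fst t)) (?I' (snd t))"
    have "E J J' \<subseteq> ?EA \<union> ?EB \<union> ?EC"
    proof
      fix t assume t: "t \<in> E J J'"
      obtain x y where xy: "t = (x, y)" by (cases t)
      have m: "x \<in> J" "y \<in> J'" "R x y" using t xy by (auto simp: E_def)
      consider "c x \<in> fst ` M" | "c' y \<in> snd ` M" | "(c x, c' y) \<in> ?rest" using c[OF m(1)] c'[OF m(2)] by blast
      then show "t \<in> ?EA \<union> ?EB \<union> ?EC"
      proof cases
        case 1
        have "t \<in> E (?I (c x)) J'" using m xy by (simp add: E_def)
        then show ?thesis using 1 by blast
      next
        case 2
        have "t \<in> E J (?I' (c' y))" using m xy by (simp add: E_def)
        then show ?thesis using 2 by blast
      next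
        case 3
        have "t \<in> E (?I (fst (c x, c' y))) (?I' (snd (c x, c' y)))" using m xy by (simp add: E_def)
        then show ?thesis using 3 by blast
      qed
    qed
    moreover have "finite (?EA \<union> ?EB \<union> ?EC)"
      using finM fin_sub by (intro finite_UnI finite_UN_I) auto
    ultimately have "card (E J J') \<le> card (?EA \<union> ?EB \<union> ?EC)" by (rule card_mono[rotated])
    \<comment> \<open>The fewer than \<open>a\<close> matched colours cover at most 2 * a * u edges
      on either side. The other pairs have at most d * (|I k| + |I' l|) edges each; over all (K +
      1)^2 pairs of colours this sums to 2 * d * n * (K + 1).\<close>
    also have "\<dots> \<le> card ?EA + card ?EB + card ?EC"
      using card_Un_le[of "?EA \<union> ?EB" ?EC] card_Un_le[of ?EA ?EB] by linarith
    also have "card ?EA \<le> 2 * a * u"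
    proof -
      have "card ?EA \<le> (\<Sum>k\<in>fst ` M. card (E (?I k) J'))" using finM by (intro card_UN_le) simp
      also have "\<dots> \<le> (\<Sum>k\<in>fst ` M. 2 * u)" using w by (rule sum_mono)
      also have "\<dots> = card (fst ` M) * (2 * u)" by simp
      also have "\<dots> \<le> a * (2 * u)" using small card_image_le[OF finM, of fst] by (intro mult_le_mono1) simp
      finally show ?thesis by (simp add: mult_ac)
    qed
    also have "card ?EB \<le> 2 * a * u"
    proof -
      have "card ?EB \<le> (\<Sum>k\<in>snd ` M. card (E J (?I' k)))" using finM by (intro card_UN_le) simp
      also have "\<dots> \<le> (\<Sum>k\<in>snd ` M. 2 * u)" using w' by (rule sum_mono)
      also have "\<dots> = card (snd ` M) * (2 * u)" by simp
      also have "\<dots> \<le> a * (2 * u)" using small card_image_le[OF finM, of snd] by (intro mult_le_mono1) simp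
      finally show ?thesis by (simp add: mult_ac)
    qed
    also have "card ?EC \<le> 2 * d * n * (K + 1)"
    proof -
      have "card ?EC \<le> (\<Sum>t\<in>?rest. card (E (?I (fst t)) (?I' (snd t))))" by (intro card_UN_le) simp
      also have "\<dots> \<le> (\<Sum>t\<in>?rest. d * (card (?I (fst t)) + card (?I' (snd t))))"
        using bad by (intro sum_mono) (auto simp: good_def not_less)
      also have "\<dots> \<le> (\<Sum>t\<in>{..K} \<times> {..K}. d * (card (?I (fst t)) + card (?I' (snd t))))"
        by (intro sum_mono2) auto
      also have "\<dots> = (\<Sum>k\<le>K. \<Sum>l\<le>K. d * (card (?I k) + card (?I' l)))" by (simp add: sum.cartesian_product case_prod_unfold)
      also have "\<dots> = d * ((K + 1) * (\<Sum>k\<le>K. card (?I k)) + (K + 1) * (\<Sum>l\<le>K. card (?I' l)))"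
        by (simp add: sum.distrib sum_distrib_left[symmetric] distrib_left)
      also have "(\<Sum>k\<le>K. card (?I k)) = n"
      proof -
        have "(\<Sum>k\<le>K. card (?I k)) = card (\<Union>k\<le>K. ?I k)" using fin by (intro card_UN_disjoint[symmetric]) auto
        moreover have "(\<Union>k\<le>K. ?I k) = J" using c by auto
        ultimately show ?thesis using n by simp
      qed
      also have "(\<Sum>l\<le>K. card (?I' l)) = n"
      proof -
        have "(\<Sum>k\<le>K. card (?I' k)) = card (\<Union>k\<le>K. ?I' k)" using fin by (intro card_UN_disjoint[symmetric]) auto
        moreover have "(\<Union>k\<le>K. ?I' k) = J'" using c' by auto
        ultimately show ?thesis using n by simp
      qed
      finally show ?thesis by (simp add: algebra_simps)
    qed
    finally show False using big by simp
  qed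
  then obtain M0 where M0: "M0 \<subseteq> M" "card M0 = a" by (meson obtain_subset_with_card_n)
  have "finite M0" using M0(1) finM by (rule finite_subset)
  then obtain h where h: "bij_betw h {..<a} M0" using ex_bij_betw_nat_finite[of M0] M0(2) by (auto simp: atLeast0LessThan)
  have hM: "h g \<in> M" if "g < a" for g using h M0(1) that by (auto simp: bij_betw_def)
  have inj_fst: "inj_on fst (h ` {..<a})" and inj_snd: "inj_on snd (h ` {..<a})"
    using M M0(1) h by (auto simp: matching_def bij_betw_def intro: inj_on_subset)
  have inj_h: "inj_on h {..<a}" using h by (simp add: bij_betw_def)
  show ?thesis
  proof (rule exI[of _ "fst \<circ> h"], rule exI[of _ "snd \<circ> h"], intro conjI allI impI)
    show "inj_on (fst \<circ> h) {..<a}" "inj_on (snd \<circ> h) {..<a}"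
      using comp_inj_on[OF inj_h inj_fst] comp_inj_on[OF inj_h inj_snd] by auto
    fix g assume "g < a"
    then have "good (fst (h g)) (snd (h g))" using hM[of g] M by (auto simp: matching_def)
    then show "d * (card (?I ((fst \<circ> h) g)) + card (?I' ((snd \<circ> h) g))) < card (E (?I ((fst \<circ> h) g)) (?I' ((snd \<circ> h) g)))"
      by (simp add: good_def)
  qed
qed

text \<open>Elements are weighted by their degrees, which are at most n \<le> u. With u about m / (8
  * a), matched colours cover at most 4 * a * u \<le> m / 2 of the m edges. There are at most 17 * a
  colours, so pairs that are not dense contain at most 34 * a * d * n edges. This is less than m /
  2, which is where 68 comes from.\<close>

lemma dense_interval_pairs:
  fixes R :: "'a \<Rightarrow> 'b \<Rightarrow> bool"
  assumes fin: "finite J" "finite J'" and n: "card J = n" "card J' = n"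
    and bij: "bij_betw \<pi> J J" "bij_betw \<pi>' J' J'"
    and a: "a \<ge> 1" and d: "d \<ge> 1"
    and big: "68 * a * d * n < card {(x, y) \<in> J \<times> J'. R x y}"
  shows "\<exists>I I'. (\<forall>g<a. I g \<subseteq> J \<and> I' g \<subseteq> J' \<and> card {x\<in>I g. \<pi> x \<notin> I g} \<le> 2 \<and>
      card {y\<in>I' g. \<pi>' y \<notin> I' g} \<le> 2 \<and>
      d * (card (I g) + card (I' g)) < card {(x, y) \<in> I g \<times> I' g. R x y}) \<and>
    (\<forall>g<a. \<forall>h<a. g \<noteq> h \<longrightarrow> I g \<inter> I h = {} \<and> I' g \<inter> I' h = {})"
proof -
  define m where "m = card {(x, y) \<in> J \<times> J'. R x y}"
  define u where "u = m div (8 * a)"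
  have "68 * (a * n) \<le> 68 * a * d * n" using mult_le_mono2[OF d, of "68 * (a * n)"] by (simp add: mult_ac)
  then have m: "68 * a * d * n < m" "68 * (a * n) < m" using big unfolding m_def by linarith+
  have n0: "n > 0"
  proof (rule ccontr)
    assume "\<not> n > 0"
    then have "J = {}" using n fin by auto
    then show False using big by simp
  qed
  have "8 * a * n \<le> m" using m(2) by simp
  then have nu: "n \<le> u" unfolding u_def using a by (simp add: less_eq_div_iff_mult_less_eq mult_ac)
  then have u0: "u > 0" using n0 by simp
  have mu: "8 * a * u \<le> m" "m < 8 * a * u + 8 * a"
  proof -
    have "8 * a * u + m mod (8 * a) = m" unfolding u_def by (rule mult_div_mod_eq)
    moreover have "m mod (8 * a) < 8 * a" using a by (intro mod_less_divisor) simp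
    ultimately show "8 * a * u \<le> m" "m < 8 * a * u + 8 * a" by linarith+
  qed
  have degs: "card {y\<in>J'. R x y} \<le> u" for x
    using card_mono[of J' "{y\<in>J'. R x y}"] fin n nu by auto
  have degs': "card {x\<in>J. R x y} \<le> u" for y
    using card_mono[of J "{x\<in>J. R x y}"] fin n nu by auto
  have edges: "card {(x, y) \<in> A \<times> J'. R x y} = (\<Sum>x\<in>A. card {y\<in>J'. R x y})" if "A \<subseteq> J" for A
  proof -
    have "{(x, y) \<in> A \<times> J'. R x y} = Sigma A (\<lambda>x. {y\<in>J'. R x y})" by auto
    then show ?thesis using fin that by (simp add: finite_subset card_SigmaI)
  qed
  have edges': "card {(x, y) \<in> J \<times> A. R x y} = (\<Sum>y\<in>A. card {x\<in>J. R x y})" if "A \<subseteq> J'" for A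
  proof -
    have "{(x, y) \<in> J \<times> A. R x y} = prod.swap ` Sigma A (\<lambda>y. {x\<in>J. R x y})" by (auto simp: image_iff)
    moreover have "card (prod.swap ` Sigma A (\<lambda>y. {x\<in>J. R x y})) = card (Sigma A (\<lambda>y. {x\<in>J. R x y}))"
      by (rule card_image) simp
    ultimately show ?thesis using fin that by (simp add: finite_subset card_SigmaI)
  qed
  obtain c where c: "\<And>x. x \<in> J \<Longrightarrow> c x \<le> m div u"
      "\<And>k. (\<Sum>x\<in>{x\<in>J. c x = k}. card {y\<in>J'. R x y}) \<le> 2 * u"
      "\<And>k. card {x\<in>J. c x = k \<and> c (\<pi> x) \<noteq> k} \<le> 2"
    using interval_colouring[OF fin(1) bij(1) u0, of "\<lambda>x. card {y\<in>J'. R x y}"] degs edges[of J]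
    unfolding m_def by auto
  obtain c' where c': "\<And>y. y \<in> J' \<Longrightarrow> c' y \<le> m div u"
      "\<And>k. (\<Sum>y\<in>{y\<in>J'. c' y = k}. card {x\<in>J. R x y}) \<le> 2 * u"
      "\<And>k. card {y\<in>J'. c' y = k \<and> c' (\<pi>' y) \<noteq> k} \<le> 2"
    using interval_colouring[OF fin(2) bij(2) u0, of "\<lambda>y. card {x\<in>J. R x y}"] degs' edges'[of J']
    unfolding m_def by auto
  have K: "m div u + 1 \<le> 17 * a"
  proof -
    have "8 * a \<le> 8 * a * u" using u0 by simp
    then have "m < 16 * a * u + u" using mu(2) u0 by linarith
    then have "m < (16 * a + 1) * u" by (simp add: distrib_right)
    then have "m div u < 16 * a + 1" using div_less_iff_less_mult[OF u0] by blast
    then show ?thesis using a by simp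
  qed
  have "2 * d * n * (m div u + 1) \<le> 2 * d * n * (17 * a)" using K by (rule mult_le_mono2)
  then have big': "4 * a * u + 2 * d * n * (m div u + 1) < m"
  proof -
    have "2 * d * n * (17 * a) = 34 * (a * d * n)" by (simp add: mult_ac)
    then have "2 * d * n * (m div u + 1) \<le> 34 * (a * d * n)"
      using \<open>2 * d * n * (m div u + 1) \<le> 2 * d * n * (17 * a)\<close> by linarith
    moreover have "68 * (a * d * n) < m" using m(1) by (simp add: mult.assoc)
    moreover have "8 * (a * u) \<le> m" using mu(1) by (simp add: mult.assoc)
    ultimately have "4 * (a * u) + 2 * d * n * (m div u + 1) < m" by linarith
    then show ?thesis by (simp only: mult.assoc)
  qed
  have "\<exists>\<kappa> \<kappa>'. inj_on \<kappa> {..<a} \<and> inj_on \<kappa>' {..<a} \<and>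
    (\<forall>g<a. d * (card {x\<in>J. c x = \<kappa> g} + card {y\<in>J'. c' y = \<kappa>' g}) <
       card {(x, y) \<in> {x\<in>J. c x = \<kappa> g} \<times> {y\<in>J'. c' y = \<kappa>' g}. R x y})"
  proof (rule dense_matching[OF fin n c(1) c'(1)])
    fix k
    have "{x\<in>J. c x = k} \<subseteq> J" "{y\<in>J'. c' y = k} \<subseteq> J'" by auto
    then show "card {(x, y) \<in> {x\<in>J. c x = k} \<times> J'. R x y} \<le> 2 * u"
      "card {(x, y) \<in> J \<times> {y\<in>J'. c' y = k}. R x y} \<le> 2 * u"
      using c(2)[of k] c'(2)[of k] by (simp_all only: edges edges')
  qed (use big' in \<open>simp_all only: m_def\<close>)
  then obtain \<kappa> \<kappa>' where \<kappa>: "inj_on \<kappa> {..<a}" "inj_on \<kappa>' {..<a}"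
    and dense: "\<And>g. g < a \<Longrightarrow> d * (card {x\<in>J. c x = \<kappa> g} + card {y\<in>J'. c' y = \<kappa>' g}) <
       card {(x, y) \<in> {x\<in>J. c x = \<kappa> g} \<times> {y\<in>J'. c' y = \<kappa>' g}. R x y}" by blast
  have \<pi>J: "\<pi> x \<in> J" if "x \<in> J" for x using bij(1) that by (auto simp: bij_betw_def)
  have \<pi>J': "\<pi>' x \<in> J'" if "x \<in> J'" for x using bij(2) that by (auto simp: bij_betw_def)
  show ?thesis
  proof (rule exI[of _ "\<lambda>g. {x\<in>J. c x = \<kappa> g}"], rule exI[of _ "\<lambda>g. {y\<in>J'. c' y = \<kappa>' g}"],
      intro conjI allI impI)
    fix g assume g: "g < a"
    have "{x\<in>{x\<in>J. c x = \<kappa> g}. \<pi> x \<notin> {x\<in>J. c x = \<kappa> g}} = {x\<in>J. c x = \<kappa> g \<and> c (\<pi> x) \<noteq> \<kappa> g}" using \<pi>J by blast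
    then show "card {x\<in>{x\<in>J. c x = \<kappa> g}. \<pi> x \<notin> {x\<in>J. c x = \<kappa> g}} \<le> 2" using c(3) by simp
    have "{x\<in>{x\<in>J'. c' x = \<kappa>' g}. \<pi>' x \<notin> {x\<in>J'. c' x = \<kappa>' g}} = {x\<in>J'. c' x = \<kappa>' g \<and> c' (\<pi>' x) \<noteq> \<kappa>' g}" using \<pi>J' by blast
    then show "card {x\<in>{x\<in>J'. c' x = \<kappa>' g}. \<pi>' x \<notin> {x\<in>J'. c' x = \<kappa>' g}} \<le> 2" using c'(3) by simp
    show "d * (card {x\<in>J. c x = \<kappa> g} + card {y\<in>J'. c' y = \<kappa>' g}) <
       card {(x, y) \<in> {x\<in>J. c x = \<kappa> g} \<times> {y\<in>J'. c' y = \<kappa>' g}. R x y}" by (rule dense[OF g])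
  next
    fix g h assume gh: "g < a" "h < a" "g \<noteq> h"
    then have "\<kappa> g \<noteq> \<kappa> h" "\<kappa>' g \<noteq> \<kappa>' h" using \<kappa> by (auto simp: inj_on_def)
    then show "{x\<in>J. c x = \<kappa> g} \<inter> {x\<in>J. c x = \<kappa> h} = {}" "{y\<in>J'. c' y = \<kappa>' g} \<inter> {y\<in>J'. c' y = \<kappa>' h} = {}" by auto
  qed auto
qed

section \<open>Densely intersecting linkages\<close>

lemma packing_dense:
  fixes G :: digraph
  defines "B \<equiv> \<lambda>b::nat. 3 * b + 2"
  assumes wf: "wf_digraph G" and a: "a \<ge> 1"
    and X: "X \<subseteq> verts G" "finite Y" "card X = n" "card Y = n"
    and X': "X' \<subseteq> verts G" "finite Y'" "card X' = n" "card Y' = n"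
    and p: "linkage (arcs G) X Y p" and q: "linkage (arcs G) Y X q"
    and p': "linkage (arcs G) X' Y' p'" and q': "linkage (arcs G) Y' X' q'"
    and big: "68 * a * (5 * B b) * n < card {(x, y) \<in> X \<times> X'. set (p x) \<inter> set (p' y) \<noteq> {}}"
  shows "packing G a b"
proof -
  have finV: "finite (verts G)" and arcsV: "arcs G \<subseteq> verts G \<times> verts G" using wf by (auto simp: wf_digraph_def)
  \<comment> \<open>Going forth along one linkage and back along the other permutes the first
    vertices of the former.\<close>
  have bij: "bij_betw (\<lambda>x. last (q (last (p x)))) X X"
    if "X \<subseteq> verts G" "finite Y" "card X = n" "card Y = n" "linkage (arcs G) X Y p" "linkage (arcs G) Y X q" for X Y p q
  proof -
    have "finite X" using that(1) finV by (rule finite_subset)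
    then have "bij_betw (\<lambda>y. last (q y)) Y X" using that by (intro linkage_last_bij) auto
    moreover have "bij_betw (\<lambda>x. last (p x)) X Y" using that by (intro linkage_last_bij) auto
    ultimately show ?thesis using bij_betw_trans[of "\<lambda>x. last (p x)" X Y "\<lambda>y. last (q y)" X] by (simp add: comp_def)
  qed
  have fin: "finite X" "finite X'" using X(1) X'(1) finV by (auto intro: finite_subset)
  have dd: "1 \<le> 5 * B b" by (simp add: B_def)
  obtain I I' where I: "\<And>g. g < a \<Longrightarrow> I g \<subseteq> X \<and> I' g \<subseteq> X' \<and>
      card {x\<in>I g. last (q (last (p x))) \<notin> I g} \<le> 2 \<and> card {y\<in>I' g. last (q' (last (p' y))) \<notin> I' g} \<le> 2 \<and>
      5 * B b * (card (I g) + card (I' g)) < card {(x, y) \<in> I g \<times> I' g. set (p x) \<inter> set (p' y) \<noteq> {}}"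
    and I_disj: "\<And>g h. g < a \<Longrightarrow> h < a \<Longrightarrow> g \<noteq> h \<Longrightarrow> I g \<inter> I h = {} \<and> I' g \<inter> I' h = {}"
    using dense_interval_pairs[OF fin X(3) X'(3) bij[OF X p q] bij[OF X' p' q'] a dd big]
    by (elim exE conjE) (rule that, drule spec, erule mp, assumption,
        drule spec, drule mp, assumption, drule spec, drule mp, assumption, erule mp, assumption)
  have facts: "is_path (arcs G) (p x) \<and> set (p x) \<subseteq> verts G \<and> is_path (arcs G) (q (last (p x))) \<and>
      set (q (last (p x))) \<subseteq> verts G \<and> hd (q (last (p x))) = last (p x) \<and> hd (p x) = x \<and> last (q (last (p x))) \<in> X"
    if "X \<subseteq> verts G" "linkage (arcs G) X Y p" "linkage (arcs G) Y X q" "x \<in> X" for X Y p q x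
  proof -
    have 1: "is_path (arcs G) (p x)" "hd (p x) = x" "last (p x) \<in> Y" using that(2,4) by (auto simp: linkage_def)
    have 2: "is_path (arcs G) (q (last (p x)))" "hd (q (last (p x))) = last (p x)" "last (q (last (p x))) \<in> X"
      using that(3) 1(3) by (auto simp: linkage_def)
    have 3: "set (p x) \<subseteq> verts G" using is_path_subset[OF 1(1) _ arcsV] 1(2) that(1,4) by auto
    have "last (p x) \<in> verts G" using 1(1) 3 last_in_set[of "p x"] by (auto simp: is_path_def)
    then have "set (q (last (p x))) \<subseteq> verts G" using is_path_subset[OF 2(1) _ arcsV] 2(2) by auto
    then show ?thesis using 1 2 3 by simp
  qed
  note F = facts[OF X(1) p q] and F' = facts[OF X'(1) p' q']
  have disj: "set (p x) \<inter> set (p y) = {} \<and> set (q (last (p x))) \<inter> set (q (last (p y))) = {}"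
    if "linkage (arcs G) X Y p" "linkage (arcs G) Y X q" "x \<in> X" "y \<in> X" "x \<noteq> y" for X Y p q x y
  proof -
    have "last (p x) \<noteq> last (p y)" using linkage_last_inj[OF that(1)] that(3-5) by (auto simp: inj_on_def)
    moreover have "last (p x) \<in> Y" "last (p y) \<in> Y" using that(1,3,4) by (auto simp: linkage_def)
    ultimately show ?thesis using that unfolding linkage_def by simp
  qed
  note D = disj[OF p q] and D' = disj[OF p' q']
  have chain: "chained (union_graph Qs) (\<lambda>x. set (p x)) J b (B b)"
    if X: "X \<subseteq> verts G" "finite Y" "card X = n" "card Y = n" and p: "linkage (arcs G) X Y p"
      and q: "linkage (arcs G) Y X q" and J: "J \<subseteq> X" "card {x\<in>J. last (q (last (p x))) \<notin> J} \<le> 2"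
      and Qs: "p ` J \<subseteq> Qs" "(\<lambda>x. q (last (p x))) ` J \<subseteq> Qs" for X Y p q J Qs
    unfolding B_def
  proof (rule chained_of_permutation[OF finite_subset[OF X(1) finV] bij[OF X p q] J(1), where q = "\<lambda>x. q (last (p x))"])
    fix x assume x: "x \<in> J"
    note F = facts[OF X(1) p q]
    have xX: "x \<in> X" using x J(1) by blast
    show "is_path (arcs (union_graph Qs)) (p x)"
      by (rule is_path_union_graph[of "arcs G"]) (use F[OF xX] x Qs in auto)
    have "is_path (arcs (union_graph Qs)) (q (last (p x)))"
      by (rule is_path_union_graph[of "arcs G"]) (use F[OF xX] x Qs in auto)
    moreover have "last (q (last (p x))) \<in> X" using F[OF xX] by simp
    ultimately show "is_path (arcs (union_graph Qs)) (q (last (p x))) \<and> hd (q (last (p x))) = last (p x) \<and>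
        last (q (last (p x))) = hd (p (last (q (last (p x)))))"
      using F[OF xX] F[of "last (q (last (p x)))"] by simp
  next
    fix x y assume "x \<in> J" "y \<in> J" "x \<noteq> y"
    then show "set (p x) \<inter> set (p y) = {}" "set (q (last (p x))) \<inter> set (q (last (p y))) = {}"
      using disj[OF p q, of x y] J(1) by auto
  qed (rule J(2))
  define Ps where "Ps g = p ` I g \<union> (\<lambda>x. q (last (p x))) ` I g \<union> p' ` I' g \<union> (\<lambda>x. q' (last (p' x))) ` I' g" for g
  let ?G = "\<lambda>g. union_graph (Ps g)"
  have IX: "x \<in> X" if "g < a" "x \<in> I g" for g x using I[OF that(1)] that(2) by blast
  have IX': "x \<in> X'" if "g < a" "x \<in> I' g" for g x using I[OF that(1)] that(2) by blast
  have finI: "finite (I g)" "finite (I' g)" if "g < a" for g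
    using I[OF that] fin by (auto intro: finite_subset)
  have sub: "subgraph (?G g) G" if g: "g < a" for g
  proof (rule subgraph_union_graph)
    show "finite (Ps g)" using finI[OF g] by (simp add: Ps_def)
    show "is_path (arcs G) r \<and> set r \<subseteq> verts G" if "r \<in> Ps g" for r
      using that F[OF IX[OF g]] F'[OF IX'[OF g]] unfolding Ps_def by blast
  qed
  have "b \<le> dtw (?G g)" if g: "g < a" for g
  proof -
    have wfg: "wf_digraph (?G g)" using sub[OF g] by (simp add: subgraph_def)
    have chP: "chained (?G g) (\<lambda>x. set (p x)) (I g) b (B b)"
      by (rule chain[OF X p q]) (use I[OF g] in \<open>auto simp: Ps_def\<close>)
    have chQ: "chained (?G g) (\<lambda>x. set (p' x)) (I' g) b (B b)"
      by (rule chain[OF X' p' q']) (use I[OF g] in \<open>auto simp: Ps_def\<close>)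
    have "5 * B b * (card (I g) + card (I' g)) < card {(x, y) \<in> I g \<times> I' g. set (p x) \<inter> set (p' y) \<noteq> {}}"
      using I[OF g] by simp
    \<comment> \<open>Large minimum degree holds only after some indices are discarded, but the
      graph keeps all paths of the interval pair. So \<open>chained\<close> survives: its walks may
      run through discarded indices.\<close>
    from min_degree_subgraph[OF finI[OF g] this]
    obtain U U' where U: "U \<subseteq> I g" "U' \<subseteq> I' g" "U \<noteq> {}"
      and deg: "\<forall>x\<in>U. 5 * B b < card {y\<in>U'. set (p x) \<inter> set (p' y) \<noteq> {}}"
        "\<forall>y\<in>U'. 5 * B b < card {x\<in>U. set (p x) \<inter> set (p' y) \<noteq> {}}" by blast
    show ?thesis
    proof (rule chained_dtw[OF wfg chained_subset[OF chP U(1)] chained_subset[OF chQ U(2)]])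
      show "finite U" "finite U'" using U(1,2) finI[OF g] by (auto intro: finite_subset)
      show "U \<noteq> {}" by (rule U(3))
    next
      fix x assume x: "x \<in> U"
      then have xI: "x \<in> I g" using U(1) by blast
      have "p x \<noteq> []" using F[OF IX[OF g xI]] by (auto simp: is_path_def)
      moreover have "p x \<in> Ps g" using xI by (simp add: Ps_def)
      ultimately show "set (p x) \<noteq> {} \<and> set (p x) \<subseteq> verts (?G g)" unfolding verts_union_graph by auto
      show "5 * B b < card {y\<in>U'. set (p x) \<inter> set (p' y) \<noteq> {}}" using deg(1) x by (rule bspec)
    next
      fix y assume y: "y \<in> U'"
      then have "p' y \<in> Ps g" using U(2) by (auto simp: Ps_def)
      then show "set (p' y) \<subseteq> verts (?G g)" unfolding verts_union_graph by auto
      show "5 * B b < card {x\<in>U. set (p x) \<inter> set (p' y) \<noteq> {}}" using deg(2) y by (rule bspec)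
    qed
  qed
  moreover have "card {g. g < a \<and> v \<in> verts (?G g)} \<le> 4" for v
  proof -
    have one: "card {g. g < a \<and> v \<in> (\<Union>x\<in>J g. set (f x))} \<le> 1"
      if J: "\<And>g h. g < a \<Longrightarrow> h < a \<Longrightarrow> g \<noteq> h \<Longrightarrow> J g \<inter> J h = {}"
        and f: "\<And>g h x y. g < a \<Longrightarrow> h < a \<Longrightarrow> x \<in> J g \<Longrightarrow> y \<in> J h \<Longrightarrow> x \<noteq> y \<Longrightarrow> set (f x) \<inter> set (f y) = {}"
      for J :: "nat \<Rightarrow> nat set" and f :: "nat \<Rightarrow> nat list"
    proof (rule card_le_one_disjoint)
      fix g h assume gh: "g < a" "h < a" "g \<noteq> h"
      have "set (f x) \<inter> set (f y) = {}" if "x \<in> J g" "y \<in> J h" for x y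
        using f[OF gh(1,2) that] J[OF gh] that by blast
      then show "(\<Union>x\<in>J g. set (f x)) \<inter> (\<Union>x\<in>J h. set (f x)) = {}" by blast
    qed
    let ?A = "\<lambda>J f. {g. g < a \<and> v \<in> (\<Union>x\<in>J g. set (f x))}"
    have "card (?A I p) \<le> 1" by (rule one) (use I_disj D IX in auto)
    moreover have "card (?A I (\<lambda>x. q (last (p x)))) \<le> 1" by (rule one) (use I_disj D IX in auto)
    moreover have "card (?A I' p') \<le> 1" by (rule one) (use I_disj D' IX' in auto)
    moreover have "card (?A I' (\<lambda>x. q' (last (p' x)))) \<le> 1" by (rule one) (use I_disj D' IX' in auto)
    moreover have eq: "{g. g < a \<and> v \<in> verts (?G g)} =
        ?A I p \<union> ?A I (\<lambda>x. q (last (p x))) \<union> ?A I' p' \<union> ?A I' (\<lambda>x. q' (last (p' x)))"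
      unfolding verts_union_graph Ps_def by auto
    moreover have "card (?A I p \<union> ?A I (\<lambda>x. q (last (p x))) \<union> ?A I' p' \<union> ?A I' (\<lambda>x. q' (last (p' x)))) \<le>
        card (?A I p) + card (?A I (\<lambda>x. q (last (p x)))) + card (?A I' p') + card (?A I' (\<lambda>x. q' (last (p' x))))"
      using card_Un_le[of "?A I p \<union> ?A I (\<lambda>x. q (last (p x))) \<union> ?A I' p'" "?A I' (\<lambda>x. q' (last (p' x)))"]
        card_Un_le[of "?A I p \<union> ?A I (\<lambda>x. q (last (p x)))" "?A I' p'"]
        card_Un_le[of "?A I p" "?A I (\<lambda>x. q (last (p x)))"] by linarith
    ultimately show ?thesis unfolding eq by linarith
  qed
  ultimately show ?thesis using sub unfolding packing_def by (intro exI[of _ ?G]) simp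
qed

section \<open>Choice of the parameters and the final bound\<close>

lemma packing_of_dtw:
  assumes wf: "wf_digraph G" and a: "a \<ge> 1" and b: "b \<ge> 1"
    and dtw: "9 * (4664800 * a ^ 3 * b ^ 4)\<^sup>2 \<le> dtw G"
  shows "packing G a b"
proof -
  \<comment> \<open>A group needs at least 6 * b + 1 pieces. \<open>D * S\<close> is the density
    demanded by \<open>packing_dense\<close>, and \<open>S\<close> is chosen such that 4 * (a * M *
    M) * (D * S) = S * S, which is what \<open>packing_sparse\<close> demands. \<open>K\<close>
    counts all tokens.\<close>
  define M where "M = 7 * b"
  define D where "D = 68 * a * (5 * (3 * b + 2))"
  define S where "S = 4 * (a * M * M) * D"
  define K where "K = a * M * (2 * S)"
  have M1: "6 * b + 1 \<le> M" using b by (simp add: M_def)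
  have pos: "a * M \<ge> 1" "S \<ge> 1" using a b by (auto simp: S_def M_def D_def Suc_le_eq)
  have "K \<ge> 1" using pos by (simp add: K_def)
  have "5 * (3 * b + 2) \<le> 25 * b" using b by simp
  then have "D \<le> 68 * a * (25 * b)" unfolding D_def by (rule mult_le_mono2)
  then have "S \<le> 4 * (a * M * M) * (68 * a * (25 * b))" unfolding S_def by (rule mult_le_mono2)
  then have "K \<le> a * M * (2 * (4 * (a * M * M) * (68 * a * (25 * b))))" unfolding K_def by (intro mult_le_mono2)
  \<comment> \<open>4664800 = 7 * 2 * 4 * 49 * 68 * 25. The factor 9 in the assumption comes from 6
    * K^2 + 3 \<le> 9 * K^2.\<close>
  also have "\<dots> = 4664800 * a ^ 3 * b ^ 4" by (simp add: M_def power3_eq_cube power4_eq_xxxx mult_ac)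
  finally have "K\<^sup>2 \<le> (4664800 * a ^ 3 * b ^ 4)\<^sup>2" by (rule power_mono) simp
  moreover have "1 \<le> K\<^sup>2" using \<open>K \<ge> 1\<close> by simp
  moreover have "3 * (2 * K * K) + 3 = 6 * K\<^sup>2 + 3" by (simp add: power2_eq_square)
  ultimately have "3 * (2 * K * K) + 3 \<le> dtw G" using dtw by linarith
  from path_system[OF wf pos K_def this]
  obtain p1 p2 In Out where
    P: "\<And>i. i < a * M \<Longrightarrow> is_path (arcs G) (p1 i @ p2 i) \<and> set (p1 i @ p2 i) \<subseteq> verts G \<and>
       In i \<subseteq> set (p1 i) \<and> Out i \<subseteq> set (p2 i) \<and> card (In i) = S \<and> card (Out i) = S"
    and P_disj: "\<And>i j. i < a * M \<Longrightarrow> j < a * M \<Longrightarrow> i \<noteq> j \<Longrightarrow> set (p1 i @ p2 i) \<inter> set (p1 j @ p2 j) = {}"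
    and link: "\<And>X Y. X \<subseteq> (\<Union>i<a * M. In i \<union> Out i) \<Longrightarrow> Y \<subseteq> (\<Union>i<a * M. In i \<union> Out i) \<Longrightarrow> card X = card Y \<Longrightarrow>
       \<exists>p. linkage (arcs G) X Y p"
    by (elim exE conjE) (rule that, drule spec, erule mp, assumption,
        drule spec, drule mp, assumption, drule spec, drule mp, assumption, erule mp, assumption,
        drule spec, drule spec, drule mp, assumption, drule mp, assumption, erule mp, assumption)
  define T where "T = {(i, j). i < a * M \<and> j < a * M \<and> i \<noteq> j \<and> i div M = j div M}"
  have IO: "In i \<subseteq> (\<Union>i<a * M. In i \<union> Out i)" "Out i \<subseteq> (\<Union>i<a * M. In i \<union> Out i)" if "i < a * M" for i
    using that by auto
  have "\<exists>p. linkage (arcs G) (Out (fst t)) (In (snd t)) p" if "t \<in> T" for t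
    by (rule link) (use that P IO in \<open>auto simp: T_def\<close>)
  then obtain L where L: "\<And>t. t \<in> T \<Longrightarrow> linkage (arcs G) (Out (fst t)) (In (snd t)) (L t)" by metis
  have return_link: "\<exists>p. linkage (arcs G) (In (snd t)) (Out (fst t)) p" if "t \<in> T" for t
    by (rule link) (use that P IO in \<open>auto simp: T_def\<close>)
  show ?thesis
  proof (cases "\<forall>s\<in>T. \<forall>t\<in>T. s \<noteq> t \<longrightarrow>
      card {(u, v) \<in> Out (fst s) \<times> Out (fst t). set (L s u) \<inter> set (L t v) \<noteq> {}} \<le> D * S")
    case True
    show ?thesis
    proof (rule packing_sparse[OF wf M1 pos(2) _ P_disj T_def, where L = L and e = "D * S" and In = In and Out = Out])
      show "is_path (arcs G) (p1 i @ p2 i) \<and> set (p1 i @ p2 i) \<subseteq> verts G \<and>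
         In i \<subseteq> set (p1 i) \<and> Out i \<subseteq> set (p2 i) \<and> card (Out i) = S" if "i < a * M" for i using P[OF that] by simp
      show "linkage (arcs G) (Out i) (In j) (L (i, j))" if "(i, j) \<in> T" for i j using L[OF that] by simp
      show "card {(u, v) \<in> Out (fst s) \<times> Out (fst t). set (L s u) \<inter> set (L t v) \<noteq> {}} \<le> D * S"
        if "s \<in> T" "t \<in> T" "s \<noteq> t" for s t using True that by blast
      show "4 * (a * M * M) * (D * S) \<le> S * S" by (simp add: S_def mult_ac)
    qed
  next
    case False
    then obtain s t where st: "s \<in> T" "t \<in> T"
      and big: "D * S < card {(u, v) \<in> Out (fst s) \<times> Out (fst t). set (L s u) \<inter> set (L t v) \<noteq> {}}"
      by (auto simp: not_le)
    obtain q where q: "linkage (arcs G) (In (snd s)) (Out (fst s)) q" using return_link[OF st(1)] by blast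
    obtain q' where q': "linkage (arcs G) (In (snd t)) (Out (fst t)) q'" using return_link[OF st(2)] by blast
    have ends: "Out (fst r) \<subseteq> verts G" "finite (In (snd r))" "card (Out (fst r)) = S" "card (In (snd r)) = S" if r: "r \<in> T" for r
    proof -
      have i: "fst r < a * M" "snd r < a * M" using r by (auto simp: T_def)
      show "Out (fst r) \<subseteq> verts G" using P[OF i(1)] by auto
      show "finite (In (snd r))" using P[OF i(2)] by (meson List.finite_set finite_subset)
      show "card (Out (fst r)) = S" "card (In (snd r)) = S" using P[OF i(1)] P[OF i(2)] by simp_all
    qed
    show ?thesis
      by (rule packing_dense[OF wf a ends[OF st(1)] ends[OF st(2)] L[OF st(1)] q L[OF st(2)] q'])
        (use big in \<open>simp only: D_def\<close>)
  qed
qed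

theorem theorem5:
  shows "\<exists>c::real. \<forall>a b :: nat. \<forall>G :: digraph.
     a \<ge> 1 \<longrightarrow> b \<ge> 1 \<longrightarrow> wf_digraph G \<longrightarrow>
     real (dtw G) \<ge> c * real a ^ 6 * real b ^ 8 * (max 1 (log 2 (real (a * b))))\<^sup>2 \<longrightarrow>
     (\<exists>Gs :: nat \<Rightarrow> digraph.
        (\<forall>i\<in>{1..a}. subgraph (Gs i) G) \<and>
        (\<forall>v\<in>verts G. card {i\<in>{1..a}. v \<in> verts (Gs i)} \<le> 4) \<and>
        (\<forall>i\<in>{1..a}. dtw (Gs i) \<ge> b))"
proof (intro exI[of _ "9 * 4664800\<^sup>2"] allI impI)
  fix a b :: nat and G :: digraph
  let ?c = "9 * 4664800\<^sup>2 :: real"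
  assume ab: "a \<ge> 1" "b \<ge> 1" and wf: "wf_digraph G"
    and dtw: "?c * real a ^ 6 * real b ^ 8 * (max 1 (log 2 (real (a * b))))\<^sup>2 \<le> real (dtw G)"
  let ?l = "(max 1 (log 2 (real (a * b))))\<^sup>2"
  \<comment> \<open>The logarithmic factor is at least 1, so the assumption implies the purely
    polynomial bound of \<open>packing_of_dtw\<close>.\<close>
  have "1 \<le> ?l" by (rule one_le_power) simp
  then have "?c * real a ^ 6 * real b ^ 8 * 1 \<le> ?c * real a ^ 6 * real b ^ 8 * ?l"
    by (rule mult_left_mono) simp
  moreover have "real (9 * (4664800 * a ^ 3 * b ^ 4)\<^sup>2) = ?c * real a ^ 6 * real b ^ 8"
    by (simp add: power_mult_distrib flip: power_mult)
  ultimately have "real (9 * (4664800 * a ^ 3 * b ^ 4)\<^sup>2) \<le> real (dtw G)" using dtw by linarith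
  then have "9 * (4664800 * a ^ 3 * b ^ 4)\<^sup>2 \<le> dtw G" by (simp only: of_nat_le_iff)
  from packing_of_dtw[OF wf ab this]
  obtain Gs where Gs: "\<And>g. g < a \<Longrightarrow> subgraph (Gs g) G \<and> b \<le> dtw (Gs g)"
    and cong: "\<And>v. card {g. g < a \<and> v \<in> verts (Gs g)} \<le> 4"
    unfolding packing_def by blast
  have "card {i\<in>{1..a}. v \<in> verts (Gs (i - 1))} \<le> 4" for v
  proof -
    have "{i\<in>{1..a}. v \<in> verts (Gs (i - 1))} = Suc ` {g. g < a \<and> v \<in> verts (Gs g)}"
    proof (rule set_eqI)
      fix i
      show "i \<in> {i\<in>{1..a}. v \<in> verts (Gs (i - 1))} \<longleftrightarrow> i \<in> Suc ` {g. g < a \<and> v \<in> verts (Gs g)}"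
        by (cases i) auto
    qed
    then show ?thesis using cong[of v] by (simp add: card_image)
  qed
  moreover have "subgraph (Gs (i - 1)) G" "b \<le> dtw (Gs (i - 1))" if "i \<in> {1..a}" for i
    using Gs[of "i - 1"] that by auto
  ultimately show "\<exists>Gs :: nat \<Rightarrow> digraph. (\<forall>i\<in>{1..a}. subgraph (Gs i) G) \<and>
      (\<forall>v\<in>verts G. card {i\<in>{1..a}. v \<in> verts (Gs i)} \<le> 4) \<and> (\<forall>i\<in>{1..a}. b \<le> dtw (Gs i))"
    by (intro exI[of _ "\<lambda>i. Gs (i - 1)"]) simp
qed

end
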